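(* Let $\Delta>0$ and let $(Y(t))_{t\in\mathbb{R}^d}$ be a causal CAR$(p)$ random field (that is, a causal CARMA$(p,0)$ random field) with companion matrices $A_1,\dots,A_d$, each having distinct eigenvalues, driven by a homogeneous Lévy basis $\Lambda$ with mean zero and finite second moment, whose variance $\kappa_2>0$ is given. Assume that $b_0\ge0$, that all eigenvalues $\lambda$ of $A_1,\dots,A_d$ satisfy $-\pi/\Delta\le\mathrm{Im}(\lambda)<\pi/\Delta$, and that all coefficients $d_i^*(\lambda_i)$ ($\lambda_i$ an eigenvalue of $A_i$, $i=1,\dots,d$) are nonzero. Then the parameter vector $\theta=(b_0,\lambda_{11},\dots,\lambda_{1p},\lambda_{21},\dots,\lambda_{dp})$ is uniquely determined (up to the order in which the eigenvalues of each $A_i$ are listed) by the variogram ordinates $$\{\psi(j\Delta\mathbf e_i)\colon i=1,\dots,d;\ j=0,\dots,2p+1\}.$$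
   Context: Homogeneous Lévy basis: an infinitely divisible, independently scattered random measure $\Lambda$ on $\mathbb{R}^d$ with $\mathbb{E}[e^{\mathrm{i}u\Lambda(B)}]=\exp\{\mathrm{Leb}(B)(\mathrm{i}\beta u-\tfrac12\sigma^2u^2+\int_{\mathbb{R}}(e^{\mathrm{i}uz}-1-\mathrm{i}uz\mathbf 1_{\{|z|<1\}})\,\nu(dz))\}$ for bounded Borel sets $B$; its characteristic triplet is $(\beta,\sigma^2,\nu)$. It has finite second moment iff $\int z^2\nu(dz)<\infty$, and then its variance is $\kappa_2=\sigma^2+\int z^2\nu(dz)$. Stochastic integrals are in the sense of Rajput and Rosinski. Causal CARMA$(p,q)$ random field: let $0\le q<p$ be integers, $b=(b_0,\dots,b_{p-1})^\top\in\mathbb{R}^p$ with $b_q\ne0$ and $b_i=0$ for $i>q$, $\mathbf e_p=(0,\dots,0,1)^\top\in\mathbb{R}^p$, and for $i=1,\dots,d$ let $A_i\in\mathbb{R}^{p\times p}$ be the companion matrix (ones on the superdiagonal, last row $(-a_{i,p},\dots,-a_{i,1})$, other entries $0$) of a monic real polynomial $a_i(z)=z^p+a_{i,1}z^{p-1}+\dots+a_{i,p}$ all of whose roots have strictly negative real parts. With $\Lambda$ a homogeneous Lévy basis with $\int\log(|z|)^d\mathbf 1_{\{|z|>1\}}\nu(dz)<\infty$, $$Y(t)=\int_{-\infty}^{t_1}\cdots\int_{-\infty}^{t_d}b^\top e^{A_1(t_1-s_1)}\cdots e^{A_d(t_d-s_d)}\mathbf e_p\,\Lambda(ds),\quad t\in\mathbb{R}^d.$$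 Parameters: $\lambda_{i1},\dots,\lambda_{ip}$ denote the eigenvalues of $A_i$. The variogram is $\psi(t)=\mathrm{Var}[Y(t)-Y(0)]$. The coefficients $d_i^*(\lambda_i)\in\mathbb{C}$ are those in the representation $\psi(\tau\mathbf e_i)=2\kappa_2\sum_{\lambda_i}d_i^*(\lambda_i)(1-e^{\lambda_i|\tau|})$, $\tau\in\mathbb{R}$, where $\mathbf e_i$ is the $i$-th unit vector of $\mathbb{R}^d$ and the sum runs over the distinct eigenvalues $\lambda_i$ of $A_i$. "Uniquely determined" means: two fields satisfying all the hypotheses (with the same $d,p,\Delta,\kappa_2$) and having the same listed variogram ordinates have the same parameter vector. *)

theory Defs
  imports "HOL-Probability.Probability" "HOL-Library.Multiset" "Jordan_Normal_Form.Spectral_Radius"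
begin

text \<open>The symbols \<open>$\<close> and \<open>\<bullet>\<close> are overloaded between HOL-Analysis (vectors
  \<open>real ^ 'd\<close>, points of the parameter space) and Jordan_Normal_Form (vectors and matrices of
  size \<open>p\<close>); the types decide in every occurrence below.\<close>

section \<open>Homogeneous Levy bases\<close>

definition infinitely_divisible :: "real measure \<Rightarrow> bool" where
  "infinitely_divisible \<mu> \<longleftrightarrow>
     (\<forall>n::nat. n > 0 \<longrightarrow> (\<exists>N. real_distribution N \<and>
        distr (\<Pi>\<^sub>M k\<in>{..<n}. N) borel (\<lambda>x. \<Sum>k<n. x k) = \<mu>))"

definition levy_measure :: "real measure \<Rightarrow> bool" where
  "levy_measure \<nu> \<longleftrightarrow> sets \<nu> = sets borel \<and> emeasure \<nu> {0} = 0 \<and>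
     integrable \<nu> (\<lambda>z. min 1 (z\<^sup>2))"

definition levy_exponent :: "real \<Rightarrow> real \<Rightarrow> real measure \<Rightarrow> real \<Rightarrow> complex" where
  "levy_exponent \<beta> \<sigma>2 \<nu> u =
     \<i> * \<beta> * u - \<sigma>2 * u\<^sup>2 / 2 +
     (CLINT z|\<nu>. exp (\<i> * u * z) - 1 - \<i> * u * z * indicat_real {x :: real. \<bar>x\<bar> < 1} z)"

text \<open>A random measure is only given on the bounded Borel sets; the values of \<open>\<Lambda>\<close> on other
  sets are irrelevant.\<close>

definition bounded_borel :: "('x :: euclidean_space) set set" where
  "bounded_borel = {B \<in> sets borel. bounded B}"

definition independently_scattered ::
    "'a measure \<Rightarrow> (('x :: euclidean_space) set \<Rightarrow> 'a \<Rightarrow> real) \<Rightarrow> bool" where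
  "independently_scattered M \<Lambda> \<longleftrightarrow>
     (\<forall>B :: nat \<Rightarrow> 'x set. range B \<subseteq> bounded_borel \<and> disjoint_family B \<longrightarrow>
        prob_space.indep_vars M (\<lambda>_. borel) (\<lambda>n. \<Lambda> (B n)) UNIV \<and>
        ((\<Union>n. B n) \<in> bounded_borel \<longrightarrow>
           (AE \<omega> in M. (\<lambda>n. \<Lambda> (B n) \<omega>) sums \<Lambda> (\<Union>n. B n) \<omega>)))"

definition homogeneous_levy_basis ::
    "'a measure \<Rightarrow> (('x :: euclidean_space) set \<Rightarrow> 'a \<Rightarrow> real) \<Rightarrow>
     real \<Rightarrow> real \<Rightarrow> real measure \<Rightarrow> bool" where
  "homogeneous_levy_basis M \<Lambda> \<beta> \<sigma>2 \<nu> \<longleftrightarrow>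
     prob_space M \<and> \<sigma>2 \<ge> 0 \<and> levy_measure \<nu> \<and>
     (\<forall>B\<in>bounded_borel. \<Lambda> B \<in> borel_measurable M \<and>
        infinitely_divisible (distr M borel (\<Lambda> B)) \<and>
        (\<forall>u. char (distr M borel (\<Lambda> B)) u = exp (measure lborel B * levy_exponent \<beta> \<sigma>2 \<nu> u))) \<and>
     independently_scattered M \<Lambda>"

definition levy_mean_zero ::
    "'a measure \<Rightarrow> (('x :: euclidean_space) set \<Rightarrow> 'a \<Rightarrow> real) \<Rightarrow> bool" where
  "levy_mean_zero M \<Lambda> \<longleftrightarrow> (\<forall>B\<in>bounded_borel. has_bochner_integral M (\<Lambda> B) 0)"

definition levy_finite_second_moment ::
    "'a measure \<Rightarrow> (('x :: euclidean_space) set \<Rightarrow> 'a \<Rightarrow> real) \<Rightarrow> bool" where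
  "levy_finite_second_moment M \<Lambda> \<longleftrightarrow>
     (\<forall>B\<in>bounded_borel. integrable M (\<lambda>\<omega>. (\<Lambda> B \<omega>)\<^sup>2))"

definition levy_variance :: "real \<Rightarrow> real measure \<Rightarrow> real" where
  "levy_variance \<sigma>2 \<nu> = \<sigma>2 + (LINT z|\<nu>. z\<^sup>2)"

section \<open>The stochastic integral of Rajput and Rosinski\<close>

definition tendsto_in_probability ::
    "'a measure \<Rightarrow> (nat \<Rightarrow> 'a \<Rightarrow> real) \<Rightarrow> ('a \<Rightarrow> real) \<Rightarrow> bool" where
  "tendsto_in_probability M X Z \<longleftrightarrow>
     (\<forall>\<epsilon>>0. (\<lambda>n. measure M {\<omega> \<in> space M. \<bar>X n \<omega> - Z \<omega>\<bar> \<ge> \<epsilon>}) \<longlonglongrightarrow> 0)"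

definition bounded_simple :: "('x :: euclidean_space \<Rightarrow> real) \<Rightarrow> bool" where
  "bounded_simple g \<longleftrightarrow> simple_function borel g \<and> bounded {x. g x \<noteq> 0}"

definition simple_stochastic_integral ::
    "(('x :: euclidean_space) set \<Rightarrow> 'a \<Rightarrow> real) \<Rightarrow> ('x \<Rightarrow> real) \<Rightarrow> 'x set \<Rightarrow> 'a \<Rightarrow> real" where
  "simple_stochastic_integral \<Lambda> g A \<omega> = (\<Sum>y\<in>range g - {0}. y * \<Lambda> (g -` {y} \<inter> A) \<omega>)"

text \<open>\<open>X\<close> is a version of the integral of \<open>f\<close> over the whole space. The control measure of a
  homogeneous Levy basis is a constant multiple of Lebesgue measure (positive unless \<open>\<Lambda>\<close>
  vanishes), hence the Lebesgue-almost everywhere convergence of the simple functions.\<close>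

definition has_stochastic_integral ::
    "'a measure \<Rightarrow> (('x :: euclidean_space) set \<Rightarrow> 'a \<Rightarrow> real) \<Rightarrow> ('x \<Rightarrow> real) \<Rightarrow>
     ('a \<Rightarrow> real) \<Rightarrow> bool" where
  "has_stochastic_integral M \<Lambda> f X \<longleftrightarrow>
     f \<in> borel_measurable borel \<and> X \<in> borel_measurable M \<and>
     (\<exists>g. (\<forall>n. bounded_simple (g n)) \<and>
          (AE x in lborel. (\<lambda>n. g n x) \<longlonglongrightarrow> f x) \<and>
          (\<forall>A\<in>sets borel. \<exists>Z\<in>borel_measurable M.
             tendsto_in_probability M (\<lambda>n. simple_stochastic_integral \<Lambda> (g n) A) Z) \<and>
          tendsto_in_probability M (\<lambda>n. simple_stochastic_integral \<Lambda> (g n) UNIV) X)"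

section \<open>Causal CARMA random fields\<close>

definition mat_exp :: "real mat \<Rightarrow> real mat" where
  "mat_exp A = mat (dim_row A) (dim_row A) (\<lambda>(r, c). \<Sum>k. (A ^\<^sub>m k) $$ (r, c) / fact k)"

text \<open>For \<open>a = z ^ p + a\<^sub>1 z ^ (p - 1) + \<dots> + a\<^sub>p\<close> we have \<open>coeff a c = a\<^sub>p\<^sub>-\<^sub>c\<close>, so the last row
  below is \<open>(- a\<^sub>p, \<dots>, - a\<^sub>1)\<close>.\<close>

definition companion_matrix :: "real poly \<Rightarrow> real mat" where
  "companion_matrix a = (let p = degree a in
     mat p p (\<lambda>(r, c). if r = p - 1 then - coeff a c else if c = r + 1 then 1 else 0))"

text \<open>The matrices for different coordinates need not commute, so the index type \<open>'d\<close> is linearly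
  ordered and the factors of \<open>exp (A\<^sub>1 (t\<^sub>1 - s\<^sub>1)) \<cdots> exp (A\<^sub>d (t\<^sub>d - s\<^sub>d))\<close> are taken in increasing
  order of the index. The indices of vectors of dimension \<open>p\<close> start at \<open>0\<close>, so
  \<open>unit_vec p (p - 1)\<close> is \<open>(0, \<dots>, 0, 1)\<close>.\<close>

definition carma_kernel ::
    "nat \<Rightarrow> real Matrix.vec \<Rightarrow> ('d \<Rightarrow> real mat) \<Rightarrow>
     real ^ ('d :: {finite, linorder}) \<Rightarrow> real ^ ('d :: {finite, linorder}) \<Rightarrow> real" where
  "carma_kernel p b A t s =
     (if \<forall>i. s $ i \<le> t $ i
      then b \<bullet> (foldr (\<lambda>i P. mat_exp ((t $ i - s $ i) \<cdot>\<^sub>m A i) * P)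
                  (sorted_list_of_set (UNIV :: 'd set)) (1\<^sub>m p) *\<^sub>v unit_vec p (p - 1))
      else 0)"

definition causal_CARMA_field ::
    "'a measure \<Rightarrow> ((real ^ ('d :: {finite, linorder})) set \<Rightarrow> 'a \<Rightarrow> real) \<Rightarrow>
     real \<Rightarrow> real \<Rightarrow> real measure \<Rightarrow> nat \<Rightarrow> nat \<Rightarrow> real Matrix.vec \<Rightarrow> ('d \<Rightarrow> real mat) \<Rightarrow>
     (real ^ ('d :: {finite, linorder}) \<Rightarrow> 'a \<Rightarrow> real) \<Rightarrow> bool" where
  "causal_CARMA_field M \<Lambda> \<beta> \<sigma>2 \<nu> p q b A Y \<longleftrightarrow>
     homogeneous_levy_basis M \<Lambda> \<beta> \<sigma>2 \<nu> \<and>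
     integrable \<nu> (\<lambda>z. ln \<bar>z\<bar> ^ CARD('d) * indicator {z. \<bar>z\<bar> > 1} z) \<and>
     q < p \<and> b \<in> carrier_vec p \<and> b $ q \<noteq> 0 \<and> (\<forall>k<p. k > q \<longrightarrow> b $ k = 0) \<and>
     (\<forall>i. \<exists>a. degree a = p \<and> lead_coeff a = 1 \<and>
        (\<forall>z. poly (map_poly complex_of_real a) z = 0 \<longrightarrow> Re z < 0) \<and>
        A i = companion_matrix a) \<and>
     (\<forall>t. has_stochastic_integral M \<Lambda> (carma_kernel p b A t) (Y t))"

definition causal_CAR_field ::
    "'a measure \<Rightarrow> ((real ^ ('d :: {finite, linorder})) set \<Rightarrow> 'a \<Rightarrow> real) \<Rightarrow>
     real \<Rightarrow> real \<Rightarrow> real measure \<Rightarrow> nat \<Rightarrow> real Matrix.vec \<Rightarrow> ('d \<Rightarrow> real mat) \<Rightarrow>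
     (real ^ ('d :: {finite, linorder}) \<Rightarrow> 'a \<Rightarrow> real) \<Rightarrow> bool" where
  "causal_CAR_field M \<Lambda> \<beta> \<sigma>2 \<nu> p b A Y \<longleftrightarrow> causal_CARMA_field M \<Lambda> \<beta> \<sigma>2 \<nu> p 0 b A Y"

abbreviation complex_spectrum :: "real mat \<Rightarrow> complex set" where
  "complex_spectrum A \<equiv> spectrum (map_mat complex_of_real A)"

section \<open>The variogram\<close>

definition variogram :: "'a measure \<Rightarrow> (real ^ 'd \<Rightarrow> 'a \<Rightarrow> real) \<Rightarrow> real ^ 'd \<Rightarrow> real" where
  "variogram M Y t = prob_space.variance M (\<lambda>\<omega>. Y t \<omega> - Y 0 \<omega>)"

text \<open>\<open>variogram_coeff \<psi> \<kappa>2 S i l\<close> is the coefficient \<open>d\<^sub>i\<^sup>*(l)\<close> in the representation of the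
  variogram \<open>\<psi>\<close> along the \<open>i\<close>-th axis by the eigenvalues \<open>S\<close>. The coefficients are
  unique because the functions \<open>1 - exp (l \<bar>\<tau>\<bar>)\<close> for different nonzero \<open>l\<close> are linearly
  independent.\<close>

definition variogram_coeff ::
    "(real ^ 'd \<Rightarrow> real) \<Rightarrow> real \<Rightarrow> complex set \<Rightarrow> 'd \<Rightarrow> complex \<Rightarrow> complex" where
  "variogram_coeff \<psi> \<kappa>2 S i =
     (THE c. (\<forall>l. l \<notin> S \<longrightarrow> c l = 0) \<and>
        (\<forall>\<tau>::real. complex_of_real (\<psi> (\<tau> *\<^sub>R axis i 1)) =
           2 * \<kappa>2 * (\<Sum>l\<in>S. c l * (1 - exp (l * \<bar>\<tau>\<bar>)))))"

end

theory Submission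
  imports Defs
begin

text \<open>The log-modulus of the characteristic function of \<open>\<integral> f d\<Lambda>\<close> is \<open>- \<integral> h (u f(x)) dx\<close> with
  \<open>h = - Re\<close> of the Levy exponent. For simple integrands this is independent scattering; it passes
  to the limit in the sense of Rajput and Rosinski because convergence of \<open>\<integral>\<^sub>A h (u g\<^sub>n(x)) dx\<close> for all
  Borel sets \<open>A\<close> together with \<open>g\<^sub>n \<rightarrow> f\<close> almost everywhere forces convergence in \<open>L\<^sup>1\<close>. As the
  variance is read off from the modulus of the characteristic function near \<open>0\<close>, this gives
  \<open>\<psi>(t) = \<kappa>\<^sub>2 \<integral> (f(t - s) - f(- s))\<^sup>2 ds\<close> for the kernel \<open>f\<close>.
  The companion matrices are diagonalised by Vandermonde matrices, so \<open>f\<close> is \<open>b\<^sub>0\<close> times a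
  combination of exponentials on the positive orthant, and \<open>\<psi>\<close> along an axis is a combination of the functions
  \<open>1 - exp (\<lambda> \<bar>\<tau>\<bar>)\<close>. At the points \<open>j \<Delta>\<close>, the first differences of two such combinations are sums
  of powers of at most \<open>2 p\<close> distinct nodes \<open>exp (\<lambda> \<Delta>)\<close>, so \<open>2 p\<close> of them determine the
  eigenvalues with nonzero coefficient. These determine the companion matrices, and then \<open>\<psi>\<close> is
  \<open>b\<^sub>0\<^sup>2\<close> times a known function.\<close>

text \<open>The definition of the integral gives no control in L^2: the simple functions converge
  only almost everywhere, their integrals only in probability, and \<open>Y t\<close> and
  \<open>Y 0\<close> may come with unrelated approximating sequences. Second moments cannot be
  carried to such a limit, bounded functionals such as \<open>iexp\<close> can; hence the detour
  through characteristic functions, applied directly to the difference of two integrals. The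
  hypotheses on the eigenvalues enter at separate points. The strip for the imaginary parts excludes
  aliasing, that is, different eigenvalues with the same node \<open>exp (l * \<Delta>)\<close>.
  Negative real parts keep the nodes away from \<open>1\<close>, so that taking first differences
  loses no coefficient. An eigenvalue with coefficient \<open>0\<close> would be invisible in the
  samples. The spectra of two competing matrices have together at most \<open>2 * p\<close>
  elements, which is the origin of the factor \<open>2\<close> in the number of ordinates. The sign
  condition on \<open>b $ 0\<close> selects the root of its square.\<close>

section \<open>Setwise convergence of integrals\<close>

text \<open>A gliding hump argument in the style of Vitali, Hahn and Saks: if mass \<open>\<delta> > 0\<close> were lost in the
  limit, it would escape from every set \<open>E k\<close> of an exhausting sequence on which dominated convergence
  holds, and a union \<open>A\<close> of every other difference of these sets would catch the escaping mass for
  infinitely many \<open>n\<close> and miss it for infinitely many others.\<close>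

lemma tendsto_integral_of_setwise_convergent:
  fixes h :: "nat \<Rightarrow> 'a \<Rightarrow> real" and g :: "'a \<Rightarrow> real"
  assumes "sigma_finite_measure M"
    and [measurable]: "\<And>n. integrable M (h n)" "integrable M g"
    and nonneg: "\<And>n x. h n x \<ge> 0" "\<And>x. g x \<ge> 0"
    and ae: "AE x in M. (\<lambda>n. h n x) \<longlonglongrightarrow> g x"
    and conv: "\<And>A. A \<in> sets M \<Longrightarrow> convergent (\<lambda>n. LINT x:A|M. h n x)"
  shows "(\<lambda>n. LINT x|M. h n x) \<longlonglongrightarrow> (LINT x|M. g x)"
proof -
  interpret sigma_finite_measure M by fact
  \<comment> \<open>Strict positivity of \<open>w\<close> makes
    \<open>h n x \<le> \<bar>g x\<bar> + w x\<close> hold eventually at every point of convergence,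
    even where \<open>g x = 0\<close>, so the sets \<open>E k\<close> exhaust the space up to a null
    set; integrability of \<open>w\<close> makes the bound a dominating function.\<close>
  obtain w0 where w0: "w0 \<in> borel_measurable M" "integral\<^sup>N M w0 \<noteq> \<infinity>"
      "\<And>x. x \<in> space M \<Longrightarrow> 0 < w0 x \<and> w0 x < \<infinity>"
    using Ex_finite_integrable_function by auto
  define w where "w x = enn2real (w0 x)" for x
  have w_pos: "w x > 0" if "x \<in> space M" for x
    using w0(3)[OF that] by (simp add: w_def enn2real_positive_iff less_top)
  have [measurable]: "w \<in> borel_measurable M"
    using w0(1) unfolding w_def by measurable
  have w_int: "integrable M w"
  proof (rule integrableI_bounded)
    have "(\<integral>\<^sup>+x. ennreal (norm (w x)) \<partial>M) = integral\<^sup>N M w0"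
      by (intro nn_integral_cong) (use w0(3) in \<open>simp add: w_def less_top\<close>)
    then show "(\<integral>\<^sup>+x. ennreal (norm (w x)) \<partial>M) < \<infinity>"
      using w0(2) by (simp add: less_top)
  qed measurable
  note h_int = assms(2) and g_int = assms(3)
  have [measurable]: "h n \<in> borel_measurable M" "g \<in> borel_measurable M" for n
    using h_int g_int by auto
  define E where "E k = {x \<in> space M. \<forall>n\<ge>k. h n x \<le> \<bar>g x\<bar> + w x}" for k
  have E_meas [measurable]: "E k \<in> sets M" for k
    unfolding E_def by measurable
  have E_mono: "k \<le> l \<Longrightarrow> E k \<subseteq> E l" for k l
    unfolding E_def by auto
  have E_AE: "AE x in M. x \<in> (\<Union>k. E k)"
    using ae
  proof (rule AE_mp, intro AE_I2 impI)
    fix x assume x: "x \<in> space M" and l: "(\<lambda>n. h n x) \<longlonglongrightarrow> g x"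
    have "\<forall>\<^sub>F n in sequentially. h n x < g x + w x"
      using order_tendstoD(2)[OF l, of "g x + w x"] w_pos[OF x] by simp
    then obtain k where "\<And>n. n \<ge> k \<Longrightarrow> h n x < g x + w x"
      unfolding eventually_sequentially by auto
    then have "x \<in> E k" using x unfolding E_def by (fastforce)
    then show "x \<in> (\<Union>k. E k)" by blast
  qed
  define I where "I f A = (LINT x:A|M. f x)" for f :: "'a \<Rightarrow> real" and A
  have si: "set_integrable M A f" if "integrable M f" "A \<in> sets M" for f :: "'a \<Rightarrow> real" and A
    unfolding set_integrable_def using integrable_mult_indicator[OF that(2,1)] by simp
  have I_mono: "I f A \<le> I f B" if "integrable M f" "\<And>x. f x \<ge> 0" "A \<in> sets M" "B \<in> sets M" "A \<subseteq> B" for f A B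
    unfolding I_def set_lebesgue_integral_def
    using that si[OF that(1,3)] si[OF that(1,4)] unfolding set_integrable_def
    by (intro integral_mono) (auto simp: indicator_def)
  have I_nonneg: "I f A \<ge> 0" if "\<And>x. f x \<ge> 0" for f A
    unfolding I_def set_lebesgue_integral_def using that by (intro integral_nonneg_AE) auto
  have I_Un: "I f (A \<union> B) = I f A + I f B" if "integrable M f" "A \<in> sets M" "B \<in> sets M" "A \<inter> B = {}" for f A B
    unfolding I_def using si[OF that(1)] that by (intro set_integral_Un) auto
  have L1E: "(\<lambda>n. LINT x:E k|M. \<bar>h n x - g x\<bar>) \<longlonglongrightarrow> 0" for k
  proof -
    have "(\<lambda>n. LINT x|M. indicator (E k) x *\<^sub>R \<bar>h (n + k) x - g x\<bar>) \<longlonglongrightarrow> (LINT x|M. (0::real))"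
    proof (rule integral_dominated_convergence[where w = "\<lambda>x. 2 * \<bar>g x\<bar> + w x"])
      show "integrable M (\<lambda>x. 2 * \<bar>g x\<bar> + w x)" using g_int w_int by auto
      show "AE x in M. (\<lambda>n. indicator (E k) x *\<^sub>R \<bar>h (n + k) x - g x\<bar>) \<longlonglongrightarrow> 0"
        using ae
      proof eventually_elim
        case (elim x)
        from LIMSEQ_ignore_initial_segment[OF elim, of k]
        have "(\<lambda>n. \<bar>h (n + k) x - g x\<bar>) \<longlonglongrightarrow> 0"
          by (intro tendsto_rabs_zero) (simp add: LIM_zero)
        then show ?case using tendsto_mult_right_zero[of _ _ "indicat_real (E k) x"] by simp
      qed
      show "AE x in M. norm (indicator (E k) x *\<^sub>R \<bar>h (n + k) x - g x\<bar>) \<le> 2 * \<bar>g x\<bar> + w x" for n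
      proof (rule AE_I2)
        fix x assume x: "x \<in> space M"
        show "norm (indicator (E k) x *\<^sub>R \<bar>h (n + k) x - g x\<bar>) \<le> 2 * \<bar>g x\<bar> + w x"
        proof (cases "x \<in> E k")
          case True
          then have "h (n + k) x \<le> \<bar>g x\<bar> + w x" by (auto simp: E_def)
          with nonneg(1)[of "n + k" x] True abs_triangle_ineq4[of "h (n + k) x" "g x"] show ?thesis by simp
        next
          case False then show ?thesis using w_pos[OF x] by simp
        qed
      qed
    qed measurable
    then show ?thesis unfolding set_lebesgue_integral_def by (simp add: LIMSEQ_offset[of _ k])
  qed
  \<comment> \<open>The estimate is uniform over all \<open>A \<subseteq> E k\<close>. This lets
    \<open>nn j\<close> be chosen before the final set \<open>A\<close> exists and still be applied
    to \<open>A \<inter> E (kk j)\<close>.\<close>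
  have diff_le: "\<bar>I (h n) A - I g A\<bar> \<le> (LINT x:E k|M. \<bar>h n x - g x\<bar>)" if "A \<in> sets M" "A \<subseteq> E k" for n A k
  proof -
    have "I (h n) A - I g A = (LINT x:A|M. h n x - g x)"
      unfolding I_def using si h_int g_int that by (intro set_integral_diff(2)[symmetric]) auto
    also have "\<bar>\<dots>\<bar> \<le> (LINT x:A|M. \<bar>h n x - g x\<bar>)"
      unfolding set_lebesgue_integral_def
      by (rule order_trans[OF integral_abs_bound]) (simp add: abs_mult)
    also have "\<dots> \<le> (LINT x:E k|M. \<bar>h n x - g x\<bar>)"
      using I_mono[of "\<lambda>x. \<bar>h n x - g x\<bar>" A "E k"] h_int g_int that unfolding I_def by auto
    finally show ?thesis .
  qed
  have I_E: "(\<lambda>k. I f (A \<inter> E k)) \<longlonglongrightarrow> I f A" if f: "integrable M f" and A[measurable]: "A \<in> sets M" for f A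
    unfolding I_def set_lebesgue_integral_def
  proof (rule integral_dominated_convergence[where w = "\<lambda>x. \<bar>f x\<bar>"])
    show "AE x in M. (\<lambda>k. indicator (A \<inter> E k) x *\<^sub>R f x) \<longlonglongrightarrow> indicator A x *\<^sub>R f x"
      using E_AE
    proof eventually_elim
      case (elim x)
      then obtain k where k: "x \<in> E k" by auto
      have "\<forall>\<^sub>F l in sequentially. indicator (A \<inter> E l) x *\<^sub>R f x = indicator A x *\<^sub>R f x"
        using eventually_ge_at_top[of k] by eventually_elim (use k E_mono in \<open>auto simp: indicator_def\<close>)
      then show ?case by (rule tendsto_eventually)
    qed
  qed (use f in \<open>auto simp: indicator_def\<close>)
  have IS: "I f (space M) = (LINT x|M. f x)" for f
    unfolding I_def by (simp add: set_integral_space set_lebesgue_integral_def cong: Bochner_Integration.integral_cong)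
  have I_compl: "I f (space M - E k) = I f (space M) - I f (E k)" if "integrable M f" for f k
    using I_Un[OF that, of "E k" "space M - E k"] sets.sets_into_space[OF E_meas[of k]]
    by (simp add: Un_absorb1)
  have cE: "(\<lambda>n. I (h n) (E k)) \<longlonglongrightarrow> I g (E k)" for k
    by (rule LIM_zero_cancel, rule Lim_null_comparison[OF _ L1E[of k]])
       (use diff_le[of "E k" k] in auto)
  obtain L where L: "(\<lambda>n. I (h n) (space M)) \<longlonglongrightarrow> L"
    using conv[of "space M"] unfolding I_def convergent_def by auto
  have "I g (E k) \<le> L" for k
    using I_mono[OF h_int nonneg(1) E_meas, of "space M"] sets.sets_into_space[OF E_meas]
    by (intro LIMSEQ_le[OF cE L]) auto
  moreover have "(\<lambda>k. I g (E k)) \<longlonglongrightarrow> I g (space M)"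
    using I_E[OF g_int, of "space M"] sets.sets_into_space[OF E_meas] by (simp add: Int_absorb1)
  ultimately have g_le: "I g (space M) \<le> L"
    by (intro LIMSEQ_le_const2) auto
  have "\<not> I g (space M) < L"
  proof
    assume less: "I g (space M) < L"
    define \<delta> where "\<delta> = L - I g (space M)"
    have \<delta>: "\<delta> > 0" using less by (simp add: \<delta>_def)
    \<comment> \<open>In the limit a mass of at least \<open>\<delta>\<close> remains off every
      \<open>E k\<close>, because \<open>I g (E k) \<le> I g (space M)\<close>. Each approximation
      below is allowed an error of \<open>\<delta> / 8\<close>.\<close>
    have ex_n: "\<exists>n. (LINT x:E k|M. \<bar>h n x - g x\<bar>) < \<delta> / 8 \<and> I (h n) (space M - E k) > 7 * \<delta> / 8 \<and> n \<ge> j" for k j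
    proof -
      have "I g (E k) \<le> I g (space M)"
        using sets.sets_into_space[OF E_meas] by (intro I_mono g_int nonneg(2)) auto
      then have "(\<lambda>n. I (h n) (space M - E k)) \<longlonglongrightarrow> L - I g (E k)" "L - I g (E k) \<ge> \<delta>"
        using tendsto_diff[OF L cE[of k]] by (auto simp: I_compl[OF h_int] \<delta>_def)
      then have "\<forall>\<^sub>F n in sequentially. I (h n) (space M - E k) > 7 * \<delta> / 8"
        using \<delta> by (intro order_tendstoD(1)) auto
      moreover have "\<forall>\<^sub>F n in sequentially. (LINT x:E k|M. \<bar>h n x - g x\<bar>) < \<delta> / 8"
        using \<delta> by (intro order_tendstoD(2)[OF L1E]) auto
      ultimately have "\<forall>\<^sub>F n in sequentially. (LINT x:E k|M. \<bar>h n x - g x\<bar>) < \<delta> / 8 \<and> I (h n) (space M - E k) > 7 * \<delta> / 8 \<and> n \<ge> j"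
        using eventually_ge_at_top[of j] by eventually_elim auto
      then show ?thesis by (rule eventually_happens'[rotated]) simp
    qed
    have ex_k: "\<exists>l>k. I (h n) (space M - E l) < \<delta> / 8" for n k
    proof -
      have "(\<lambda>l. I (h n) (E l)) \<longlonglongrightarrow> I (h n) (space M)"
        using I_E[OF h_int, of "space M"] sets.sets_into_space[OF E_meas] by (simp add: Int_absorb1)
      then have "(\<lambda>l. I (h n) (space M - E l)) \<longlonglongrightarrow> 0"
        unfolding I_compl[OF h_int] using tendsto_diff[OF tendsto_const[of "I (h n) (space M)"]] by fastforce
      then have "\<forall>\<^sub>F l in sequentially. I (h n) (space M - E l) < \<delta> / 8 \<and> l > k"
        using \<delta> eventually_gt_at_top[of k] by (intro eventually_conj order_tendstoD(2)[where y = 0]) auto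
      then show ?thesis using eventually_happens'[of sequentially] by fastforce
    qed
    define N where "N k j = (SOME n. (LINT x:E k|M. \<bar>h n x - g x\<bar>) < \<delta> / 8 \<and> I (h n) (space M - E k) > 7 * \<delta> / 8 \<and> n \<ge> j)" for k j
    define K where "K n k = (SOME l. l > k \<and> I (h n) (space M - E l) < \<delta> / 8)" for n k
    have N: "(LINT x:E k|M. \<bar>h (N k j) x - g x\<bar>) < \<delta> / 8" "I (h (N k j)) (space M - E k) > 7 * \<delta> / 8" "N k j \<ge> j" for k j
      using someI_ex[OF ex_n[of k j]] unfolding N_def by auto
    have K: "K n k > k" "I (h n) (space M - E (K n k)) < \<delta> / 8" for n k
      using someI_ex[OF ex_k[of k n]] unfolding K_def by auto
    \<comment> \<open>From \<open>k = kk j\<close> the index \<open>nn j \<ge> j\<close> is picked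
      so that \<open>h (nn j)\<close> is close to \<open>g\<close> inside \<open>E k\<close> and has
      mass above \<open>7 * \<delta> / 8\<close> outside; the next \<open>kk\<close> is so large
      that less than \<open>\<delta> / 8\<close> lies beyond it. The hump of more than
      \<open>6 * \<delta> / 8\<close> sits in the ring \<open>R j\<close>.\<close>
    define kk where "kk = rec_nat 0 (\<lambda>j k. K (N k j) k)"
    have kk_Suc: "kk (Suc j) = K (N (kk j) j) (kk j)" for j by (simp add: kk_def)
    define nn where "nn j = N (kk j) j" for j
    have smono: "strict_mono kk"
      using K(1) by (intro strict_monoI_Suc) (simp add: kk_Suc)
    define R where "R j = E (kk (Suc j)) - E (kk j)" for j
    define A where "A = (\<Union>j. R (2 * j))"
    have [measurable]: "R j \<in> sets M" "A \<in> sets M" for j unfolding R_def A_def by measurable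
    have R_disj: "R i \<inter> R j = {}" if "i < j" for i j
    proof -
      have "kk (Suc i) \<le> kk j" using that smono by (simp add: strict_mono_less_eq)
      then show ?thesis using E_mono unfolding R_def by blast
    qed
    have bound: "\<bar>I (h (nn j)) (A \<inter> E (kk j)) - I g (A \<inter> E (kk j))\<bar> < \<delta> / 8" for j
      using diff_le[of "A \<inter> E (kk j)" "kk j" "nn j"] N(1)[of "kk j" j] unfolding nn_def by force
    have split3: "I (h n) A = I (h n) (A \<inter> E (kk j)) + I (h n) (A \<inter> R j) + I (h n) (A - E (kk (Suc j)))" for n j
    proof -
      have "kk j \<le> kk (Suc j)" using smono by (simp add: strict_mono_less_eq)
      then have "A = (A \<inter> E (kk j) \<union> A \<inter> R j) \<union> (A - E (kk (Suc j)))"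
        using E_mono[of "kk j" "kk (Suc j)"] unfolding R_def by blast
      moreover have "(A \<inter> E (kk j) \<union> A \<inter> R j) \<inter> (A - E (kk (Suc j))) = {}" "(A \<inter> E (kk j)) \<inter> (A \<inter> R j) = {}"
        using \<open>kk j \<le> kk (Suc j)\<close> E_mono[of "kk j" "kk (Suc j)"] unfolding R_def by blast+
      ultimately show ?thesis
        using I_Un[OF h_int, of "A \<inter> E (kk j) \<union> A \<inter> R j" "A - E (kk (Suc j))"] I_Un[OF h_int, of "A \<inter> E (kk j)" "A \<inter> R j"]
        by simp
    qed
    have A_sub: "A \<subseteq> space M" by (rule sets.sets_into_space) measurable
    have tail: "I (h (nn j)) (A - E (kk (Suc j))) < \<delta> / 8" for j
    proof -
      have "I (h (nn j)) (A - E (kk (Suc j))) \<le> I (h (nn j)) (space M - E (kk (Suc j)))"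
        using A_sub by (intro I_mono h_int nonneg(1)) auto
      then show ?thesis using K(2)[of "nn j" "kk j"] by (simp add: kk_Suc nn_def)
    qed
    have mid_even: "I (h (nn (2 * j))) (A \<inter> R (2 * j)) > 6 * \<delta> / 8" for j
    proof -
      have "A \<inter> R (2 * j) = R (2 * j)" unfolding A_def by blast
      moreover have "space M - E (kk (2*j)) = R (2*j) \<union> (space M - E (kk (Suc (2*j))))"
        using smono E_mono[of "kk (2*j)" "kk (Suc (2*j))"] sets.sets_into_space[OF E_meas]
        unfolding R_def by (auto simp: strict_mono_less_eq)
      then have "I (h n) (space M - E (kk (2*j))) = I (h n) (R (2*j)) + I (h n) (space M - E (kk (Suc (2*j))))" for n
        using I_Un[OF h_int, of "R (2*j)" "space M - E (kk (Suc (2*j)))"] unfolding R_def by auto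
      ultimately show ?thesis
        using N(2)[of "kk (2*j)" "2*j"] K(2)[of "nn (2*j)" "kk (2*j)"]
        unfolding nn_def[symmetric] kk_Suc[of "2*j", folded nn_def, symmetric] by simp
    qed
    have mid_odd: "I f (A \<inter> R (Suc (2 * j))) = 0" for f j
    proof -
      have "R (2 * i) \<inter> R (Suc (2 * j)) = {}" for i
        using R_disj[of "2*i" "Suc (2*j)"] R_disj[of "Suc (2*j)" "2*i"] by (cases "i \<le> j") auto
      then have "A \<inter> R (Suc (2 * j)) = {}" unfolding A_def by blast
      then show ?thesis by (simp add: I_def set_lebesgue_integral_def)
    qed
    obtain a where a: "(\<lambda>n. I (h n) A) \<longlonglongrightarrow> a"
      using conv[of A] unfolding I_def convergent_def by auto
    have nn_lim: "filterlim nn at_top sequentially"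
      using N(3) unfolding nn_def by (intro filterlim_at_top_mono[OF filterlim_ident]) auto
    have kk_lim: "filterlim kk at_top sequentially" using smono by (rule filterlim_subseq)
    have Ak: "(\<lambda>j. I g (A \<inter> E (kk j))) \<longlonglongrightarrow> I g A"
      by (rule filterlim_compose[OF I_E[OF g_int] kk_lim]) measurable
    have ev: "filterlim (\<lambda>j::nat. 2 * j) at_top sequentially" "filterlim (\<lambda>j::nat. Suc (2 * j)) at_top sequentially"
      by (auto intro!: filterlim_subseq strict_monoI)
    have aj: "(\<lambda>j. I (h (nn j)) A) \<longlonglongrightarrow> a" by (rule filterlim_compose[OF a nn_lim])
    \<comment> \<open>Along even \<open>j\<close> the ring contributes its hump and the inner error
      costs \<open>\<delta> / 8\<close>, a gain of \<open>5 * \<delta> / 8\<close> over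
      \<open>g\<close>; along odd \<open>j\<close> the ring misses \<open>A\<close>, leaving one
      inner error and one tail, at most \<open>2 * \<delta> / 8\<close>. Both subsequences have the
      limit \<open>a\<close>.\<close>
    have "I g A + 5 * \<delta> / 8 \<le> a"
    proof (rule LIMSEQ_le)
      show "(\<lambda>j. I g (A \<inter> E (kk (2 * j))) + 5 * \<delta> / 8) \<longlonglongrightarrow> I g A + 5 * \<delta> / 8"
        by (intro tendsto_add tendsto_const filterlim_compose[OF Ak ev(1)])
      show "(\<lambda>j. I (h (nn (2 * j))) A) \<longlonglongrightarrow> a" by (rule filterlim_compose[OF aj ev(1)])
      have "I g (A \<inter> E (kk (2 * j))) + 5 * \<delta> / 8 \<le> I (h (nn (2 * j))) A" for j
        using split3[of "nn (2*j)" "2*j"] bound[of "2*j"] mid_even[of j]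
          I_nonneg[of "h (nn (2*j))" "A - E (kk (Suc (2*j)))", OF nonneg(1)] by linarith
      then show "\<exists>N. \<forall>j\<ge>N. I g (A \<inter> E (kk (2 * j))) + 5 * \<delta> / 8 \<le> I (h (nn (2 * j))) A" by blast
    qed
    moreover have "a \<le> I g A + 2 * \<delta> / 8"
    proof (rule LIMSEQ_le)
      show "(\<lambda>j. I g (A \<inter> E (kk (Suc (2 * j)))) + 2 * \<delta> / 8) \<longlonglongrightarrow> I g A + 2 * \<delta> / 8"
        by (intro tendsto_add tendsto_const filterlim_compose[OF Ak ev(2)])
      show "(\<lambda>j. I (h (nn (Suc (2 * j)))) A) \<longlonglongrightarrow> a" by (rule filterlim_compose[OF aj ev(2)])
      have "I (h (nn (Suc (2 * j)))) A \<le> I g (A \<inter> E (kk (Suc (2 * j)))) + 2 * \<delta> / 8" for j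
        using split3[of "nn (Suc (2*j))" "Suc (2*j)"] bound[of "Suc (2*j)"] mid_odd[of "h (nn (Suc (2*j)))" j]
          tail[of "Suc (2*j)"] by linarith
      then show "\<exists>N. \<forall>j\<ge>N. I (h (nn (Suc (2 * j)))) A \<le> I g (A \<inter> E (kk (Suc (2 * j)))) + 2 * \<delta> / 8" by blast
    qed
    ultimately show False using \<delta> by linarith
  qed
  with g_le have "I g (space M) = L" by simp
  with L show ?thesis by (simp add: IS)
qed

section \<open>Characteristic functions and variance\<close>

lemma one_minus_cos_le: "1 - cos (t::real) \<le> t\<^sup>2 / 2"
proof -
  have "1 - cos t = 2 * (sin (t / 2))\<^sup>2"
    using cos_double_sin[of "t / 2"] by simp
  also have "(sin (t / 2))\<^sup>2 \<le> (t / 2)\<^sup>2"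
    using abs_sin_x_le_abs_x[of "t / 2"] unfolding abs_le_square_iff .
  finally show ?thesis by (simp add: power_divide)
qed

lemma tendsto_one_minus_cos_over_square:
  fixes u :: "nat \<Rightarrow> real"
  assumes "u \<longlonglongrightarrow> 0" "\<And>n. u n \<noteq> 0"
  shows "(\<lambda>n. (1 - cos (u n * w)) / (u n)\<^sup>2) \<longlonglongrightarrow> w\<^sup>2 / 2"
proof -
  have "((\<lambda>x. sin (x * (w / 2))) has_real_derivative w / 2) (at 0)"
    by (auto intro!: derivative_eq_intros)
  then have "((\<lambda>x. sin (x * (w / 2)) / x) \<longlongrightarrow> w / 2) (at 0)"
    by (simp add: has_field_derivative_iff)
  then have "(\<lambda>n. sin (u n * (w / 2)) / u n) \<longlonglongrightarrow> w / 2"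
    by (rule filterlim_compose) (use assms in \<open>auto simp: filterlim_at\<close>)
  then have "(\<lambda>n. 2 * (sin (u n * (w / 2)) / u n)\<^sup>2) \<longlonglongrightarrow> 2 * (w / 2)\<^sup>2"
    by (intro tendsto_mult tendsto_const tendsto_power)
  moreover have "(\<lambda>n. 2 * (sin (u n * (w / 2)) / u n)\<^sup>2) = (\<lambda>n. (1 - cos (u n * w)) / (u n)\<^sup>2)"
    using cos_double_sin[of "u _ * w / 2"] by (simp add: power_divide)
  ultimately have "(\<lambda>n. (1 - cos (u n * w)) / (u n)\<^sup>2) \<longlonglongrightarrow> 2 * (w / 2)\<^sup>2" by (simp only:)
  then show ?thesis by (simp add: power_divide)
qed

lemma cmod_iexp_diff_le: "cmod (iexp a - iexp b) \<le> \<bar>a - b\<bar>"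
proof -
  have "iexp a - iexp b = iexp b * (iexp (a - b) - 1)"
    by (simp add: algebra_simps flip: exp_add)
  then have "cmod (iexp a - iexp b) = cmod (iexp (a - b) - 1)"
    by (simp add: norm_mult)
  also have "\<dots> \<le> \<bar>a - b\<bar>"
    using iexp_approx1[of "a - b" 0] by simp
  finally show ?thesis .
qed

lemma cmod_iexp_diff_le_2: "cmod (iexp a - iexp b) \<le> 2"
  using norm_triangle_ineq4[of "iexp a" "iexp b"] by simp

lemma (in prob_space) integrable_iexp_real:
  assumes "f \<in> borel_measurable M"
  shows "integrable M (\<lambda>\<omega>. iexp (f \<omega>))"
  using assms by (intro integrable_iexp) auto

lemma (in prob_space) integrable_cmod_iexp_diff:
  assumes [measurable]: "f \<in> borel_measurable M" "g \<in> borel_measurable M"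
  shows "integrable M (\<lambda>\<omega>. cmod (iexp (f \<omega>) - iexp (g \<omega>)))"
  by (intro integrable_norm Bochner_Integration.integrable_diff integrable_iexp_real) measurable

lemma (in prob_space) char_distr:
  assumes [measurable]: "X \<in> borel_measurable M"
  shows "char (distr M borel X) u = (CLINT \<omega>|M. iexp (u * X \<omega>))"
  unfolding char_def by (subst integral_distr) auto

text \<open>The two projections of the product space provide the independent copies, and
  \<open>cos (a - b) = cos a * cos b + sin a * sin b\<close> integrates by Fubini to the sum of the
  squared real and imaginary parts.\<close>

lemma (in prob_space) cmod_char_square:
  assumes [measurable]: "X \<in> borel_measurable M"
  shows "(cmod (char (distr M borel X) u))\<^sup>2 =
    (LINT z|(M \<Otimes>\<^sub>M M). cos (u * (X (fst z) - X (snd z))))"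
proof -
  interpret P: pair_prob_space M M ..
  have i: "integrable M (\<lambda>\<omega>. iexp (u * X \<omega>))" by (intro integrable_iexp_real) measurable
  define C S where "C = (LINT \<omega>|M. cos (u * X \<omega>))" and "S = (LINT \<omega>|M. sin (u * X \<omega>))"
  have ic: "integrable M (\<lambda>\<omega>. cos (u * X \<omega>))" and iS: "integrable M (\<lambda>\<omega>. sin (u * X \<omega>))"
    by (auto intro!: integrable_const_bound[where B = 1])
  have "Re (char (distr M borel X) u) = C" "Im (char (distr M borel X) u) = S"
    unfolding char_distr[OF assms] C_def S_def integral_Re[OF i, symmetric] integral_Im[OF i, symmetric]
    by (auto simp: Re_exp Im_exp simp del: of_real_mult)
  then have "(cmod (char (distr M borel X) u))\<^sup>2 = C * C + S * S"
    by (simp add: cmod_power2) (simp add: power2_eq_square)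
  also have "\<dots> = (LINT x|M. cos (u * X x) * C + sin (u * X x) * S)"
    using ic iS by (simp add: C_def S_def)
  also have "\<dots> = (LINT x|M. LINT y|M. cos (u * (X x - X y)))"
    using ic iS by (simp add: C_def S_def cos_diff right_diff_distrib)
  also have "\<dots> = (LINT z|(M \<Otimes>\<^sub>M M). cos (u * (X (fst z) - X (snd z))))"
    by (subst P.integral_fst'[symmetric]) (auto intro!: P.P.integrable_const_bound[where B = 1])
  finally show ?thesis .
qed

text \<open>The squared modulus is the characteristic function of \<open>X - X'\<close> for an independent copy \<open>X'\<close> of
  \<open>X\<close>, and the second moment of \<open>X - X'\<close> is twice the variance; that it is finite follows from Fatou's
  lemma.\<close>

lemma (in prob_space) variance_eq_limit_char:
  fixes u :: "nat \<Rightarrow> real"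
  assumes [measurable]: "X \<in> borel_measurable M"
    and u: "u \<longlonglongrightarrow> 0" "\<And>n. u n \<noteq> 0"
    and lim: "(\<lambda>n. (1 - (cmod (char (distr M borel X) (u n)))\<^sup>2) / (u n)\<^sup>2) \<longlonglongrightarrow> v"
  shows "variance X = v"
proof -
  interpret P: pair_prob_space M M ..
  define W where "W z = X (fst z) - X (snd z)" for z
  have [measurable]: "W \<in> borel_measurable (M \<Otimes>\<^sub>M M)" unfolding W_def by measurable
  define Q where "Q n z = (1 - cos (u n * W z)) / (u n)\<^sup>2" for n z
  have [measurable]: "Q n \<in> borel_measurable (M \<Otimes>\<^sub>M M)" for n unfolding Q_def by measurable
  have Q_nonneg: "Q n z \<ge> 0" for n z unfolding Q_def by simp
  have Q_le: "Q n z \<le> (W z)\<^sup>2 / 2" for n z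
    using one_minus_cos_le[of "u n * W z"] u(2)[of n]
    by (simp add: Q_def divide_simps power_mult_distrib) (simp add: mult_ac)
  have Q_lim: "(\<lambda>n. Q n z) \<longlonglongrightarrow> (W z)\<^sup>2 / 2" for z
    unfolding Q_def by (rule tendsto_one_minus_cos_over_square[OF u])
  have ic: "integrable (M \<Otimes>\<^sub>M M) (\<lambda>z. cos (u n * W z))" for n
    by (auto intro!: P.P.integrable_const_bound[where B = 1])
  have Q_int: "integrable (M \<Otimes>\<^sub>M M) (Q n)" for n
    unfolding Q_def using ic by auto
  have "(LINT z|(M \<Otimes>\<^sub>M M). Q n z) = (1 - (cmod (char (distr M borel X) (u n)))\<^sup>2) / (u n)\<^sup>2" for n
    unfolding Q_def cmod_char_square[OF assms(1)] using ic[of n] by (simp add: W_def P.P.prob_space)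
  with lim have lim': "(\<lambda>n. LINT z|(M \<Otimes>\<^sub>M M). Q n z) \<longlonglongrightarrow> v" by simp
  have "(\<integral>\<^sup>+z. ennreal ((W z)\<^sup>2 / 2) \<partial>(M \<Otimes>\<^sub>M M)) = (\<integral>\<^sup>+z. liminf (\<lambda>n. ennreal (Q n z)) \<partial>(M \<Otimes>\<^sub>M M))"
  proof (rule nn_integral_cong)
    fix z
    have "(\<lambda>n. ennreal (Q n z)) \<longlonglongrightarrow> ennreal ((W z)\<^sup>2 / 2)" by (intro tendsto_ennrealI Q_lim)
    from lim_imp_Liminf[OF _ this] show "ennreal ((W z)\<^sup>2 / 2) = liminf (\<lambda>n. ennreal (Q n z))" by simp
  qed
  also have "\<dots> \<le> liminf (\<lambda>n. \<integral>\<^sup>+z. ennreal (Q n z) \<partial>(M \<Otimes>\<^sub>M M))"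
    by (rule nn_integral_liminf) measurable
  also have "\<dots> = liminf (\<lambda>n. ennreal (LINT z|(M \<Otimes>\<^sub>M M). Q n z))"
    using Q_int Q_nonneg by (simp add: nn_integral_eq_integral)
  also have "\<dots> = ennreal v"
    using lim_imp_Liminf[OF _ tendsto_ennrealI[OF lim']] by simp
  finally have "(\<integral>\<^sup>+z. ennreal ((W z)\<^sup>2 / 2) \<partial>(M \<Otimes>\<^sub>M M)) < \<infinity>"
    by (simp add: le_less_trans[OF _ ennreal_less_top])
  then have W_int2: "integrable (M \<Otimes>\<^sub>M M) (\<lambda>z. (W z)\<^sup>2 / 2)"
    by (intro integrableI_nonneg) auto
  have "(\<lambda>n. LINT z|(M \<Otimes>\<^sub>M M). Q n z) \<longlonglongrightarrow> (LINT z|(M \<Otimes>\<^sub>M M). (W z)\<^sup>2 / 2)"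
    by (rule integral_dominated_convergence[OF _ _ W_int2])
       (use Q_lim Q_le Q_nonneg in \<open>auto simp del: times_divide_eq_right\<close>)
  then have v: "v = (LINT z|(M \<Otimes>\<^sub>M M). (W z)\<^sup>2 / 2)" by (rule LIMSEQ_unique[OF lim'])
  \<comment> \<open>Fubini fixes a point \<open>x0\<close> for which \<open>X x0 - X y\<close> is
    square integrable in \<open>y\<close>; since \<open>X x0\<close> is a constant, this bounds the
    second moment of \<open>X\<close> itself. Without it the Bochner integrals in
    \<open>variance\<close> could be the default value \<open>0\<close>.\<close>
  have "AE x in M. integrable M (\<lambda>y. (W (x, y))\<^sup>2 / 2)"
    using P.AE_integrable_fst'[OF W_int2] .
  then obtain x0 where x0: "integrable M (\<lambda>y. (W (x0, y))\<^sup>2 / 2)"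
    using eventually_happens'[OF ae_filter_bot] by blast
  have X2: "integrable M (\<lambda>y. (X y)\<^sup>2)"
  proof (rule Bochner_Integration.integrable_bound)
    show "integrable M (\<lambda>y. 4 * ((W (x0, y))\<^sup>2 / 2) + 2 * (X x0)\<^sup>2)" by (intro Bochner_Integration.integrable_add integrable_mult_right x0) simp
    have "(X y)\<^sup>2 \<le> 4 * ((W (x0, y))\<^sup>2 / 2) + 2 * (X x0)\<^sup>2" for y
      using zero_le_power2[of "X y - 2 * X x0"] unfolding W_def fst_conv snd_conv power2_diff power_mult_distrib by (simp add: field_simps)
    then show "AE y in M. norm ((X y)\<^sup>2) \<le> norm (4 * ((W (x0, y))\<^sup>2 / 2) + 2 * (X x0)\<^sup>2)" by simp
  qed simp
  then have X1: "integrable M X" by (rule square_integrable_imp_integrable[rotated]) simp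
  have "v = (LINT x|M. LINT y|M. (X x)\<^sup>2 / 2 - X x * X y + (X y)\<^sup>2 / 2)"
    unfolding v by (subst P.integral_fst'[OF W_int2, symmetric])
      (simp add: W_def power2_diff diff_divide_distrib add_divide_distrib algebra_simps)
  also have "\<dots> = (LINT x|M. (X x)\<^sup>2 / 2 - X x * expectation X + expectation (\<lambda>y. (X y)\<^sup>2) / 2)"
    using X1 X2 by (simp add: prob_space)
  also have "\<dots> = expectation (\<lambda>y. (X y)\<^sup>2) - (expectation X)\<^sup>2"
    using X1 X2 by (simp add: prob_space power2_eq_square)
  also have "\<dots> = variance X" using variance_eq[OF X1 X2] by simp
  finally show ?thesis by simp
qed

text \<open>Centring only multiplies the characteristic function by a phase, so its modulus is at
  least the expectation of \<open>cos (u * (X \<omega> - m))\<close>, to which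
  \<open>one_minus_cos_le\<close> applies. This converts a finite variance of the Levy basis into an
  upper bound for \<open>levy_re\<close>.\<close>

lemma (in prob_space) char_lower_bound:
  assumes [measurable]: "X \<in> borel_measurable M" and X2: "integrable M (\<lambda>\<omega>. (X \<omega>)\<^sup>2)"
  shows "1 - u\<^sup>2 * variance X / 2 \<le> cmod (char (distr M borel X) u)"
proof -
  have X1: "integrable M X" using X2 by (rule square_integrable_imp_integrable[rotated]) simp
  define m where "m = expectation X"
  have i: "integrable M (\<lambda>\<omega>. iexp (u * (X \<omega> - m)))"
    by (intro integrable_const_bound[where B = 1]) auto
  have V: "integrable M (\<lambda>\<omega>. (X \<omega> - m)\<^sup>2)"
    using X1 X2 by (auto simp: power2_diff)
  have "1 - u\<^sup>2 * variance X / 2 = (LINT \<omega>|M. 1 - u\<^sup>2 * (X \<omega> - m)\<^sup>2 / 2)"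
    using V by (simp add: prob_space m_def)
  also have "\<dots> \<le> (LINT \<omega>|M. cos (u * (X \<omega> - m)))"
  proof (rule integral_mono)
    show "integrable M (\<lambda>\<omega>. 1 - u\<^sup>2 * (X \<omega> - m)\<^sup>2 / 2)" using V by auto
    show "integrable M (\<lambda>\<omega>. cos (u * (X \<omega> - m)))" by (intro integrable_const_bound[where B = 1]) auto
    show "1 - u\<^sup>2 * (X \<omega> - m)\<^sup>2 / 2 \<le> cos (u * (X \<omega> - m))" for \<omega>
      using one_minus_cos_le[of "u * (X \<omega> - m)"] by (simp add: power_mult_distrib)
  qed
  also have "\<dots> = Re (CLINT \<omega>|M. iexp (u * (X \<omega> - m)))"
    by (subst integral_Re[OF i, symmetric]) (simp add: Re_exp)
  also have "\<dots> \<le> cmod (CLINT \<omega>|M. iexp (u * (X \<omega> - m)))" by (rule complex_Re_le_cmod)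
  also have "(CLINT \<omega>|M. iexp (u * (X \<omega> - m))) = (CLINT \<omega>|M. iexp (- u * m) * iexp (u * X \<omega>))"
    by (intro Bochner_Integration.integral_cong) (auto simp: algebra_simps simp flip: exp_add)
  also have "\<dots> = iexp (- u * m) * char (distr M borel X) u"
    by (simp add: char_distr)
  also have "cmod \<dots> = cmod (char (distr M borel X) u)" by (simp add: norm_mult)
  finally show ?thesis .
qed

text \<open>The integrand is at most
  \<open>\<bar>u\<bar> * \<bar>X n \<omega> - Z \<omega>\<bar>\<close> and at most \<open>2\<close>:
  the first bound serves where the distance is below \<open>\<epsilon>\<close>, the second on the
  event whose probability tends to \<open>0\<close>.\<close>

lemma (in prob_space) tendsto_in_probability_iexp:
  assumes [measurable]: "\<And>n. X n \<in> borel_measurable M" "Z \<in> borel_measurable M"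
    and conv: "tendsto_in_probability M X Z"
  shows "(\<lambda>n. LINT \<omega>|M. cmod (iexp (u * X n \<omega>) - iexp (u * Z \<omega>))) \<longlonglongrightarrow> 0"
proof (rule order_tendstoI)
  fix a :: real assume "a < 0"
  moreover have "0 \<le> (LINT \<omega>|M. cmod (iexp (u * X n \<omega>) - iexp (u * Z \<omega>)))" for n by simp
  ultimately show "\<forall>\<^sub>F n in sequentially. a < (LINT \<omega>|M. cmod (iexp (u * X n \<omega>) - iexp (u * Z \<omega>)))"
    by (intro always_eventually allI) (rule less_le_trans)
next
  fix a :: real assume a: "0 < a"
  define \<epsilon> where "\<epsilon> = a / (2 * (\<bar>u\<bar> + 1))"
  have \<epsilon>: "\<epsilon> > 0" "\<bar>u\<bar> * \<epsilon> < a / 2" using a by (auto simp: \<epsilon>_def field_simps)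
  define B where "B n = {\<omega> \<in> space M. \<bar>X n \<omega> - Z \<omega>\<bar> \<ge> \<epsilon>}" for n
  have [measurable]: "B n \<in> sets M" for n unfolding B_def by measurable
  have "(LINT \<omega>|M. cmod (iexp (u * X n \<omega>) - iexp (u * Z \<omega>))) \<le> a / 2 + 2 * measure M (B n)" for n
  proof -
    have "(LINT \<omega>|M. cmod (iexp (u * X n \<omega>) - iexp (u * Z \<omega>))) \<le> (LINT \<omega>|M. a / 2 + 2 * indicator (B n) \<omega>)"
    proof (rule integral_mono_AE)
      show "integrable M (\<lambda>\<omega>. cmod (iexp (u * X n \<omega>) - iexp (u * Z \<omega>)))"
        by (intro integrable_cmod_iexp_diff) measurable
      show "AE \<omega> in M. cmod (iexp (u * X n \<omega>) - iexp (u * Z \<omega>)) \<le> a / 2 + 2 * indicator (B n) \<omega>"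
      proof (rule AE_I2)
        fix \<omega> assume \<omega>: "\<omega> \<in> space M"
        show "cmod (iexp (u * X n \<omega>) - iexp (u * Z \<omega>)) \<le> a / 2 + 2 * indicator (B n) \<omega>"
        proof (cases "\<omega> \<in> B n")
          case True
          then show ?thesis using a norm_triangle_ineq4[of "iexp (u * X n \<omega>)" "iexp (u * Z \<omega>)"] by simp
        next
          case False
          then have "\<bar>X n \<omega> - Z \<omega>\<bar> \<le> \<epsilon>" using \<omega> by (simp add: B_def)
          then have "\<bar>u\<bar> * \<bar>X n \<omega> - Z \<omega>\<bar> \<le> \<bar>u\<bar> * \<epsilon>" by (intro mult_left_mono) auto
          then show ?thesis using cmod_iexp_diff_le[of "u * X n \<omega>" "u * Z \<omega>"] \<epsilon> False
            by (simp add: abs_mult flip: right_diff_distrib)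
        qed
      qed
    qed (auto simp: integrable_real_indicator less_top[symmetric])
    also have "\<dots> = a / 2 + 2 * measure M (B n)" by (simp add: prob_space less_top[symmetric])
    finally show ?thesis .
  qed
  moreover have "\<forall>\<^sub>F n in sequentially. measure M (B n) < a / 4"
    using conv \<epsilon>(1) a unfolding tendsto_in_probability_def B_def by (intro order_tendstoD(2)[where y = 0]) auto
  ultimately show "\<forall>\<^sub>F n in sequentially. (LINT \<omega>|M. cmod (iexp (u * X n \<omega>) - iexp (u * Z \<omega>))) < a"
    by (auto elim!: eventually_mono) (smt (verit) field_sum_of_halves)
qed

text \<open>The difference of two products of unimodular factors telescopes, and each term is
  controlled by one of the sequences. So the approximations of two stochastic integrals need not be
  related to each other.\<close>

lemma (in prob_space) tendsto_char_diff_in_probability: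
  assumes [measurable]: "\<And>n. X n \<in> borel_measurable M" "Z \<in> borel_measurable M"
      "\<And>n. X' n \<in> borel_measurable M" "Z' \<in> borel_measurable M"
    and conv: "tendsto_in_probability M X Z" "tendsto_in_probability M X' Z'"
  shows "(\<lambda>n. char (distr M borel (\<lambda>\<omega>. X n \<omega> - X' n \<omega>)) u) \<longlonglongrightarrow> char (distr M borel (\<lambda>\<omega>. Z \<omega> - Z' \<omega>)) u"
proof (rule LIM_zero_cancel, rule Lim_null_comparison)
  let ?D = "\<lambda>X Z \<omega>. cmod (iexp (u * X \<omega>) - iexp (u * Z \<omega>))"
  have D: "integrable M (?D U V)" if [measurable]: "U \<in> borel_measurable M" "V \<in> borel_measurable M" for U V
    by (intro integrable_cmod_iexp_diff) measurable
  show "(\<lambda>n. (LINT \<omega>|M. ?D (X n) Z \<omega>) + (LINT \<omega>|M. ?D (X' n) Z' \<omega>)) \<longlonglongrightarrow> 0"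
    using tendsto_add[OF tendsto_in_probability_iexp tendsto_in_probability_iexp] conv by fastforce
  have "cmod (char (distr M borel (\<lambda>\<omega>. X n \<omega> - X' n \<omega>)) u - char (distr M borel (\<lambda>\<omega>. Z \<omega> - Z' \<omega>)) u)
      \<le> (LINT \<omega>|M. ?D (X n) Z \<omega>) + (LINT \<omega>|M. ?D (X' n) Z' \<omega>)" for n
  proof -
    have i: "integrable M (\<lambda>\<omega>. iexp (u * U \<omega>))" if [measurable]: "U \<in> borel_measurable M" for U
      by (intro integrable_iexp_real) measurable
    have "cmod (char (distr M borel (\<lambda>\<omega>. X n \<omega> - X' n \<omega>)) u - char (distr M borel (\<lambda>\<omega>. Z \<omega> - Z' \<omega>)) u)
       = cmod (CLINT \<omega>|M. iexp (u * (X n \<omega> - X' n \<omega>)) - iexp (u * (Z \<omega> - Z' \<omega>)))"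
      using i[of "\<lambda>\<omega>. X n \<omega> - X' n \<omega>"] i[of "\<lambda>\<omega>. Z \<omega> - Z' \<omega>"]
      by (simp add: char_distr)
    also have "\<dots> \<le> (LINT \<omega>|M. cmod (iexp (u * (X n \<omega> - X' n \<omega>)) - iexp (u * (Z \<omega> - Z' \<omega>))))"
      by (rule integral_norm_bound)
    also have "\<dots> \<le> (LINT \<omega>|M. ?D (X n) Z \<omega> + ?D (X' n) Z' \<omega>)"
    proof (rule integral_mono)
      fix \<omega>
      have "iexp (u * (X n \<omega> - X' n \<omega>)) - iexp (u * (Z \<omega> - Z' \<omega>)) =
         iexp (- u * X' n \<omega>) * (iexp (u * X n \<omega>) - iexp (u * Z \<omega>)) +
         iexp (u * Z \<omega>) * (iexp (- (u * X' n \<omega>)) - iexp (- (u * Z' \<omega>)))"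
        by (simp add: algebra_simps flip: exp_add)
      moreover have "cmod (iexp (- (u * X' n \<omega>)) - iexp (- (u * Z' \<omega>))) = ?D (X' n) Z' \<omega>"
      proof -
        have "iexp (- (u * X' n \<omega>)) - iexp (- (u * Z' \<omega>)) = cnj (iexp (u * X' n \<omega>) - iexp (u * Z' \<omega>))"
          by (simp add: exp_cnj)
        then show ?thesis by (simp only: complex_mod_cnj)
      qed
      ultimately show "cmod (iexp (u * (X n \<omega> - X' n \<omega>)) - iexp (u * (Z \<omega> - Z' \<omega>))) \<le> ?D (X n) Z \<omega> + ?D (X' n) Z' \<omega>"
        by (metis (no_types, lifting) mult.left_neutral norm_exp_i_times norm_mult norm_triangle_ineq of_real_mult)
    qed (intro Bochner_Integration.integrable_add integrable_cmod_iexp_diff; measurable)+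
    also have "\<dots> = (LINT \<omega>|M. ?D (X n) Z \<omega>) + (LINT \<omega>|M. ?D (X' n) Z' \<omega>)"
      by (intro Bochner_Integration.integral_add D) measurable
    finally show ?thesis .
  qed
  then show "\<forall>\<^sub>F n in sequentially. cmod (char (distr M borel (\<lambda>\<omega>. X n \<omega> - X' n \<omega>)) u - char (distr M borel (\<lambda>\<omega>. Z \<omega> - Z' \<omega>)) u)
      \<le> (LINT \<omega>|M. ?D (X n) Z \<omega>) + (LINT \<omega>|M. ?D (X' n) Z' \<omega>)" by simp
qed

section \<open>The real part of the Levy exponent\<close>

text \<open>Drift and compensator are purely imaginary in \<open>levy_exponent\<close>, which is why
  this real part carries neither \<open>\<beta>\<close> nor a truncation at
  \<open>1\<close>.\<close>

definition levy_re :: "real \<Rightarrow> real measure \<Rightarrow> real \<Rightarrow> real" where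
  "levy_re \<sigma>2 \<nu> v = \<sigma>2 * v\<^sup>2 / 2 + (LINT z|\<nu>. 1 - cos (v * z))"

lemma integrable_levy_bound:
  fixes f :: "real \<Rightarrow> 'b :: {banach, second_countable_topology}"
  assumes \<nu>: "levy_measure \<nu>" and [measurable]: "f \<in> borel_measurable borel"
    and le: "\<And>z. norm (f z) \<le> C * min 1 (z\<^sup>2)"
  shows "integrable \<nu> f"
proof (rule Bochner_Integration.integrable_bound)
  have [measurable_cong]: "sets \<nu> = sets borel" using \<nu> by (simp add: levy_measure_def)
  show "integrable \<nu> (\<lambda>z. C * min 1 (z\<^sup>2))" using \<nu> by (simp add: levy_measure_def)
  show "f \<in> borel_measurable \<nu>" by measurable
  have "norm (f z) \<le> norm (C * min 1 (z\<^sup>2))" for z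
    using le[of z] unfolding real_norm_def by (rule order_trans[OF _ abs_ge_self])
  then show "AE z in \<nu>. norm (f z) \<le> norm (C * min 1 (z\<^sup>2))" by simp
qed

lemma integrable_one_minus_cos:
  assumes "levy_measure \<nu>"
  shows "integrable \<nu> (\<lambda>z. 1 - cos (v * z))"
proof (rule integrable_levy_bound[OF assms, where C = "2 + v\<^sup>2"])
  fix z
  have "1 - cos (v * z) \<le> v\<^sup>2 * z\<^sup>2 / 2" "1 - cos (v * z) \<le> 2"
    using one_minus_cos_le[of "v * z"] cos_ge_minus_one[of "v * z"] by (auto simp: power_mult_distrib)
  moreover have "v\<^sup>2 * z\<^sup>2 \<ge> 0" "v\<^sup>2 \<ge> 0" "z\<^sup>2 \<ge> 0" by auto
  ultimately have "1 - cos (v * z) \<le> (2 + v\<^sup>2) * min 1 (z\<^sup>2)"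
    by (cases "1 \<le> z\<^sup>2"; simp only: min_def if_True if_False distrib_right; linarith)
  then show "norm (1 - cos (v * z)) \<le> (2 + v\<^sup>2) * min 1 (z\<^sup>2)" by simp
qed measurable

lemma Re_levy_exponent:
  assumes \<nu>: "levy_measure \<nu>"
  shows "Re (levy_exponent \<beta> \<sigma>2 \<nu> u) = - levy_re \<sigma>2 \<nu> u"
proof -
  let ?f = "\<lambda>z. exp (\<i> * u * z) - 1 - \<i> * u * z * indicat_real {x :: real. \<bar>x\<bar> < 1} z"
  have int: "integrable \<nu> ?f"
  \<comment> \<open>Near the origin the compensator leaves a second-order Taylor remainder of at
    most \<open>(u * z)\<^sup>2 / 2\<close>; for \<open>\<bar>z\<bar> \<ge> 1\<close> the bound is
    \<open>2\<close>. The constant covers both cases.\<close>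
  proof (rule integrable_levy_bound[OF \<nu>, where C = "2 + u\<^sup>2"])
    fix z :: real
    show "norm (?f z) \<le> (2 + u\<^sup>2) * min 1 (z\<^sup>2)"
    proof (cases "\<bar>z\<bar> < 1")
      case True
      then have z: "min 1 (z\<^sup>2) = z\<^sup>2" using abs_square_less_1[of z] by (simp add: min_def)
      have "norm (?f z) = cmod (iexp (u * z) - (\<Sum>k\<le>1. (\<i> * (u * z)) ^ k / fact k))"
        using True by (simp add: algebra_simps)
      also have "\<dots> \<le> (u * z)\<^sup>2 / 2"
        using iexp_approx1[of "u * z" 1] by (simp add: numeral_2_eq_2)
      also have "\<dots> \<le> (2 + u\<^sup>2) * z\<^sup>2" by (simp add: power_mult_distrib algebra_simps)
      finally show ?thesis unfolding z .
    next
      case False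
      then have z: "min 1 (z\<^sup>2) = 1" using abs_le_square_iff[of 1 z] by (simp add: min_def)
      have "norm (?f z) = cmod (iexp (u * z) - iexp 0)" using False by (simp add: algebra_simps)
      also have "\<dots> \<le> 2" by (rule cmod_iexp_diff_le_2)
      also have "\<dots> \<le> (2 + u\<^sup>2) * 1" by simp
      finally show ?thesis unfolding z .
    qed
  qed measurable
  have "Re (CLINT z|\<nu>. ?f z) = (LINT z|\<nu>. - (1 - cos (u * z)))"
    by (subst integral_Re[OF int, symmetric]) (simp add: Re_exp)
  also have "\<dots> = - (LINT z|\<nu>. 1 - cos (u * z))" by (rule integral_minus)
  finally show ?thesis unfolding levy_exponent_def levy_re_def by simp
qed

lemma levy_re_nonneg: "\<sigma>2 \<ge> 0 \<Longrightarrow> levy_re \<sigma>2 \<nu> v \<ge> 0"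
  unfolding levy_re_def by (intro add_nonneg_nonneg integral_nonneg_AE) auto

lemma levy_re_0 [simp]: "levy_re \<sigma>2 \<nu> 0 = 0"
  by (simp add: levy_re_def)

lemma levy_re_tendsto:
  assumes \<nu>: "levy_measure \<nu>" and z2: "integrable \<nu> (\<lambda>z. z\<^sup>2)" and v: "v \<longlonglongrightarrow> w"
  shows "(\<lambda>n. levy_re \<sigma>2 \<nu> (v n)) \<longlonglongrightarrow> levy_re \<sigma>2 \<nu> w"
proof -
  have s: "borel_measurable \<nu> = (borel_measurable borel :: (real \<Rightarrow> real) set)"
    using \<nu> by (intro measurable_cong_sets) (auto simp: levy_measure_def)
  obtain B where B: "\<And>n. \<bar>v n\<bar> \<le> B"
    using convergent_imp_Bseq[OF convergentI[OF v]] unfolding Bseq_def by auto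
  have "(\<lambda>n. LINT z|\<nu>. 1 - cos (v n * z)) \<longlonglongrightarrow> (LINT z|\<nu>. 1 - cos (w * z))"
  proof (rule integral_dominated_convergence[where w = "\<lambda>z. B\<^sup>2 * z\<^sup>2"])
    show "AE z in \<nu>. norm (1 - cos (v n * z)) \<le> B\<^sup>2 * z\<^sup>2" for n
    proof (rule AE_I2)
      fix z
      have "1 - cos (v n * z) \<le> (v n)\<^sup>2 * z\<^sup>2 / 2"
        using one_minus_cos_le[of "v n * z"] by (simp add: power_mult_distrib)
      also have "\<dots> \<le> (v n)\<^sup>2 * z\<^sup>2" by simp
      also have "\<dots> \<le> B\<^sup>2 * z\<^sup>2" using power_mono[OF B[of n], of 2] by (intro mult_right_mono) auto
      finally show "norm (1 - cos (v n * z)) \<le> B\<^sup>2 * z\<^sup>2" by simp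
    qed
    show "AE z in \<nu>. (\<lambda>n. 1 - cos (v n * z)) \<longlonglongrightarrow> 1 - cos (w * z)"
      by (intro AE_I2 tendsto_intros v)
  qed (use z2 in \<open>auto simp: s\<close>)
  then show ?thesis unfolding levy_re_def by (intro tendsto_intros v) auto
qed

lemma continuous_on_levy_re:
  assumes "levy_measure \<nu>" "integrable \<nu> (\<lambda>z. z\<^sup>2)"
  shows "continuous_on UNIV (levy_re \<sigma>2 \<nu>)"
  using levy_re_tendsto[OF assms] by (auto simp: continuous_on_sequentially o_def)

text \<open>Serves twice as a domination: it makes \<open>levy_re \<sigma>2 \<nu> (u * w)\<close>
  integrable in the space variable for square-integrable \<open>w\<close>, and after division by the
  square of \<open>u\<close> it no longer depends on \<open>u\<close>.\<close>

lemma levy_re_le: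
  assumes \<nu>: "levy_measure \<nu>" and z2: "integrable \<nu> (\<lambda>z. z\<^sup>2)"
  shows "levy_re \<sigma>2 \<nu> v \<le> levy_variance \<sigma>2 \<nu> * v\<^sup>2 / 2"
proof -
  have "(LINT z|\<nu>. 1 - cos (v * z)) \<le> (LINT z|\<nu>. v\<^sup>2 / 2 * z\<^sup>2)"
    using one_minus_cos_le[of "v * _"] z2 integrable_one_minus_cos[OF \<nu>]
    by (intro integral_mono) (auto simp: power_mult_distrib)
  also have "\<dots> = v\<^sup>2 / 2 * (LINT z|\<nu>. z\<^sup>2)" by (rule integral_mult_right_zero)
  finally show ?thesis by (simp add: levy_re_def levy_variance_def algebra_simps)
qed

lemma levy_re_over_square_tendsto:
  assumes \<nu>: "levy_measure \<nu>" and z2: "integrable \<nu> (\<lambda>z. z\<^sup>2)"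
    and u: "u \<longlonglongrightarrow> 0" "\<And>n. u n \<noteq> 0"
  shows "(\<lambda>n. levy_re \<sigma>2 \<nu> (u n) / (u n)\<^sup>2) \<longlonglongrightarrow> levy_variance \<sigma>2 \<nu> / 2"
proof -
  have s: "borel_measurable \<nu> = (borel_measurable borel :: (real \<Rightarrow> real) set)"
    using \<nu> by (intro measurable_cong_sets) (auto simp: levy_measure_def)
  have "(\<lambda>n. LINT z|\<nu>. (1 - cos (u n * z)) / (u n)\<^sup>2) \<longlonglongrightarrow> (LINT z|\<nu>. z\<^sup>2 / 2)"
  proof (rule integral_dominated_convergence[where w = "\<lambda>z. z\<^sup>2 / 2"])
    show "AE z in \<nu>. norm ((1 - cos (u n * z)) / (u n)\<^sup>2) \<le> z\<^sup>2 / 2" for n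
    proof (rule AE_I2)
      fix z show "norm ((1 - cos (u n * z)) / (u n)\<^sup>2) \<le> z\<^sup>2 / 2"
        using one_minus_cos_le[of "u n * z"] u(2)[of n]
        by (simp add: power_mult_distrib divide_simps) (simp add: mult_ac)
    qed
    show "AE z in \<nu>. (\<lambda>n. (1 - cos (u n * z)) / (u n)\<^sup>2) \<longlonglongrightarrow> z\<^sup>2 / 2"
      by (intro AE_I2 tendsto_one_minus_cos_over_square u)
  qed (use z2 in \<open>auto simp: s\<close>)
  then have "(\<lambda>n. \<sigma>2 / 2 + (LINT z|\<nu>. (1 - cos (u n * z)) / (u n)\<^sup>2)) \<longlonglongrightarrow> \<sigma>2 / 2 + (LINT z|\<nu>. z\<^sup>2 / 2)"
    by (intro tendsto_intros)
  moreover have "\<sigma>2 / 2 + (LINT z|\<nu>. (1 - cos (u n * z)) / (u n)\<^sup>2) = levy_re \<sigma>2 \<nu> (u n) / (u n)\<^sup>2" for n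
    using u(2)[of n] by (simp add: levy_re_def field_simps)
  ultimately show ?thesis by (simp add: levy_variance_def add_divide_distrib)
qed

section \<open>Levy bases: modulus of the characteristic function and second moment\<close>

lemma homogeneous_levy_basisD:
  assumes "homogeneous_levy_basis M \<Lambda> \<beta> \<sigma>2 \<nu>"
  shows "prob_space M" "\<sigma>2 \<ge> 0" "levy_measure \<nu>" "independently_scattered M \<Lambda>"
    "B \<in> bounded_borel \<Longrightarrow> \<Lambda> B \<in> borel_measurable M"
    "B \<in> bounded_borel \<Longrightarrow> cmod (char (distr M borel (\<Lambda> B)) u) = exp (- (measure lborel B * levy_re \<sigma>2 \<nu> u))"
proof -
  note L = assms[unfolded homogeneous_levy_basis_def]
  show "prob_space M" "\<sigma>2 \<ge> 0" and \<nu>: "levy_measure \<nu>" and "independently_scattered M \<Lambda>"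
    using L by blast+
  show "\<Lambda> B \<in> borel_measurable M" if "B \<in> bounded_borel" using L that by blast
  show "cmod (char (distr M borel (\<Lambda> B)) u) = exp (- (measure lborel B * levy_re \<sigma>2 \<nu> u))" if "B \<in> bounded_borel"
  proof -
    have "char (distr M borel (\<Lambda> B)) u = exp (measure lborel B * levy_exponent \<beta> \<sigma>2 \<nu> u)" using L that by blast
    then show ?thesis by (simp add: norm_exp_eq_Re Re_levy_exponent[OF \<nu>])
  qed
qed

text \<open>Without this lemma the integral in \<^const>\<open>levy_variance\<close> might have the junk value \<open>0\<close>.\<close>

lemma homogeneous_levy_basis_second_moment:
  fixes \<Lambda> :: "('x :: euclidean_space) set \<Rightarrow> 'a \<Rightarrow> real"
  assumes L: "homogeneous_levy_basis M \<Lambda> \<beta> \<sigma>2 \<nu>" and "levy_finite_second_moment M \<Lambda>"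
  shows "integrable \<nu> (\<lambda>z. z\<^sup>2)"
proof -
  note D = homogeneous_levy_basisD[OF L]
  interpret prob_space M by (rule D(1))
  have [measurable_cong]: "sets \<nu> = sets borel" using D(3) by (simp add: levy_measure_def)
  define B :: "'x set" where "B = cbox 0 One"
  have B: "B \<in> bounded_borel" "measure lborel B = 1"
    unfolding B_def by (simp_all add: bounded_borel_def bounded_cbox content_unit)
  define V where "V = variance (\<Lambda> B)"
  have V: "V \<ge> 0" unfolding V_def by simp
  \<comment> \<open>A null sequence scaled so that \<open>(u n)\<^sup>2 * V \<le> 1\<close>; then
    \<open>c\<close> below is at most \<open>1 / 2\<close>, and the factor \<open>1 - c\<close> in
    front of \<open>h\<close> can be removed.\<close>
  define u where "u n = 1 / ((1 + V) * (real n + 1))" for n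
  have u0: "u \<longlonglongrightarrow> 0"
    unfolding u_def using tendsto_mult[OF tendsto_const[of "1 / (1 + V)"] LIMSEQ_inverse_real_of_nat] V
    by (simp add: field_simps)
  have u_pos: "u n > 0" for n unfolding u_def using V by simp
  have uV: "(u n)\<^sup>2 * V \<le> 1" for n
  proof -
    have "1 \<le> (1 + V) * (real n + 1)" using V mult_mono[of 1 "1 + V" 1 "real n + 1"] by simp
    then have "u n \<le> 1" unfolding u_def by (simp add: divide_le_eq)
    have "(1 + V) * 1 \<le> (1 + V) * (real n + 1)" using V by (intro mult_left_mono) auto
    then have "V \<le> (1 + V) * (real n + 1)" using V by (simp only: mult_1_right)
    then have "u n * V \<le> 1" unfolding u_def using V by (simp add: divide_le_eq)
    then have "u n * (u n * V) \<le> 1 * 1" using \<open>u n \<le> 1\<close> u_pos[of n] V by (intro mult_mono) auto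
    then show ?thesis by (simp add: power2_eq_square mult_ac)
  qed
  have h_le: "levy_re \<sigma>2 \<nu> (u n) \<le> (u n)\<^sup>2 * V" for n
  proof -
    define h c where "h = levy_re \<sigma>2 \<nu> (u n)" and "c = (u n)\<^sup>2 * V / 2"
    have h: "h \<ge> 0" unfolding h_def using D(2) by (rule levy_re_nonneg)
    have c: "0 \<le> c" "c \<le> 1 / 2" using uV[of n] V by (auto simp: c_def)
    have "integrable M (\<lambda>\<omega>. (\<Lambda> B \<omega>)\<^sup>2)" using assms(2) B by (simp add: levy_finite_second_moment_def)
    from char_lower_bound[OF D(5)[OF B(1)] this, of "u n"]
    have "1 - c \<le> exp (- h)"
      using D(6)[OF B(1), of "u n"] B(2) by (simp add: V_def c_def h_def)
    also have "\<dots> \<le> 1 / (1 + h)"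
      using exp_ge_add_one_self[of h] h unfolding exp_minus inverse_eq_divide
      by (intro divide_left_mono) auto
    finally have "(1 - c) * (1 + h) \<le> 1" using h by (simp add: pos_le_divide_eq)
    then have "h * (1 - c) \<le> c" by (simp add: algebra_simps)
    moreover have "h * (1 / 2) \<le> h * (1 - c)" using c h by (intro mult_left_mono) auto
    ultimately show ?thesis by (simp add: h_def c_def)
  qed
  \<comment> \<open>Fatou's lemma for \<open>u n\<close> tending to \<open>0\<close>: the quotients
    converge to \<open>z\<^sup>2 / 2\<close>, while their integrals stay below \<open>V\<close>
    because \<open>levy_re\<close> dominates its jump part.\<close>
  have "(\<integral>\<^sup>+z. ennreal (z\<^sup>2 / 2) \<partial>\<nu>) = (\<integral>\<^sup>+z. liminf (\<lambda>n. ennreal ((1 - cos (u n * z)) / (u n)\<^sup>2)) \<partial>\<nu>)"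
  proof (rule nn_integral_cong)
    fix z
    have "(\<lambda>n. ennreal ((1 - cos (u n * z)) / (u n)\<^sup>2)) \<longlonglongrightarrow> ennreal (z\<^sup>2 / 2)"
      using less_imp_neq[OF u_pos] by (intro tendsto_ennrealI tendsto_one_minus_cos_over_square u0) metis
    from lim_imp_Liminf[OF _ this]
    show "ennreal (z\<^sup>2 / 2) = liminf (\<lambda>n. ennreal ((1 - cos (u n * z)) / (u n)\<^sup>2))" by simp
  qed
  also have "\<dots> \<le> liminf (\<lambda>n. \<integral>\<^sup>+z. ennreal ((1 - cos (u n * z)) / (u n)\<^sup>2) \<partial>\<nu>)"
    by (rule nn_integral_liminf) measurable
  also have "\<dots> \<le> liminf (\<lambda>n::nat. ennreal V)"
  proof (rule Liminf_mono, rule always_eventually, rule allI)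
    fix n
    have "(\<integral>\<^sup>+z. ennreal ((1 - cos (u n * z)) / (u n)\<^sup>2) \<partial>\<nu>) = ennreal (LINT z|\<nu>. (1 - cos (u n * z)) / (u n)\<^sup>2)"
      using integrable_one_minus_cos[OF D(3)] by (intro nn_integral_eq_integral) auto
    moreover have "(LINT z|\<nu>. (1 - cos (u n * z)) / (u n)\<^sup>2) \<le> V"
    proof -
      have "(LINT z|\<nu>. 1 - cos (u n * z)) \<le> levy_re \<sigma>2 \<nu> (u n)" using D(2) by (simp add: levy_re_def)
      also note h_le[of n]
      finally show ?thesis using u_pos[of n] by (simp add: divide_le_eq mult.commute)
    qed
    ultimately show "(\<integral>\<^sup>+z. ennreal ((1 - cos (u n * z)) / (u n)\<^sup>2) \<partial>\<nu>) \<le> ennreal V" by (simp add: ennreal_leI)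
  qed
  also have "\<dots> = ennreal V" by (simp add: Liminf_const)
  finally have "(\<integral>\<^sup>+z. ennreal (z\<^sup>2 / 2) \<partial>\<nu>) < \<infinity>"
    by (simp add: le_less_trans[OF _ ennreal_less_top])
  then have "integrable \<nu> (\<lambda>z. z\<^sup>2 / 2)"
    by (intro integrableI_nonneg) auto
  then have "integrable \<nu> (\<lambda>z. 2 * (z\<^sup>2 / 2))" by (rule integrable_mult_right)
  then show ?thesis by simp
qed

section \<open>Integrals of simple functions\<close>

text \<open>Countable additivity for the constant sequence of empty sets makes a series with equal
  terms converge, which forces these terms to be \<open>0\<close>.\<close>

lemma levy_basis_empty:
  assumes "independently_scattered M \<Lambda>"
  shows "AE \<omega> in M. \<Lambda> {} \<omega> = 0"
proof -
  have "AE \<omega> in M. (\<lambda>n::nat. \<Lambda> {} \<omega>) sums \<Lambda> (\<Union>n::nat. {}) \<omega>"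
    using assms[unfolded independently_scattered_def, rule_format, of "\<lambda>_. {}"]
    by (auto simp: bounded_borel_def disjoint_family_on_def)
  then show ?thesis
    by eventually_elim (auto dest!: sums_summable simp: summable_const_iff)
qed

text \<open>\<open>independently_scattered\<close> speaks of sequences of sets, so a finite family
  is enumerated and padded with empty sets.\<close>

lemma nat_enumeration_disjoint_family:
  fixes C :: "'k \<Rightarrow> 'x :: euclidean_space set"
  assumes I: "finite I" and C: "\<And>i. i \<in> I \<Longrightarrow> C i \<in> bounded_borel" and disj: "disjoint_family_on C I"
  obtains f B where "bij_betw f {..<card I} I" "range B \<subseteq> bounded_borel" "disjoint_family B"
    "\<And>n. n < card I \<Longrightarrow> B n = C (f n)" "\<And>n. n \<ge> card I \<Longrightarrow> B n = {}" "(\<Union>n. B n) = (\<Union>i\<in>I. C i)"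
proof -
  obtain f where f: "bij_betw f {..<card I} I"
    using ex_bij_betw_nat_finite[OF I] by (auto simp: lessThan_atLeast0)
  define B where "B n = (if n < card I then C (f n) else {})" for n
  have fI: "f n \<in> I" if "n < card I" for n using f that by (auto simp: bij_betw_def)
  have "range B \<subseteq> bounded_borel"
    using C fI by (auto simp: B_def) (auto simp: bounded_borel_def)
  moreover have "disjoint_family B"
    unfolding disjoint_family_on_def
  proof (intro ballI impI)
    fix m n :: nat assume mn: "m \<noteq> n"
    show "B m \<inter> B n = {}"
    proof (cases "m < card I \<and> n < card I")
      case True
      then have "f m \<noteq> f n" using f mn by (auto simp: bij_betw_def inj_on_def)
      then show ?thesis using disj True fI unfolding disjoint_family_on_def B_def by auto
    qed (auto simp: B_def)
  qed
  moreover have "(\<Union>n. B n) = (\<Union>i\<in>I. C i)"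
    using f unfolding B_def bij_betw_def by (auto split: if_splits) (metis imageE lessThan_iff)+
  ultimately show thesis using that[of f B] f by (auto simp: B_def)
qed

lemma levy_basis_finite_UN:
  fixes \<Lambda> :: "('x :: euclidean_space) set \<Rightarrow> 'a \<Rightarrow> real"
  assumes scat: "independently_scattered M \<Lambda>"
    and I: "finite I" and C: "\<And>i. i \<in> I \<Longrightarrow> C i \<in> bounded_borel" and disj: "disjoint_family_on C I"
  shows "AE \<omega> in M. \<Lambda> (\<Union>i\<in>I. C i) \<omega> = (\<Sum>i\<in>I. \<Lambda> (C i) \<omega>)"
proof -
  obtain f B where f: "bij_betw f {..<card I} I" and B: "range B \<subseteq> bounded_borel" "disjoint_family B"
    "\<And>n. n < card I \<Longrightarrow> B n = C (f n)" "\<And>n. n \<ge> card I \<Longrightarrow> B n = {}" "(\<Union>n. B n) = (\<Union>i\<in>I. C i)"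
    using nat_enumeration_disjoint_family[OF I C disj] by metis
  have "(\<Union>i\<in>I. C i) \<in> bounded_borel"
    using C I by (auto simp: bounded_borel_def)
  then have "AE \<omega> in M. (\<lambda>n. \<Lambda> (B n) \<omega>) sums \<Lambda> (\<Union>i\<in>I. C i) \<omega>"
    using scat B unfolding independently_scattered_def by metis
  with levy_basis_empty[OF scat] show ?thesis
  proof eventually_elim
    case (elim \<omega>)
    have "(\<lambda>n. \<Lambda> (B n) \<omega>) sums (\<Sum>n<card I. \<Lambda> (B n) \<omega>)"
      using elim B(4) by (intro sums_finite) auto
    with elim have "\<Lambda> (\<Union>i\<in>I. C i) \<omega> = (\<Sum>n<card I. \<Lambda> (B n) \<omega>)" by (blast intro: sums_unique2)
    also have "\<dots> = (\<Sum>n<card I. \<Lambda> (C (f n)) \<omega>)" using B(3) by simp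
    also have "\<dots> = (\<Sum>i\<in>I. \<Lambda> (C i) \<omega>)" by (rule sum.reindex_bij_betw[OF f])
    finally show ?case .
  qed
qed

lemma cmod_char_levy_sum:
  fixes \<Lambda> :: "('x :: euclidean_space) set \<Rightarrow> 'a \<Rightarrow> real"
  assumes L: "homogeneous_levy_basis M \<Lambda> \<beta> \<sigma>2 \<nu>"
    and I: "finite I" and C: "\<And>i. i \<in> I \<Longrightarrow> C i \<in> bounded_borel" and disj: "disjoint_family_on C I"
  shows "cmod (char (distr M borel (\<lambda>\<omega>. \<Sum>i\<in>I. v i * \<Lambda> (C i) \<omega>)) u) =
    exp (- (\<Sum>i\<in>I. measure lborel (C i) * levy_re \<sigma>2 \<nu> (u * v i)))"
proof -
  note D = homogeneous_levy_basisD[OF L]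
  interpret prob_space M by (rule D(1))
  obtain f B where f: "bij_betw f {..<card I} I" and B: "range B \<subseteq> bounded_borel" "disjoint_family B"
    "\<And>n. n < card I \<Longrightarrow> B n = C (f n)" "\<And>n. n \<ge> card I \<Longrightarrow> B n = {}" "(\<Union>n. B n) = (\<Union>i\<in>I. C i)"
    using nat_enumeration_disjoint_family[OF I C disj] by metis
  have [measurable]: "\<Lambda> (B n) \<in> borel_measurable M" for n using D(5) B(1) by blast
  have "indep_vars (\<lambda>_. borel) (\<lambda>n. \<Lambda> (B n)) UNIV"
    using D(4) B(1,2) unfolding independently_scattered_def by blast
  then have "indep_vars (\<lambda>_. borel) (\<lambda>n. \<Lambda> (B n)) {..<card I}"
    by (rule indep_vars_subset) simp
  then have indep: "indep_vars (\<lambda>_. borel) (\<lambda>n \<omega>. v (f n) * \<Lambda> (B n) \<omega>) {..<card I}"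
    by (rule indep_vars_compose2) measurable
  have one: "cmod (char (distr M borel (\<lambda>\<omega>. v (f n) * \<Lambda> (B n) \<omega>)) u) =
      exp (- (measure lborel (B n) * levy_re \<sigma>2 \<nu> (u * v (f n))))" for n
  proof -
    have "char (distr M borel (\<lambda>\<omega>. v (f n) * \<Lambda> (B n) \<omega>)) u = char (distr M borel (\<Lambda> (B n))) (u * v (f n))"
      by (simp add: char_distr mult_ac)
    then show ?thesis using D(6)[of "B n"] B(1) by auto
  qed
  have "(\<lambda>\<omega>. \<Sum>i\<in>I. v i * \<Lambda> (C i) \<omega>) = (\<lambda>\<omega>. \<Sum>n<card I. v (f n) * \<Lambda> (B n) \<omega>)"
    by (subst sum.reindex_bij_betw[OF f, symmetric]) (simp add: B(3))
  then have "cmod (char (distr M borel (\<lambda>\<omega>. \<Sum>i\<in>I. v i * \<Lambda> (C i) \<omega>)) u)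
      = cmod (\<Prod>n<card I. char (distr M borel (\<lambda>\<omega>. v (f n) * \<Lambda> (B n) \<omega>)) u)"
    using char_distr_sum[OF indep] by simp
  also have "\<dots> = exp (- (\<Sum>n<card I. measure lborel (B n) * levy_re \<sigma>2 \<nu> (u * v (f n))))"
    by (simp add: prod_norm[symmetric] one exp_sum flip: sum_negf)
  also have "(\<Sum>n<card I. measure lborel (B n) * levy_re \<sigma>2 \<nu> (u * v (f n))) =
      (\<Sum>n<card I. measure lborel (C (f n)) * levy_re \<sigma>2 \<nu> (u * v (f n)))"
    by (simp add: B(3))
  also have "\<dots> = (\<Sum>i\<in>I. measure lborel (C i) * levy_re \<sigma>2 \<nu> (u * v i))"
    by (rule sum.reindex_bij_betw[OF f])
  finally show ?thesis .
qed

text \<open>The definition of the integral groups points by the value of the integrand. A finer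
  partition into the cells of \<open>k\<close> allows two integrals to be written over the same
  disjoint sets; cells outside \<open>I\<close> may be unbounded, but the integrand is
  \<open>0\<close> there. The identity is almost sure because \<open>\<Lambda>\<close> is additive
  only almost surely.\<close>

lemma simple_stochastic_integral_eq_sum:
  fixes \<Lambda> :: "('x :: euclidean_space) set \<Rightarrow> 'a \<Rightarrow> real" and k :: "'x \<Rightarrow> 'k"
  assumes scat: "independently_scattered M \<Lambda>" and I: "finite I" "I \<subseteq> range k" "finite (range k)"
    and bb: "\<And>p. p \<in> I \<Longrightarrow> k -` {p} \<in> bounded_borel"
    and zero: "\<And>x. k x \<notin> I \<Longrightarrow> v (k x) = 0" and A: "A \<in> sets borel"
  shows "AE \<omega> in M. simple_stochastic_integral \<Lambda> (\<lambda>x. v (k x)) A \<omega> = (\<Sum>p\<in>I. v p * \<Lambda> (k -` {p} \<inter> A) \<omega>)"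
proof -
  let ?g = "\<lambda>x. v (k x)" and ?I = "\<lambda>y. {p \<in> I. v p = y}"
  have fin: "finite (range ?g)" using finite_imageI[OF I(3), of v] by (simp add: image_image)
  have "AE \<omega> in M. \<forall>y\<in>range ?g. \<Lambda> (\<Union>p\<in>?I y. k -` {p} \<inter> A) \<omega> = (\<Sum>p\<in>?I y. \<Lambda> (k -` {p} \<inter> A) \<omega>)"
    by (intro AE_finite_allI fin levy_basis_finite_UN[OF scat])
       (use bb I A in \<open>auto simp: bounded_borel_def disjoint_family_on_def intro: bounded_subset\<close>)
  then show ?thesis
  proof eventually_elim
    case (elim \<omega>)
    have "simple_stochastic_integral \<Lambda> ?g A \<omega> = (\<Sum>y\<in>range ?g - {0}. \<Sum>p\<in>{p \<in> {p \<in> I. v p \<noteq> 0}. v p = y}. v p * \<Lambda> (k -` {p} \<inter> A) \<omega>)"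
      unfolding simple_stochastic_integral_def
    proof (rule sum.cong[OF refl])
      fix y assume y: "y \<in> range ?g - {0}"
      have "?g -` {y} \<inter> A = (\<Union>p\<in>?I y. k -` {p} \<inter> A)" using y by auto (metis zero)
      with elim y have "y * \<Lambda> (?g -` {y} \<inter> A) \<omega> = (\<Sum>p\<in>?I y. y * \<Lambda> (k -` {p} \<inter> A) \<omega>)"
        by (auto simp: sum_distrib_left)
      also have "\<dots> = (\<Sum>p\<in>{p \<in> {p \<in> I. v p \<noteq> 0}. v p = y}. v p * \<Lambda> (k -` {p} \<inter> A) \<omega>)"
        using y by (intro sum.cong) auto
      finally show "y * \<Lambda> (?g -` {y} \<inter> A) \<omega> = \<dots>" .
    qed
    also have "\<dots> = (\<Sum>p\<in>{p \<in> I. v p \<noteq> 0}. v p * \<Lambda> (k -` {p} \<inter> A) \<omega>)"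
      using I fin by (intro sum.group) auto
    also have "\<dots> = (\<Sum>p\<in>I. v p * \<Lambda> (k -` {p} \<inter> A) \<omega>)"
      using I by (intro sum.mono_neutral_left) auto
    finally show ?case .
  qed
qed

lemma bounded_simpleD:
  assumes "bounded_simple g"
  shows "finite (range g)" "g \<in> borel_measurable borel" "y \<noteq> 0 \<Longrightarrow> g -` {y} \<in> bounded_borel"
proof -
  show "finite (range g)" using assms by (simp add: bounded_simple_def simple_function_def)
  show g: "g \<in> borel_measurable borel" using assms by (auto simp: bounded_simple_def intro: borel_measurable_simple_function)
  show "g -` {y} \<in> bounded_borel" if "y \<noteq> 0"
    using assms measurable_sets_borel[OF g, of "{y}"] that
    by (auto simp: bounded_simple_def bounded_borel_def intro: bounded_subset)
qed

lemma simple_stochastic_integral_measurable: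
  assumes L: "homogeneous_levy_basis M \<Lambda> \<beta> \<sigma>2 \<nu>" and g: "bounded_simple g" and A: "A \<in> sets borel"
  shows "simple_stochastic_integral \<Lambda> g A \<in> borel_measurable M"
proof -
  have "g -` {y} \<inter> A \<in> bounded_borel" if "y \<noteq> 0" for y
    using bounded_simpleD(3)[OF g that] A by (auto simp: bounded_borel_def)
  then have "\<Lambda> (g -` {y} \<inter> A) \<in> borel_measurable M" if "y \<in> range g - {0}" for y
    using homogeneous_levy_basisD(5)[OF L] that by auto
  then show ?thesis unfolding simple_stochastic_integral_def[abs_def]
    by (intro borel_measurable_sum borel_measurable_times) auto
qed

text \<open>The pair \<open>(g x, g' x)\<close> generates a common partition. Its cell for
  \<open>(0, 0)\<close> may be unbounded and is left out, at no cost since both integrands vanish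
  there and \<open>levy_re\<close> vanishes at \<open>0\<close>. The set \<open>A\<close> is general
  because setwise convergence will be required.\<close>

lemma cmod_char_simple_diff:
  fixes \<Lambda> :: "('x :: euclidean_space) set \<Rightarrow> 'a \<Rightarrow> real"
  assumes L: "homogeneous_levy_basis M \<Lambda> \<beta> \<sigma>2 \<nu>" and g: "bounded_simple g" and g': "bounded_simple g'"
    and A: "A \<in> sets borel"
  shows "cmod (char (distr M borel (\<lambda>\<omega>. simple_stochastic_integral \<Lambda> g A \<omega> - simple_stochastic_integral \<Lambda> g' A \<omega>)) u)
       = exp (- (LINT x:A|lborel. levy_re \<sigma>2 \<nu> (u * (g x - g' x))))" (is ?T1)
    and "integrable lborel (\<lambda>x. levy_re \<sigma>2 \<nu> (u * (g x - g' x)))" (is ?T2)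
proof -
  note D = homogeneous_levy_basisD[OF L]
  interpret prob_space M by (rule D(1))
  define k where "k x = (g x, g' x)" for x
  define I where "I = range k - {(0, 0)}"
  have k_vim: "k -` {p} = g -` {fst p} \<inter> g' -` {snd p}" for p by (auto simp: k_def)
  have fk: "finite (range k)"
    by (rule finite_subset[of _ "range g \<times> range g'"]) (use bounded_simpleD(1)[OF g] bounded_simpleD(1)[OF g'] in \<open>auto simp: k_def\<close>)
  have I: "finite I" "I \<subseteq> range k" using fk by (auto simp: I_def)
  have bb: "k -` {p} \<in> bounded_borel" if "p \<in> I" for p
  proof -
    have "fst p \<noteq> 0 \<or> snd p \<noteq> 0" using that by (cases p) (auto simp: I_def)
    then have "bounded (k -` {p})"
      using bounded_simpleD(3)[OF g, of "fst p"] bounded_simpleD(3)[OF g', of "snd p"]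
      by (auto simp: bounded_borel_def k_vim)
    moreover have "k -` {p} \<in> sets borel"
      using measurable_sets_borel[OF bounded_simpleD(2)[OF g], of "{fst p}"]
        measurable_sets_borel[OF bounded_simpleD(2)[OF g'], of "{snd p}"] by (auto simp: k_vim)
    ultimately show ?thesis by (simp add: bounded_borel_def)
  qed
  have bbA: "k -` {p} \<inter> A \<in> bounded_borel" if "p \<in> I" for p
    using bb[OF that] A by (auto simp: bounded_borel_def)
  have fst: "g = (\<lambda>x. fst (k x))" and snd: "g' = (\<lambda>x. snd (k x))" by (auto simp: k_def)
  have "AE \<omega> in M. simple_stochastic_integral \<Lambda> g A \<omega> - simple_stochastic_integral \<Lambda> g' A \<omega> =
     (\<Sum>p\<in>I. (fst p - snd p) * \<Lambda> (k -` {p} \<inter> A) \<omega>)"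
    using simple_stochastic_integral_eq_sum[OF D(4) I fk bb, of fst A, folded fst]
      simple_stochastic_integral_eq_sum[OF D(4) I fk bb, of snd A, folded snd] A
    by (auto simp: I_def k_def left_diff_distrib sum_subtractf elim!: eventually_elim2)
  then have "distr M borel (\<lambda>\<omega>. simple_stochastic_integral \<Lambda> g A \<omega> - simple_stochastic_integral \<Lambda> g' A \<omega>) =
      distr M borel (\<lambda>\<omega>. \<Sum>p\<in>I. (fst p - snd p) * \<Lambda> (k -` {p} \<inter> A) \<omega>)"
    using simple_stochastic_integral_measurable[OF L g A] simple_stochastic_integral_measurable[OF L g' A] D(5)[OF bbA]
    by (intro distr_cong_AE) auto
  then have char: "cmod (char (distr M borel (\<lambda>\<omega>. simple_stochastic_integral \<Lambda> g A \<omega> - simple_stochastic_integral \<Lambda> g' A \<omega>)) u)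
      = exp (- (\<Sum>p\<in>I. measure lborel (k -` {p} \<inter> A) * levy_re \<sigma>2 \<nu> (u * (fst p - snd p))))"
    using cmod_char_levy_sum[OF L I(1), where C = "\<lambda>p. k -` {p} \<inter> A" and v = "\<lambda>p. fst p - snd p" and u = u] bbA
    by (auto simp: disjoint_family_on_def)
  have pw: "indicator A x * levy_re \<sigma>2 \<nu> (u * (g x - g' x)) =
      (\<Sum>p\<in>I. levy_re \<sigma>2 \<nu> (u * (fst p - snd p)) * indicator (k -` {p} \<inter> A) x)" for x A
  proof -
    have "(\<Sum>p\<in>I. levy_re \<sigma>2 \<nu> (u * (fst p - snd p)) * indicator (k -` {p} \<inter> A) x)
       = (\<Sum>p\<in>I. if p = k x then levy_re \<sigma>2 \<nu> (u * (fst p - snd p)) * indicator A x else 0)"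
      by (intro sum.cong) (auto simp: indicator_def)
    also have "\<dots> = (if k x \<in> I then levy_re \<sigma>2 \<nu> (u * (g x - g' x)) * indicator A x else 0)"
      using I by (simp add: k_def)
    also have "\<dots> = indicator A x * levy_re \<sigma>2 \<nu> (u * (g x - g' x))" by (auto simp: I_def k_def)
    finally show ?thesis by simp
  qed
  have int: "integrable lborel (indicator B :: 'x \<Rightarrow> real)" if "B \<in> bounded_borel" for B
    using that emeasure_bounded_finite[of B] by (auto simp: bounded_borel_def less_top intro!: integrable_real_indicator)
  have "(LINT x:A|lborel. levy_re \<sigma>2 \<nu> (u * (g x - g' x))) =
      (\<Sum>p\<in>I. levy_re \<sigma>2 \<nu> (u * (fst p - snd p)) * measure lborel (k -` {p} \<inter> A))"
    unfolding set_lebesgue_integral_def real_scaleR_def pw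
    using int[OF bbA] by (subst Bochner_Integration.integral_sum) auto
  with char show ?T1 by (simp add: mult.commute)
  have "integrable lborel (\<lambda>x. \<Sum>p\<in>I. levy_re \<sigma>2 \<nu> (u * (fst p - snd p)) * indicator (k -` {p} \<inter> UNIV) x)"
    using int[OF bb] by (intro Bochner_Integration.integrable_sum integrable_mult_right) auto
  then show ?T2 unfolding pw[symmetric] by simp
qed

section \<open>The variance of a difference of stochastic integrals\<close>

text \<open>Setwise convergence of the exponents is obtained by taking logarithms, which needs
  nonzero limits of the moduli. The hypothesis \<open>nz\<close> supplies this on the whole space;
  it carries over to every Borel set \<open>A\<close>, since \<open>h n\<close> is nonnegative and
  the exponent over \<open>A\<close> is at most the one over \<open>UNIV\<close>. Square
  integrability of \<open>f - f'\<close> makes the limit \<open>H\<close> integrable.\<close>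

lemma cmod_char_stochastic_integral_diff:
  fixes \<Lambda> :: "('x :: euclidean_space) set \<Rightarrow> 'a \<Rightarrow> real"
  assumes L: "homogeneous_levy_basis M \<Lambda> \<beta> \<sigma>2 \<nu>" and fin: "levy_finite_second_moment M \<Lambda>"
    and f: "has_stochastic_integral M \<Lambda> f X" and f': "has_stochastic_integral M \<Lambda> f' X'"
    and sq: "integrable lborel (\<lambda>x. (f x - f' x)\<^sup>2)"
    and nz: "char (distr M borel (\<lambda>\<omega>. X \<omega> - X' \<omega>)) u \<noteq> 0"
  shows "cmod (char (distr M borel (\<lambda>\<omega>. X \<omega> - X' \<omega>)) u) = exp (- (LINT x|lborel. levy_re \<sigma>2 \<nu> (u * (f x - f' x))))"
proof -
  note D = homogeneous_levy_basisD[OF L]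
  interpret prob_space M by (rule D(1))
  note z2 = homogeneous_levy_basis_second_moment[OF L fin]
  have [measurable]: "f \<in> borel_measurable borel" "f' \<in> borel_measurable borel" "X \<in> borel_measurable M" "X' \<in> borel_measurable M"
    using f f' by (auto simp: has_stochastic_integral_def)
  obtain g where g: "\<And>n. bounded_simple (g n)" "AE x in lborel. (\<lambda>n. g n x) \<longlonglongrightarrow> f x"
      "\<And>A. A \<in> sets borel \<Longrightarrow> \<exists>Z\<in>borel_measurable M. tendsto_in_probability M (\<lambda>n. simple_stochastic_integral \<Lambda> (g n) A) Z"
      "tendsto_in_probability M (\<lambda>n. simple_stochastic_integral \<Lambda> (g n) UNIV) X"
    using f unfolding has_stochastic_integral_def by blast
  obtain g' where g': "\<And>n. bounded_simple (g' n)" "AE x in lborel. (\<lambda>n. g' n x) \<longlonglongrightarrow> f' x"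
      "\<And>A. A \<in> sets borel \<Longrightarrow> \<exists>Z\<in>borel_measurable M. tendsto_in_probability M (\<lambda>n. simple_stochastic_integral \<Lambda> (g' n) A) Z"
      "tendsto_in_probability M (\<lambda>n. simple_stochastic_integral \<Lambda> (g' n) UNIV) X'"
    using f' unfolding has_stochastic_integral_def by blast
  have [measurable]: "levy_re \<sigma>2 \<nu> \<in> borel_measurable borel"
    by (intro borel_measurable_continuous_onI continuous_on_levy_re D z2)
  define h where "h n x = levy_re \<sigma>2 \<nu> (u * (g n x - g' n x))" for n x
  define H where "H x = levy_re \<sigma>2 \<nu> (u * (f x - f' x))" for x
  have [measurable]: "H \<in> borel_measurable borel" unfolding H_def[abs_def] by measurable
  have h_int: "integrable lborel (h n)" for n
    unfolding h_def by (rule cmod_char_simple_diff(2)[OF L g(1) g'(1), of UNIV]) simp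
  have H_int: "integrable lborel H"
  proof (rule Bochner_Integration.integrable_bound)
    show "integrable lborel (\<lambda>x. levy_variance \<sigma>2 \<nu> * u\<^sup>2 / 2 * (f x - f' x)\<^sup>2)"
      using sq by (rule integrable_mult_right)
    show "AE x in lborel. norm (H x) \<le> norm (levy_variance \<sigma>2 \<nu> * u\<^sup>2 / 2 * (f x - f' x)\<^sup>2)"
    proof (rule AE_I2)
      fix x
      have "H x \<le> levy_variance \<sigma>2 \<nu> * u\<^sup>2 / 2 * (f x - f' x)\<^sup>2"
        using levy_re_le[OF D(3) z2, of \<sigma>2 "u * (f x - f' x)"] by (simp add: H_def power_mult_distrib mult_ac)
      then show "norm (H x) \<le> norm (levy_variance \<sigma>2 \<nu> * u\<^sup>2 / 2 * (f x - f' x)\<^sup>2)"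
        using levy_re_nonneg[OF D(2), of \<nu> "u * (f x - f' x)"] unfolding real_norm_def H_def by linarith
    qed
  qed measurable
  define m where "m A n = (LINT x:A|lborel. h n x)" for A n
  have m_char: "cmod (char (distr M borel (\<lambda>\<omega>. simple_stochastic_integral \<Lambda> (g n) A \<omega> - simple_stochastic_integral \<Lambda> (g' n) A \<omega>)) u)
      = exp (- m A n)" if "A \<in> sets borel" for A n
    unfolding m_def h_def by (rule cmod_char_simple_diff(1)[OF L g(1) g'(1) that])
  have lim: "(\<lambda>n. exp (- m A n)) \<longlonglongrightarrow> cmod (char (distr M borel (\<lambda>\<omega>. Z \<omega> - Z' \<omega>)) u)"
    if "A \<in> sets borel" "Z \<in> borel_measurable M" "Z' \<in> borel_measurable M"
      "tendsto_in_probability M (\<lambda>n. simple_stochastic_integral \<Lambda> (g n) A) Z"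
      "tendsto_in_probability M (\<lambda>n. simple_stochastic_integral \<Lambda> (g' n) A) Z'" for A Z Z'
    unfolding m_char[OF that(1), symmetric]
    by (intro tendsto_norm tendsto_char_diff_in_probability that
        simple_stochastic_integral_measurable[OF L] g(1) g'(1))
  let ?c = "cmod (char (distr M borel (\<lambda>\<omega>. X \<omega> - X' \<omega>)) u)"
  have "(\<lambda>n. - ln (exp (- m UNIV n))) \<longlonglongrightarrow> - ln ?c"
    using nz by (intro tendsto_minus tendsto_ln lim g(4) g'(4)) auto
  then have mU: "m UNIV \<longlonglongrightarrow> - ln ?c" by simp
  obtain K where K: "\<And>n. m UNIV n \<le> K"
    using convergent_imp_Bseq[OF convergentI[OF mU]] unfolding Bseq_def by (auto dest: abs_le_D1)
  have "(\<lambda>n. LINT x|lborel. h n x) \<longlonglongrightarrow> (LINT x|lborel. H x)"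
  proof (rule tendsto_integral_of_setwise_convergent[OF sigma_finite_lborel h_int H_int])
    show "h n x \<ge> 0" "H x \<ge> 0" for n x unfolding h_def H_def by (intro levy_re_nonneg D(2))+
    show "AE x in lborel. (\<lambda>n. h n x) \<longlonglongrightarrow> H x"
      using g(2) g'(2) unfolding h_def H_def
      by eventually_elim (intro levy_re_tendsto D z2 tendsto_intros)
    fix A :: "'x set" assume "A \<in> sets lborel"
    then have A: "A \<in> sets borel" by simp
    obtain Z where Z: "Z \<in> borel_measurable M" "tendsto_in_probability M (\<lambda>n. simple_stochastic_integral \<Lambda> (g n) A) Z"
      using g(3)[OF A] by blast
    obtain Z' where Z': "Z' \<in> borel_measurable M" "tendsto_in_probability M (\<lambda>n. simple_stochastic_integral \<Lambda> (g' n) A) Z'"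
      using g'(3)[OF A] by blast
    let ?a = "cmod (char (distr M borel (\<lambda>\<omega>. Z \<omega> - Z' \<omega>)) u)"
    have l: "(\<lambda>n. exp (- m A n)) \<longlonglongrightarrow> ?a" by (rule lim[OF A Z(1) Z'(1) Z(2) Z'(2)])
    have le: "m A n \<le> m UNIV n" for n
      unfolding m_def set_lebesgue_integral_def
      using A levy_re_nonneg[OF D(2)]
      by (intro integral_mono integrable_mult_indicator h_int) (auto simp: h_def indicator_def)
    have "exp (- K) \<le> exp (- m A n)" for n using order_trans[OF le K, of n] by simp
    then have "exp (- K) \<le> ?a" by (intro LIMSEQ_le_const[OF l]) auto
    then have "?a \<noteq> 0" using exp_gt_zero[of "- K"] by linarith
    then have "(\<lambda>n. - ln (exp (- m A n))) \<longlonglongrightarrow> - ln ?a" by (intro tendsto_minus tendsto_ln l)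
    then show "convergent (\<lambda>n. LINT x:A|lborel. h n x)" unfolding m_def[symmetric] ln_exp by (auto simp: convergent_def)
  qed
  then have "m UNIV \<longlonglongrightarrow> (LINT x|lborel. H x)" by (simp add: m_def[abs_def] set_lebesgue_integral_def)
  then have "(LINT x|lborel. H x) = - ln ?c" using mU by (rule LIMSEQ_unique)
  then show ?thesis using nz unfolding H_def by simp
qed

theorem variance_stochastic_integral_diff:
  fixes \<Lambda> :: "('x :: euclidean_space) set \<Rightarrow> 'a \<Rightarrow> real"
  assumes L: "homogeneous_levy_basis M \<Lambda> \<beta> \<sigma>2 \<nu>" and fin: "levy_finite_second_moment M \<Lambda>"
    and f: "has_stochastic_integral M \<Lambda> f X" and f': "has_stochastic_integral M \<Lambda> f' X'"
    and sq: "integrable lborel (\<lambda>x. (f x - f' x)\<^sup>2)"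
  shows "prob_space.variance M (\<lambda>\<omega>. X \<omega> - X' \<omega>) = levy_variance \<sigma>2 \<nu> * (LINT x|lborel. (f x - f' x)\<^sup>2)"
proof -
  note D = homogeneous_levy_basisD[OF L]
  interpret prob_space M by (rule D(1))
  note z2 = homogeneous_levy_basis_second_moment[OF L fin]
  have [measurable]: "f \<in> borel_measurable borel" "f' \<in> borel_measurable borel" "X \<in> borel_measurable M" "X' \<in> borel_measurable M"
    using f f' by (auto simp: has_stochastic_integral_def)
  have [measurable]: "levy_re \<sigma>2 \<nu> \<in> borel_measurable borel"
    by (intro borel_measurable_continuous_onI continuous_on_levy_re D z2)
  let ?\<kappa> = "levy_variance \<sigma>2 \<nu>"
  define \<phi> where "\<phi> = char (distr M borel (\<lambda>\<omega>. X \<omega> - X' \<omega>))"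
  interpret R: real_distribution "distr M borel (\<lambda>\<omega>. X \<omega> - X' \<omega>)" by (rule real_distribution_distr) measurable
  \<comment> \<open>Being continuous with value \<open>1\<close> at \<open>0\<close>,
    \<open>\<phi>\<close> has no zeros near \<open>0\<close>; the sequence \<open>u\<close> stays in
    that neighbourhood, where the formula for the modulus is available.\<close>
  have "isCont \<phi> 0" "\<phi> 0 = 1" unfolding \<phi>_def by (rule R.isCont_char, rule R.char_zero)
  then have "\<forall>\<^sub>F u in at 0. \<phi> u \<noteq> 0"
    unfolding isCont_def by (metis tendsto_imp_eventually_ne zero_neq_one)
  then obtain \<epsilon> where \<epsilon>: "\<epsilon> > 0" "\<And>u. u \<noteq> 0 \<Longrightarrow> \<bar>u\<bar> < \<epsilon> \<Longrightarrow> \<phi> u \<noteq> 0"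
    unfolding eventually_at by (auto simp: dist_real_def)
  define u where "u n = \<epsilon> / 2 * inverse (real (Suc n))" for n
  have u_pos: "u n > 0" for n using \<epsilon>(1) by (simp add: u_def)
  have u_ne: "u n \<noteq> 0" for n using u_pos[of n] by linarith
  have u0: "u \<longlonglongrightarrow> 0" unfolding u_def using tendsto_mult[OF tendsto_const LIMSEQ_inverse_real_of_nat] by fastforce
  have u_less: "\<bar>u n\<bar> < \<epsilon>" for n
  proof -
    have "u n \<le> \<epsilon> / 2 * 1" unfolding u_def using \<epsilon>(1) by (intro mult_left_mono) (auto simp: field_simps)
    then show ?thesis using u_pos[of n] \<epsilon>(1) by linarith
  qed
  define I where "I n = (LINT x|lborel. levy_re \<sigma>2 \<nu> (u n * (f x - f' x)))" for n
  have \<phi>_eq: "cmod (\<phi> (u n)) = exp (- I n)" for n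
    unfolding \<phi>_def I_def
    by (rule cmod_char_stochastic_integral_diff[OF L fin f f' sq]) (use \<epsilon>(2)[OF u_ne u_less] in \<open>simp add: \<phi>_def\<close>)
  have I_nonneg: "I n \<ge> 0" for n unfolding I_def by (intro integral_nonneg_AE) (simp add: levy_re_nonneg D(2))
  have "(\<lambda>n. LINT x|lborel. levy_re \<sigma>2 \<nu> (u n * (f x - f' x)) / (u n)\<^sup>2) \<longlonglongrightarrow> (LINT x|lborel. ?\<kappa> / 2 * (f x - f' x)\<^sup>2)"
  proof (rule integral_dominated_convergence[where w = "\<lambda>x. ?\<kappa> / 2 * (f x - f' x)\<^sup>2"])
    show "integrable lborel (\<lambda>x. ?\<kappa> / 2 * (f x - f' x)\<^sup>2)" using sq by (rule integrable_mult_right)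
    show "AE x in lborel. (\<lambda>n. levy_re \<sigma>2 \<nu> (u n * (f x - f' x)) / (u n)\<^sup>2) \<longlonglongrightarrow> ?\<kappa> / 2 * (f x - f' x)\<^sup>2"
    proof (rule AE_I2)
      fix x
      define w where "w = f x - f' x"
      have "(\<lambda>n. levy_re \<sigma>2 \<nu> (u n * w) / (u n)\<^sup>2) \<longlonglongrightarrow> ?\<kappa> / 2 * w\<^sup>2"
      proof (cases "w = 0")
        case False
        have "(\<lambda>n. levy_re \<sigma>2 \<nu> (u n * w) / (u n * w)\<^sup>2) \<longlonglongrightarrow> ?\<kappa> / 2"
          using False u_ne tendsto_mult[OF u0 tendsto_const[of w]]
          by (intro levy_re_over_square_tendsto D z2) auto
        from tendsto_mult[OF this tendsto_const[of "w\<^sup>2"]] show ?thesis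
          using False by (simp add: power_mult_distrib)
      qed simp
      then show "(\<lambda>n. levy_re \<sigma>2 \<nu> (u n * (f x - f' x)) / (u n)\<^sup>2) \<longlonglongrightarrow> ?\<kappa> / 2 * (f x - f' x)\<^sup>2"
        by (simp only: w_def)
    qed
    show "AE x in lborel. norm (levy_re \<sigma>2 \<nu> (u n * (f x - f' x)) / (u n)\<^sup>2) \<le> ?\<kappa> / 2 * (f x - f' x)\<^sup>2" for n
    proof (rule AE_I2)
      fix x
      show "norm (levy_re \<sigma>2 \<nu> (u n * (f x - f' x)) / (u n)\<^sup>2) \<le> ?\<kappa> / 2 * (f x - f' x)\<^sup>2"
        using levy_re_le[OF D(3) z2, of \<sigma>2 "u n * (f x - f' x)"] levy_re_nonneg[OF D(2), of \<nu> "u n * (f x - f' x)"] u_ne[of n]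
        by (simp add: power_mult_distrib divide_le_eq mult_ac)
    qed
  qed measurable
  then have I_lim: "(\<lambda>n. I n / (u n)\<^sup>2) \<longlonglongrightarrow> ?\<kappa> / 2 * (LINT x|lborel. (f x - f' x)\<^sup>2)"
    unfolding I_def by simp
  then have J: "(\<lambda>n. 2 * (I n / (u n)\<^sup>2)) \<longlonglongrightarrow> ?\<kappa> * (LINT x|lborel. (f x - f' x)\<^sup>2)"
    using tendsto_mult[OF tendsto_const[of 2] I_lim] by simp
  have "(\<lambda>n. I n / (u n)\<^sup>2 * (u n)\<^sup>2) \<longlonglongrightarrow> ?\<kappa> / 2 * (LINT x|lborel. (f x - f' x)\<^sup>2) * 0\<^sup>2"
    by (intro tendsto_mult I_lim tendsto_power u0)
  then have I0: "I \<longlonglongrightarrow> 0" using u_ne by simp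
  have "(\<lambda>n. (1 - (cmod (\<phi> (u n)))\<^sup>2) / (u n)\<^sup>2) \<longlonglongrightarrow> ?\<kappa> * (LINT x|lborel. (f x - f' x)\<^sup>2)"
  \<comment> \<open>The squared modulus is \<open>exp (- (2 * I n))\<close>. With
    \<open>y = 2 * I n\<close>, the quantity \<open>1 - exp (- y)\<close> lies between
    \<open>y / (1 + y)\<close> and \<open>y\<close>, which agree to first order because
    \<open>I\<close> tends to \<open>0\<close>.\<close>
  proof (rule tendsto_sandwich[where f = "\<lambda>n. 2 * (I n / (u n)\<^sup>2) / (1 + 2 * I n)" and h = "\<lambda>n. 2 * (I n / (u n)\<^sup>2)"])
    have sq_exp: "(exp (- I n))\<^sup>2 = exp (- (2 * I n))" for n by (simp add: exp_double[symmetric])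
    show "(\<lambda>n. 2 * (I n / (u n)\<^sup>2)) \<longlonglongrightarrow> ?\<kappa> * (LINT x|lborel. (f x - f' x)\<^sup>2)" by (rule J)
    have "(\<lambda>n. 2 * (I n / (u n)\<^sup>2) / (1 + 2 * I n)) \<longlonglongrightarrow> ?\<kappa> * (LINT x|lborel. (f x - f' x)\<^sup>2) / (1 + 2 * 0)"
      by (intro tendsto_divide J tendsto_intros I0) simp
    then show "(\<lambda>n. 2 * (I n / (u n)\<^sup>2) / (1 + 2 * I n)) \<longlonglongrightarrow> ?\<kappa> * (LINT x|lborel. (f x - f' x)\<^sup>2)" by simp
    have "1 - exp (- (2 * I n)) \<le> 2 * I n" for n
      using exp_ge_add_one_self[of "- (2 * I n)"] by linarith
    then have "(1 - (cmod (\<phi> (u n)))\<^sup>2) / (u n)\<^sup>2 \<le> 2 * I n / (u n)\<^sup>2" for n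
      unfolding \<phi>_eq sq_exp by (intro divide_right_mono) auto
    then show "\<forall>\<^sub>F n in sequentially. (1 - (cmod (\<phi> (u n)))\<^sup>2) / (u n)\<^sup>2 \<le> 2 * (I n / (u n)\<^sup>2)" by simp
    have "2 * I n / (1 + 2 * I n) \<le> 1 - exp (- (2 * I n))" for n
    proof -
      have "exp (- (2 * I n)) \<le> 1 / (1 + 2 * I n)"
        using exp_ge_add_one_self[of "2 * I n"] I_nonneg[of n] unfolding exp_minus inverse_eq_divide
        by (intro divide_left_mono) auto
      moreover have "2 * I n / (1 + 2 * I n) = 1 - 1 / (1 + 2 * I n)" using I_nonneg[of n] by (simp add: field_simps)
      ultimately show ?thesis by linarith
    qed
    then have "2 * I n / (1 + 2 * I n) / (u n)\<^sup>2 \<le> (1 - (cmod (\<phi> (u n)))\<^sup>2) / (u n)\<^sup>2" for n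
      unfolding \<phi>_eq sq_exp by (intro divide_right_mono) auto
    then show "\<forall>\<^sub>F n in sequentially. 2 * (I n / (u n)\<^sup>2) / (1 + 2 * I n) \<le> (1 - (cmod (\<phi> (u n)))\<^sup>2) / (u n)\<^sup>2"
      by (simp add: mult.commute)
  qed
  from variance_eq_limit_char[OF _ u0 u_ne this[unfolded \<phi>_def]] show ?thesis by measurable
qed

section \<open>Companion matrices and sums of exponentials\<close>

lemma separating_poly:
  fixes w :: complex
  assumes "finite T" "w \<in> T"
  obtains q where "degree q = card T - 1" "\<And>z. z \<in> T - {w} \<Longrightarrow> poly q z = 0" "poly q w \<noteq> 0"
proof
  let ?q = "\<Prod>z\<in>T - {w}. [:- z, 1:]"
  show "degree ?q = card T - 1" using assms by (subst degree_prod_eq_sum_degree) auto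
  show "poly ?q z = 0" if "z \<in> T - {w}" for z using that assms by (auto simp: poly_prod)
  show "poly ?q w \<noteq> 0" using assms by (auto simp: poly_prod)
qed

lemma poly_eq_sum_lessThan:
  fixes q :: "'a :: comm_semiring_1 poly"
  assumes "degree q < n"
  shows "poly q x = (\<Sum>i<n. coeff q i * x ^ i)"
  unfolding poly_altdef by (rule sum.mono_neutral_left) (use assms in \<open>auto simp: coeff_eq_0\<close>)

text \<open>Invertibility of a Vandermonde matrix: the power sums are paired with the coefficients
  of a polynomial of degree \<open>card T - 1\<close> that vanishes on \<open>T\<close> except at
  \<open>w\<close>, which isolates \<open>c w\<close>.\<close>

lemma power_sums_eq_0_imp_coeff_eq_0:
  fixes c :: "complex \<Rightarrow> complex"
  assumes T: "finite T" and w: "w \<in> T" and zero: "\<And>j. j < card T \<Longrightarrow> (\<Sum>z\<in>T. c z * z ^ j) = 0"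
  shows "c w = 0"
proof -
  obtain q where q: "degree q = card T - 1" "\<And>z. z \<in> T - {w} \<Longrightarrow> poly q z = 0" "poly q w \<noteq> 0"
    using separating_poly[OF T w] by blast
  have "card T > 0" using T w by (auto simp: card_gt_0_iff)
  then have deg: "degree q < card T" using q(1) by simp
  have "c w * poly q w = (\<Sum>z\<in>T. c z * poly q z)"
    using T w q(2) by (subst sum.remove[OF T w]) auto
  also have "\<dots> = (\<Sum>z\<in>T. \<Sum>j<card T. coeff q j * (c z * z ^ j))"
    by (simp add: poly_eq_sum_lessThan[OF deg] sum_distrib_left mult_ac)
  also have "\<dots> = (\<Sum>j<card T. coeff q j * (\<Sum>z\<in>T. c z * z ^ j))"
    by (subst sum.swap) (simp add: sum_distrib_left)
  also have "\<dots> = 0" using zero by simp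
  finally show ?thesis using q(3) by simp
qed

text \<open>Differences of consecutive samples remove the constant:
  \<open>(1 - z ^ j) - (1 - z ^ Suc j) = - ((1 - z) * z ^ j)\<close> for a node \<open>z\<close>. So
  samples up to the index \<open>card T\<close> give \<open>card T\<close> power sums with
  coefficients \<open>d l * (1 - z)\<close>, from which \<open>ne1\<close> recovers
  \<open>d l\<close>. It serves both to compare two variograms and to prove the uniqueness of one
  representation.\<close>

lemma exponential_samples_eq_0_imp_coeff_eq_0:
  fixes d :: "complex \<Rightarrow> complex"
  assumes T: "finite T" and inj: "inj_on (\<lambda>l. exp (l * complex_of_real \<Delta>)) T"
    and ne1: "\<And>l. l \<in> T \<Longrightarrow> exp (l * complex_of_real \<Delta>) \<noteq> 1"
    and zero: "\<And>j. j \<le> card T \<Longrightarrow> (\<Sum>l\<in>T. d l * (1 - exp (l * complex_of_real (real j * \<Delta>)))) = 0"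
    and l: "l \<in> T"
  shows "d l = 0"
proof -
  define w where "w l = exp (l * complex_of_real \<Delta>)" for l
  define v where "v = the_inv_into T w"
  have w_inj: "inj_on w T" using inj by (simp add: w_def[abs_def])
  have v: "v (w l) = l" if "l \<in> T" for l unfolding v_def by (rule the_inv_into_f_f[OF w_inj that])
  have card: "card (w ` T) = card T" by (rule card_image[OF w_inj])
  have pow: "exp (l * complex_of_real (real j * \<Delta>)) = w l ^ j" for l j
    by (simp add: w_def mult_ac flip: exp_of_nat_mult)
  have "(\<Sum>z\<in>w ` T. (d (v z) * (1 - z)) * z ^ j) = 0" if "j < card (w ` T)" for j
  proof -
    have "(\<Sum>z\<in>w ` T. (d (v z) * (1 - z)) * z ^ j) = (\<Sum>l\<in>T. d l * (1 - w l) * w l ^ j)"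
      by (subst sum.reindex[OF w_inj]) (simp add: v)
    also have "\<dots> = (\<Sum>l\<in>T. d l * (1 - w l ^ Suc j)) - (\<Sum>l\<in>T. d l * (1 - w l ^ j))"
      by (simp add: sum_subtractf[symmetric] algebra_simps)
    also have "\<dots> = 0" using zero[of "Suc j"] zero[of j] that card unfolding pow by simp
    finally show ?thesis .
  qed
  then have "d (v (w l)) * (1 - w l) = 0"
    by (rule power_sums_eq_0_imp_coeff_eq_0[rotated 2]) (use T l in auto)
  then show ?thesis using v[OF l] ne1[OF l] by (simp add: w_def)
qed

section \<open>Spectrum, powers and exponentials of companion matrices\<close>

lemma companion_matrix_carrier: "companion_matrix a \<in> carrier_mat (degree a) (degree a)"
  by (simp add: companion_matrix_def Let_def)

lemma companion_matrix_mult_vec: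
  assumes v: "v \<in> carrier_vec (degree a)" and r: "r < degree a"
  shows "(map_mat complex_of_real (companion_matrix a) *\<^sub>v v) $ r =
    (if r = degree a - 1 then - (\<Sum>c<degree a. complex_of_real (coeff a c) * v $ c) else v $ Suc r)"
proof -
  have "(map_mat complex_of_real (companion_matrix a) *\<^sub>v v) $ r =
      (\<Sum>c<degree a. complex_of_real (companion_matrix a $$ (r, c)) * v $ c)"
    using v r companion_matrix_carrier[of a] by (simp add: scalar_prod_def lessThan_atLeast0)
  also have "\<dots> = (\<Sum>c<degree a. if r = degree a - 1 then - (complex_of_real (coeff a c) * v $ c)
      else if c = Suc r then v $ Suc r else 0)"
    using r by (intro sum.cong) (auto simp: companion_matrix_def Let_def)
  also have "\<dots> = (if r = degree a - 1 then - (\<Sum>c<degree a. complex_of_real (coeff a c) * v $ c) else v $ Suc r)"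
    using r by (auto simp: sum_negf)
  finally show ?thesis .
qed

lemma poly_monic_split:
  assumes "lead_coeff a = (1::real)"
  shows "poly (map_poly complex_of_real a) l = (\<Sum>c<degree a. complex_of_real (coeff a c) * l ^ c) + l ^ degree a"
  using assms by (simp add: poly_altdef degree_map_poly coeff_map_poly flip: lessThan_Suc_atMost)

text \<open>All rows but the last force an eigenvector to be a multiple of
  \<open>(1, l, l ^ 2, ...)\<close>; the last row then is the polynomial equation at
  \<open>l\<close>.\<close>

lemma complex_spectrum_companion_matrix_root:
  assumes monic: "lead_coeff a = 1" and l: "l \<in> complex_spectrum (companion_matrix a)"
  shows "poly (map_poly complex_of_real a) l = 0"
proof -
  let ?p = "degree a" and ?A = "map_mat complex_of_real (companion_matrix a)"
  obtain v where v: "v \<in> carrier_vec ?p" "v \<noteq> 0\<^sub>v ?p" "?A *\<^sub>v v = l \<cdot>\<^sub>v v"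
    using l companion_matrix_carrier[of a] by (auto simp: spectrum_def eigenvalue_def eigenvector_def)
  have "?p \<noteq> 0" using v(1,2) by (intro notI) auto
  have rec: "(?A *\<^sub>v v) $ r = l * v $ r" if "r < ?p" for r using v that by simp
  have "v $ r = l ^ r * v $ 0" if "r < ?p" for r
    using that
  proof (induction r)
    case (Suc r)
    then have "v $ Suc r = l * v $ r"
      using rec[of r] companion_matrix_mult_vec[OF v(1), of r] by (auto split: if_splits)
    then show ?case using Suc by simp
  qed simp
  note v_pow = this
  have "v $ 0 \<noteq> 0"
  proof
    assume "v $ 0 = 0"
    then have "v = 0\<^sub>v ?p" using v(1) v_pow by (intro eq_vecI) auto
    with v(2) show False by contradiction
  qed
  have "- (\<Sum>c<?p. complex_of_real (coeff a c) * v $ c) = l * v $ (?p - 1)"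
    using rec[of "?p - 1"] companion_matrix_mult_vec[OF v(1), of "?p - 1"] \<open>?p \<noteq> 0\<close> by simp
  moreover have "(\<Sum>c<?p. complex_of_real (coeff a c) * v $ c) = (\<Sum>c<?p. complex_of_real (coeff a c) * l ^ c) * v $ 0"
    unfolding sum_distrib_right by (intro sum.cong refl, subst v_pow) auto
  moreover have "l * v $ (?p - 1) = l ^ ?p * v $ 0"
    using v_pow[of "?p - 1"] \<open>?p \<noteq> 0\<close> power_eq_if[of l ?p] by simp
  ultimately have "((\<Sum>c<?p. complex_of_real (coeff a c) * l ^ c) + l ^ ?p) * v $ 0 = 0"
    by (simp add: distrib_right add_eq_0_iff)
  with \<open>v $ 0 \<noteq> 0\<close> show ?thesis by (simp add: poly_monic_split[OF monic])
qed

lemma monic_poly_eqI_roots: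
  fixes a a' :: "real poly"
  assumes "degree a = n" "degree a' = n" "lead_coeff a = 1" "lead_coeff a' = 1"
    and S: "card S = n" "finite S"
    and "\<And>z. z \<in> S \<Longrightarrow> poly (map_poly complex_of_real a) z = 0"
    and "\<And>z. z \<in> S \<Longrightarrow> poly (map_poly complex_of_real a') z = 0"
  shows "a = a'"
proof (rule ccontr)
  assume ne: "a \<noteq> a'"
  let ?q = "map_poly complex_of_real a - map_poly complex_of_real a'"
  have c: "coeff ?q i = complex_of_real (coeff a i - coeff a' i)" for i by (simp add: coeff_map_poly)
  have q0: "?q \<noteq> 0"
  proof
    assume "?q = 0"
    then have "complex_of_real (coeff a i - coeff a' i) = 0" for i by (simp only: c[symmetric] coeff_0)
    then have "coeff a i = coeff a' i" for i by (simp only: of_real_eq_0_iff right_minus_eq)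
    then have "a = a'" by (rule poly_eqI)
    then show False using ne by contradiction
  qed
  have q: "poly ?q z = 0" if "z \<in> S" for z
    using assms(7,8)[OF that] by simp
  have high: "coeff ?q i = 0" if "i \<ge> n" for i
  proof (cases "i = n")
    case True
    then show ?thesis using assms(1-4) unfolding c by simp
  next
    case False
    then show ?thesis using that assms(1,2) unfolding c by (simp add: coeff_eq_0)
  qed
  have "degree ?q < n"
  proof (rule ccontr)
    assume "\<not> degree ?q < n"
    then have "lead_coeff ?q = 0" by (intro high) simp
    then show False using q0 by (simp only: leading_coeff_0_iff)
  qed
  moreover have "card S \<le> card {z. poly ?q z = 0}"
    using q q0 by (intro card_mono poly_roots_finite) auto
  moreover have "card {z. poly ?q z = 0} \<le> degree ?q" by (rule card_poly_roots_bound[OF q0])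
  ultimately show False using S by linarith
qed

lemma smult_mat_pow:
  fixes A :: "'a :: comm_semiring_1 mat"
  assumes A: "A \<in> carrier_mat n n"
  shows "(t \<cdot>\<^sub>m A) ^\<^sub>m k = t ^ k \<cdot>\<^sub>m (A ^\<^sub>m k)"
proof (induction k)
  case 0
  show ?case using A by (auto intro!: eq_matI)
next
  case (Suc k)
  have "(t ^ k \<cdot>\<^sub>m (A ^\<^sub>m k)) * (t \<cdot>\<^sub>m A) = (t ^ k * t) \<cdot>\<^sub>m (A ^\<^sub>m k * A)"
    using A pow_carrier_mat[OF A, of k]
    by (intro eq_matI) (auto simp: mult_smult_assoc_mat[of _ n n _ n] mult_smult_distrib[of _ n n _ n] mult_ac)
  then show ?case using Suc by (simp add: mult.commute)
qed

lemma index_mult_mat_entry: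
  assumes "B \<in> carrier_mat n m" "C \<in> carrier_mat m k" "i < n" "j < k"
  shows "(B * C) $$ (i, j) = (\<Sum>l<m. B $$ (i, l) * C $$ (l, j))"
  using assms by (simp add: scalar_prod_def lessThan_atLeast0)

text \<open>The columns of the Vandermonde matrix \<open>V\<close> of the distinct roots are
  eigenvectors, so the powers are \<open>V * D ^ k * W\<close> with the diagonal matrix
  \<open>D\<close> of the roots and the inverse \<open>W\<close> of \<open>V\<close>. The
  coefficient at each root is thus independent of \<open>k\<close>, as summing the exponential
  series requires.\<close>

lemma companion_matrix_pow_entry:
  assumes monic: "lead_coeff a = 1"
    and S: "finite S" "card S = degree a" "\<And>l. l \<in> S \<Longrightarrow> poly (map_poly complex_of_real a) l = 0"
    and r: "r < degree a" and s: "s < degree a"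
  obtains c where "\<And>k. complex_of_real ((companion_matrix a ^\<^sub>m k) $$ (r, s)) = (\<Sum>l\<in>S. c l * l ^ k)"
proof -
  let ?p = "degree a"
  define A where "A = map_mat complex_of_real (companion_matrix a)"
  have A: "A \<in> carrier_mat ?p ?p" using companion_matrix_carrier[of a] by (simp add: A_def)
  obtain e where e: "bij_betw e {..<?p} S"
    using ex_bij_betw_nat_finite[OF S(1)] S(2) by (auto simp: lessThan_atLeast0)
  have eS: "e j \<in> S" if "j < ?p" for j using e that by (auto simp: bij_betw_def)
  have e_inj: "i = j" if "e i = e j" "i < ?p" "j < ?p" for i j
    using e that by (auto simp: bij_betw_def inj_on_def)
  define V where "V = mat ?p ?p (\<lambda>(r, j). e j ^ r)"
  have V: "V \<in> carrier_mat ?p ?p" by (simp add: V_def)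
  \<comment> \<open>Row \<open>i\<close> of the inverse holds the coefficients of the Lagrange
    polynomial that is \<open>1\<close> at \<open>e i\<close> and \<open>0\<close> at the other
    roots.\<close>
  have "\<exists>q. degree q < ?p \<and> (\<forall>j<?p. poly q (e j) = (if j = i then 1 else 0))" if i: "i < ?p" for i
  proof -
    obtain q where q: "degree q = card S - 1" "\<And>z. z \<in> S - {e i} \<Longrightarrow> poly q z = 0" "poly q (e i) \<noteq> 0"
      using separating_poly[OF S(1) eS[OF i]] by blast
    show ?thesis
      by (rule exI[of _ "Polynomial.smult (1 / poly q (e i)) q"])
         (use q S(2) i eS e_inj in \<open>auto intro!: le_less_trans[OF degree_smult_le]\<close>)
  qed
  then obtain q where q: "\<And>i. i < ?p \<Longrightarrow> degree (q i) < ?p"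
      "\<And>i j. i < ?p \<Longrightarrow> j < ?p \<Longrightarrow> poly (q i) (e j) = (if j = i then 1 else 0)" by metis
  define W where "W = mat ?p ?p (\<lambda>(i, r). coeff (q i) r)"
  have W: "W \<in> carrier_mat ?p ?p" by (simp add: W_def)
  have "W * V = 1\<^sub>m ?p"
  proof (rule eq_matI)
    fix i j assume ij: "i < dim_row (1\<^sub>m ?p :: complex mat)" "j < dim_col (1\<^sub>m ?p :: complex mat)"
    then have "(W * V) $$ (i, j) = (\<Sum>r<?p. coeff (q i) r * e j ^ r)"
      by (simp add: W_def V_def scalar_prod_def lessThan_atLeast0)
    also have "\<dots> = poly (q i) (e j)" using q(1)[of i] ij by (simp add: poly_eq_sum_lessThan[of "q i" ?p])
    finally show "(W * V) $$ (i, j) = 1\<^sub>m ?p $$ (i, j)" using q(2) ij by simp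
  qed (use V W in auto)
  then have VW: "V * W = 1\<^sub>m ?p" by (rule mat_mult_left_right_inverse[OF W V])
  have col: "A *\<^sub>v col V j = e j \<cdot>\<^sub>v col V j" if j: "j < ?p" for j
  proof (rule eq_vecI)
    fix r assume "r < dim_vec (e j \<cdot>\<^sub>v col V j)"
    then have r: "r < ?p" using V by simp
    have c: "col V j $ c = e j ^ c" if "c < ?p" for c using that j by (simp add: V_def)
    have "(\<Sum>c<?p. complex_of_real (coeff a c) * e j ^ c) + e j ^ ?p = 0"
      using S(3)[OF eS[OF j]] poly_monic_split[OF monic] by simp
    then have "- (\<Sum>c<?p. complex_of_real (coeff a c) * e j ^ c) = e j ^ ?p"
      by (simp add: add_eq_0_iff)
    then show "(A *\<^sub>v col V j) $ r = (e j \<cdot>\<^sub>v col V j) $ r"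
      unfolding A_def using r j V
      by (subst companion_matrix_mult_vec) (auto simp: c power_eq_if[of "e j" ?p] simp del: index_col)
  qed (use A V in auto)
  have pow: "(A ^\<^sub>m k * V) $$ (r, j) = e j ^ k * V $$ (r, j)" if "r < ?p" "j < ?p" for r j k
  proof -
    have "(A ^\<^sub>m k) *\<^sub>v col V j = e j ^ k \<cdot>\<^sub>v col V j"
    proof (induction k)
      case 0
      show ?case using V A that by (auto intro!: eq_vecI)
    next
      case (Suc k)
      have cV: "col V j \<in> carrier_vec ?p" using V that by simp
      have "A ^\<^sub>m Suc k *\<^sub>v col V j = A ^\<^sub>m k *\<^sub>v (A *\<^sub>v col V j)"
        using assoc_mult_mat_vec[OF pow_carrier_mat[OF A, of k] A cV] by simp
      also have "\<dots> = e j \<cdot>\<^sub>v (A ^\<^sub>m k *\<^sub>v col V j)"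
        unfolding col[OF that(2)] by (rule mult_mat_vec[OF pow_carrier_mat[OF A] cV])
      finally show ?case using Suc by (simp add: smult_smult_assoc)
    qed
    then have "((A ^\<^sub>m k) *\<^sub>v col V j) $ r = (e j ^ k \<cdot>\<^sub>v col V j) $ r" by simp
    then show ?thesis using that V carrier_matD[OF pow_carrier_mat[OF A, of k]] by simp
  qed
  have entry: "complex_of_real ((companion_matrix a ^\<^sub>m k) $$ (r, s)) = (\<Sum>j<?p. (V $$ (r, j) * W $$ (j, s)) * e j ^ k)" for k
  proof -
    have "A ^\<^sub>m k = map_mat complex_of_real (companion_matrix a ^\<^sub>m k)"
      unfolding A_def by (rule of_real_hom.mat_hom_pow[OF companion_matrix_carrier, symmetric])
    then have "complex_of_real ((companion_matrix a ^\<^sub>m k) $$ (r, s)) = (A ^\<^sub>m k) $$ (r, s)"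
      using r s carrier_matD[OF pow_carrier_mat[OF companion_matrix_carrier, of a k]] by simp
    also have "A ^\<^sub>m k = (A ^\<^sub>m k * V) * W"
      using VW assoc_mult_mat[OF pow_carrier_mat[OF A, of k] V W] right_mult_one_mat[OF pow_carrier_mat[OF A, of k]] by simp
    also have "((A ^\<^sub>m k * V) * W) $$ (r, s) = (\<Sum>j<?p. (A ^\<^sub>m k * V) $$ (r, j) * W $$ (j, s))"
      using r s by (rule index_mult_mat_entry[OF mult_carrier_mat[OF pow_carrier_mat[OF A] V] W])
    finally show ?thesis using r by (simp add: pow mult_ac)
  qed
  show thesis
  proof
    fix k
    have "(\<Sum>l\<in>S. (V $$ (r, the_inv_into {..<?p} e l) * W $$ (the_inv_into {..<?p} e l, s)) * l ^ k)
      = (\<Sum>j<?p. (V $$ (r, j) * W $$ (j, s)) * e j ^ k)"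
      using e by (subst sum.reindex_bij_betw[OF e, symmetric]) (auto simp: bij_betw_def the_inv_into_f_f intro!: sum.cong)
    then show "complex_of_real ((companion_matrix a ^\<^sub>m k) $$ (r, s)) =
       (\<Sum>l\<in>S. (V $$ (r, the_inv_into {..<?p} e l) * W $$ (the_inv_into {..<?p} e l, s)) * l ^ k)"
      using entry by simp
  qed
qed

lemma mat_exp_companion_matrix_entry:
  assumes monic: "lead_coeff a = 1"
    and S: "finite S" "card S = degree a" "\<And>l. l \<in> S \<Longrightarrow> poly (map_poly complex_of_real a) l = 0"
    and r: "r < degree a" and s: "s < degree a"
  obtains c where "\<And>t. complex_of_real (mat_exp (t \<cdot>\<^sub>m companion_matrix a) $$ (r, s)) = (\<Sum>l\<in>S. c l * exp (l * complex_of_real t))"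
proof -
  let ?A = "companion_matrix a"
  obtain c where c: "\<And>k. complex_of_real ((?A ^\<^sub>m k) $$ (r, s)) = (\<Sum>l\<in>S. c l * l ^ k)"
    using companion_matrix_pow_entry[OF assms] by blast
  show thesis
  proof
    fix t :: real
    have e: "(((t \<cdot>\<^sub>m ?A) ^\<^sub>m k) $$ (r, s)) = t ^ k * (?A ^\<^sub>m k) $$ (r, s)" for k
      using smult_mat_pow[OF companion_matrix_carrier, of t a k] r s carrier_matD[OF pow_carrier_mat[OF companion_matrix_carrier, of a k]] by simp
    have "(\<lambda>k. \<Sum>l\<in>S. c l * ((l * complex_of_real t) ^ k /\<^sub>R fact k)) sums (\<Sum>l\<in>S. c l * exp (l * complex_of_real t))"
      by (intro sums_sum sums_mult exp_converges)
    moreover have "(\<Sum>l\<in>S. c l * ((l * complex_of_real t) ^ k /\<^sub>R fact k)) = complex_of_real (((t \<cdot>\<^sub>m ?A) ^\<^sub>m k) $$ (r, s) / fact k)" for k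
      unfolding e by (simp add: c sum_distrib_left sum_distrib_right power_mult_distrib scaleR_conv_of_real sum_divide_distrib divide_inverse mult_ac)
    ultimately have sums: "(\<lambda>k. complex_of_real (((t \<cdot>\<^sub>m ?A) ^\<^sub>m k) $$ (r, s) / fact k)) sums (\<Sum>l\<in>S. c l * exp (l * complex_of_real t))"
      by simp
    \<comment> \<open>\<open>mat_exp\<close> is built from \<open>suminf\<close>, which is
      meaningful only for a summable series; summability of the real entries is inherited from the
      complex exponential series.\<close>
    then have "summable (\<lambda>k. ((t \<cdot>\<^sub>m ?A) ^\<^sub>m k) $$ (r, s) / fact k)"
      using sums_summable[OF sums] by (simp only: summable_of_real_iff)
    then have "(\<lambda>k. complex_of_real (((t \<cdot>\<^sub>m ?A) ^\<^sub>m k) $$ (r, s) / fact k)) sums complex_of_real (\<Sum>k. ((t \<cdot>\<^sub>m ?A) ^\<^sub>m k) $$ (r, s) / fact k)"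
      by (intro sums_of_real summable_sums)
    then have "complex_of_real (\<Sum>k. ((t \<cdot>\<^sub>m ?A) ^\<^sub>m k) $$ (r, s) / fact k) = (\<Sum>l\<in>S. c l * exp (l * complex_of_real t))"
      using sums by (rule sums_unique2)
    then show "complex_of_real (mat_exp (t \<cdot>\<^sub>m ?A) $$ (r, s)) = (\<Sum>l\<in>S. c l * exp (l * complex_of_real t))"
      using r s companion_matrix_carrier[of a] by (simp add: mat_exp_def)
  qed
qed

section \<open>Exponential sums on the positive orthant\<close>

text \<open>The monomials are listed, with repetitions allowed, so that sums and products with a new
  coordinate become concatenation and mapping.\<close>

definition exponential_sum :: "('d :: finite \<Rightarrow> complex set) \<Rightarrow> 'd set \<Rightarrow> (real ^ 'd \<Rightarrow> complex) \<Rightarrow> bool" where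
  "exponential_sum S J F \<longleftrightarrow> (\<exists>ms. (\<forall>(c, m)\<in>set ms. \<forall>i\<in>J. m i \<in> S i) \<and>
     (\<forall>x. F x = (\<Sum>(c, m)\<leftarrow>ms. c * exp (\<Sum>i\<in>J. m i * complex_of_real (x $ i)))))"

lemma exponential_sum_const: "exponential_sum S {} (\<lambda>x. c)"
  unfolding exponential_sum_def by (rule exI[of _ "[(c, \<lambda>_. 0)]"]) auto

lemma exponential_sum_0: "exponential_sum S J (\<lambda>x. 0)"
  unfolding exponential_sum_def by (rule exI[of _ "[]"]) auto

lemma exponential_sum_add:
  assumes "exponential_sum S J F" "exponential_sum S J G"
  shows "exponential_sum S J (\<lambda>x. F x + G x)"
proof -
  obtain ms ms' where "\<forall>(c, m)\<in>set ms. \<forall>i\<in>J. m i \<in> S i" "\<forall>(c, m)\<in>set ms'. \<forall>i\<in>J. m i \<in> S i"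
    "\<And>x. F x = (\<Sum>(c, m)\<leftarrow>ms. c * exp (\<Sum>i\<in>J. m i * complex_of_real (x $ i)))"
    "\<And>x. G x = (\<Sum>(c, m)\<leftarrow>ms'. c * exp (\<Sum>i\<in>J. m i * complex_of_real (x $ i)))"
    using assms unfolding exponential_sum_def by auto
  then show ?thesis unfolding exponential_sum_def by (intro exI[of _ "ms @ ms'"]) auto
qed

lemma exponential_sum_sum:
  assumes "finite K" "\<And>k. k \<in> K \<Longrightarrow> exponential_sum S J (F k)"
  shows "exponential_sum S J (\<lambda>x. \<Sum>k\<in>K. F k x)"
  using assms by (induction K rule: finite_induct) (auto intro: exponential_sum_0 exponential_sum_add)

lemma exponential_sum_times_exp:
  assumes F: "exponential_sum S J F" and i: "i \<notin> J" and l: "l \<in> S i"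
  shows "exponential_sum S (insert i J) (\<lambda>x. a * exp (l * complex_of_real (x $ i)) * F x)"
proof -
  obtain ms where ms: "\<And>c m j. (c, m) \<in> set ms \<Longrightarrow> j \<in> J \<Longrightarrow> m j \<in> S j"
    "\<And>x. F x = (\<Sum>(c, m)\<leftarrow>ms. c * exp (\<Sum>j\<in>J. m j * complex_of_real (x $ j)))"
    using F unfolding exponential_sum_def by fast
  let ?ms = "map (\<lambda>(c, m). (a * c, m(i := l))) ms"
  have e: "exp (\<Sum>j\<in>insert i J. (m(i := l)) j * complex_of_real (x $ j)) =
      exp (l * complex_of_real (x $ i)) * exp (\<Sum>j\<in>J. m j * complex_of_real (x $ j))" for m x
  proof -
    have "(\<Sum>j\<in>J. (m(i := l)) j * complex_of_real (x $ j)) = (\<Sum>j\<in>J. m j * complex_of_real (x $ j))"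
      using i by (intro sum.cong) auto
    then show ?thesis using i by (simp add: exp_add)
  qed
  show ?thesis unfolding exponential_sum_def
  proof (rule exI[of _ ?ms], intro conjI allI)
    show "\<forall>(c, m)\<in>set ?ms. \<forall>j\<in>insert i J. m j \<in> S j" using ms(1) l by auto
    show "a * exp (l * complex_of_real (x $ i)) * F x =
        (\<Sum>(c, m)\<leftarrow>?ms. c * exp (\<Sum>j\<in>insert i J. m j * complex_of_real (x $ j)))" for x
      unfolding ms(2) sum_list_const_mult[symmetric] map_map o_def
    proof (intro arg_cong[of _ _ sum_list] map_cong refl)
      fix p
      show "a * exp (l * complex_of_real (x $ i)) * (case p of (c, m) \<Rightarrow> c * exp (\<Sum>j\<in>J. m j * complex_of_real (x $ j))) =
          (case case p of (c, m) \<Rightarrow> (a * c, m(i := l)) of (c, m) \<Rightarrow> c * exp (\<Sum>j\<in>insert i J. m j * complex_of_real (x $ j)))"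
        by (cases p) (simp only: prod.case e, simp only: mult_ac)
    qed
  qed
qed

text \<open>The matrices need not commute, so they are not diagonalised together; instead the
  leftmost factor is peeled off and its entries are expanded. This changes the row index, hence the
  induction generalises over \<open>r\<close>, and it brings in a coordinate that does not occur in
  the rest because \<open>xs\<close> is distinct.\<close>

lemma exponential_sum_foldr_mat_exp:
  fixes A :: "'d :: finite \<Rightarrow> real mat"
  assumes A: "\<And>i. A i \<in> carrier_mat p p" and fin: "\<And>i. finite (S i)"
    and entry: "\<And>i r s. r < p \<Longrightarrow> s < p \<Longrightarrow>
      \<exists>c. \<forall>t. complex_of_real (mat_exp (t \<cdot>\<^sub>m A i) $$ (r, s)) = (\<Sum>l\<in>S i. c l * exp (l * complex_of_real t))"
    and xs: "distinct xs" and r: "r < p" and s: "s < p"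
  shows "exponential_sum S (set xs) (\<lambda>x. complex_of_real (foldr (\<lambda>i P. mat_exp ((x $ i) \<cdot>\<^sub>m A i) * P) xs (1\<^sub>m p) $$ (r, s)))"
  using xs r
proof (induction xs arbitrary: r)
  case Nil
  then show ?case by (simp add: exponential_sum_const)
next
  case (Cons i xs)
  let ?P = "\<lambda>x. foldr (\<lambda>i P. mat_exp ((x $ i) \<cdot>\<^sub>m A i) * P) xs (1\<^sub>m p)"
  have E: "mat_exp (t \<cdot>\<^sub>m A j) \<in> carrier_mat p p" for t j using A[of j] by (simp add: mat_exp_def)
  have P: "?P x \<in> carrier_mat p p" for x by (induction xs) (auto intro: mult_carrier_mat[OF E])
  have "\<forall>k\<in>{..<p}. \<exists>c. \<forall>t. complex_of_real (mat_exp (t \<cdot>\<^sub>m A i) $$ (r, k)) = (\<Sum>l\<in>S i. c l * exp (l * complex_of_real t))"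
    using entry[OF Cons.prems(2)] by simp
  from bchoice[OF this] obtain c where c: "\<And>k t. k < p \<Longrightarrow> complex_of_real (mat_exp (t \<cdot>\<^sub>m A i) $$ (r, k)) = (\<Sum>l\<in>S i. c k l * exp (l * complex_of_real t))"
    by auto
  have "complex_of_real ((mat_exp ((x $ i) \<cdot>\<^sub>m A i) * ?P x) $$ (r, s)) =
      (\<Sum>k<p. \<Sum>l\<in>S i. c k l * exp (l * complex_of_real (x $ i)) * complex_of_real (?P x $$ (k, s)))" for x
    unfolding index_mult_mat_entry[OF E P Cons.prems(2) s] by (simp add: c sum_distrib_right)
  moreover have "exponential_sum S (insert i (set xs)) (\<lambda>x. \<Sum>k<p. \<Sum>l\<in>S i. c k l * exp (l * complex_of_real (x $ i)) * complex_of_real (?P x $$ (k, s)))"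
    using Cons fin by (intro exponential_sum_sum exponential_sum_times_exp) auto
  ultimately show ?case by simp
qed

section \<open>Exponential monomials on the orthant\<close>

definition orthant :: "(real ^ 'd :: finite) set" where
  "orthant = {x. \<forall>i. 0 \<le> x $ i}"

definition exp_monomial :: "('d :: finite \<Rightarrow> complex) \<Rightarrow> real ^ 'd \<Rightarrow> complex" where
  "exp_monomial m x = exp (\<Sum>i\<in>UNIV. m i * complex_of_real (x $ i))"

lemma orthant_borel [measurable]: "orthant \<in> sets borel"
  unfolding orthant_def by measurable

lemma exp_monomial_measurable [measurable]: "exp_monomial m \<in> borel_measurable borel"
  unfolding exp_monomial_def[abs_def] by measurable

lemma exp_monomial_mult: "exp_monomial m x * exp_monomial m' x = exp_monomial (\<lambda>i. m i + m' i) x"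
  by (simp add: exp_monomial_def sum.distrib distrib_right flip: exp_add)

text \<open>A shift along one axis only rescales a monomial, by a factor that depends on
  \<open>m i\<close> alone. For this reason the variogram on the \<open>i\<close>-th axis involves
  the eigenvalues of \<open>A i\<close> only.\<close>

lemma exp_monomial_shift:
  "exp_monomial m (x + \<tau> *\<^sub>R axis i 1) = exp (m i * complex_of_real \<tau>) * exp_monomial m x"
proof -
  have "(\<Sum>j\<in>UNIV. m j * complex_of_real ((x + \<tau> *\<^sub>R axis i 1) $ j)) =
    (\<Sum>j\<in>UNIV. m j * complex_of_real (x $ j)) + (\<Sum>j\<in>UNIV. if j = i then m i * complex_of_real \<tau> else 0)"
    unfolding sum.distrib[symmetric] by (intro sum.cong) (auto simp: axis_def algebra_simps)
  then show ?thesis by (simp add: exp_monomial_def exp_add mult.commute)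
qed

text \<open>Up to normalisation the modulus is a product of one-dimensional exponential densities
  with rates \<open>- Re (m i)\<close>, so its integral factorises into finite ones.\<close>

lemma integrable_exp_monomial_orthant:
  fixes m :: "'d :: finite \<Rightarrow> complex"
  assumes m: "\<And>i. Re (m i) < 0"
  shows "integrable lborel (\<lambda>x. indicator orthant x *\<^sub>R exp_monomial m x)"
proof (rule integrableI_bounded)
  define l where "l i = - Re (m i)" for i
  have l: "l i > 0" for i using m by (simp add: l_def)
  have l_ne: "l i \<noteq> 0" for i using l[of i] by simp
  define f where "f b y = ennreal (exponential_density (l (axis_index b)) y / l (axis_index b))" for b :: "real ^ 'd" and y
  have Basis: "Basis = range (\<lambda>i. axis i 1 :: real ^ 'd)" by (auto simp: Basis_vec_def)
  have inj: "inj (\<lambda>i. axis i 1 :: real ^ 'd)" by (auto intro: injI simp: axis_eq_axis)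
  have ai: "axis_index (axis i 1 :: real ^ 'd) = i" for i
    unfolding axis_index_def by (rule some_equality) (auto simp: axis_eq_axis)
  have "ennreal (norm (indicator orthant x *\<^sub>R exp_monomial m x)) = (\<Prod>b\<in>Basis. f b (x \<bullet> b))" for x
  proof -
    have "(\<Prod>b\<in>Basis. f b (x \<bullet> b)) = (\<Prod>i\<in>UNIV. ennreal (if x $ i < 0 then 0 else exp (- (x $ i) * l i)))"
      unfolding Basis using l
      by (subst prod.reindex[OF inj]) (auto simp: f_def ai inner_axis exponential_density_def l_ne intro!: prod.cong)
    also have "\<dots> = ennreal (\<Prod>i\<in>UNIV. if x $ i < 0 then 0 else exp (- (x $ i) * l i))"
      by (rule prod_ennreal) auto
    also have "(\<Prod>i\<in>UNIV. if x $ i < 0 then 0 else exp (- (x $ i) * l i)) = norm (indicator orthant x *\<^sub>R exp_monomial m x)"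
    proof (cases "x \<in> orthant")
      case True
      then have "(\<Prod>i\<in>UNIV. if x $ i < 0 then 0 else exp (- (x $ i) * l i)) = (\<Prod>i\<in>UNIV. exp (- (x $ i) * l i))"
        by (intro prod.cong) (auto simp: orthant_def not_less)
      with True show ?thesis by (simp add: exp_monomial_def norm_exp_eq_Re l_def mult.commute flip: exp_sum)
    next
      case False
      then have "\<exists>i. x $ i < 0" by (auto simp: orthant_def not_le)
      then have "(\<Prod>i\<in>UNIV. if x $ i < 0 then 0 else exp (- (x $ i) * l i)) = 0" by (auto intro!: prod_zero)
      with False show ?thesis by simp
    qed
    finally show ?thesis by simp
  qed
  then have "(\<integral>\<^sup>+x. ennreal (norm (indicator orthant x *\<^sub>R exp_monomial m x)) \<partial>lborel) = (\<integral>\<^sup>+x. (\<Prod>b\<in>Basis. f b (x \<bullet> b)) \<partial>lborel)"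
    by simp
  also have "\<dots> = (\<Prod>b\<in>Basis. (\<integral>\<^sup>+y. f b y \<partial>lborel))"
    by (rule nn_integral_lborel_prod) (auto simp: f_def)
  also have "\<dots> < \<infinity>"
  proof -
    have "(\<integral>\<^sup>+y. f b y \<partial>lborel) = ennreal (1 / l (axis_index b))" for b
    proof -
      let ?l = "l (axis_index b)"
      interpret prob_space "density lborel (exponential_density ?l)" by (rule prob_space_exponential_density[OF l])
      have one: "(\<integral>\<^sup>+y. ennreal (exponential_density ?l y) \<partial>lborel) = 1"
        using emeasure_space_1 by (simp add: emeasure_density)
      have "(\<integral>\<^sup>+y. f b y \<partial>lborel) = (\<integral>\<^sup>+y. ennreal (1 / ?l) * ennreal (exponential_density ?l y) \<partial>lborel)"
        using l[of "axis_index b"] exponential_density_nonneg[OF l]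
        by (intro nn_integral_cong) (simp add: f_def flip: ennreal_mult)
      also have "\<dots> = ennreal (1 / ?l) * 1" by (subst nn_integral_cmult) (auto simp: one)
      finally show ?thesis by simp
    qed
    then show ?thesis using l by (simp add: prod_ennreal less_imp_le)
  qed
  finally show "(\<integral>\<^sup>+x. ennreal (norm (indicator orthant x *\<^sub>R exp_monomial m x)) \<partial>lborel) < \<infinity>" .
qed measurable

section \<open>Translation and reflection in Lebesgue integrals\<close>

lemma lborel_integrable_shift:
  fixes f :: "'x :: euclidean_space \<Rightarrow> 'b :: {banach, second_countable_topology}"
  assumes "integrable lborel f"
  shows "integrable lborel (\<lambda>x. f (x + t))"
proof -
  have "integrable (distr lborel borel ((+) t)) f" using assms by (simp only: lborel_distr_plus)
  then have "integrable lborel (\<lambda>x. f (t + x))" using assms by (subst (asm) integrable_distr_eq) auto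
  then show ?thesis by (simp add: add.commute)
qed

lemma lborel_integral_shift:
  fixes f :: "'x :: euclidean_space \<Rightarrow> 'b :: {banach, second_countable_topology}"
  assumes "f \<in> borel_measurable borel"
  shows "(LINT x|lborel. f (x + t)) = (LINT x|lborel. f x)"
proof -
  have "(LINT x|lborel. f x) = (LINT x|distr lborel borel ((+) t). f x)" by (simp only: lborel_distr_plus)
  also have "\<dots> = (LINT x|lborel. f (t + x))" using assms by (intro integral_distr) auto
  finally show ?thesis by (simp add: add.commute)
qed

lemma lborel_distr_reflect: "distr lborel borel uminus = (lborel :: 'x :: euclidean_space measure)"
  by (subst lborel_affine[of "-1" 0]) (auto simp: density_1 one_ennreal_def[symmetric])

lemma lborel_integral_reflect:
  fixes f :: "'x :: euclidean_space \<Rightarrow> 'b :: {banach, second_countable_topology}"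
  assumes "f \<in> borel_measurable borel"
  shows "(LINT x|lborel. f (- x)) = (LINT x|lborel. f x)"
proof -
  have "(LINT x|lborel. f x) = (LINT x|distr lborel borel uminus. f x)" by (simp only: lborel_distr_reflect)
  also have "\<dots> = (LINT x|lborel. f (- x))" using assms by (intro integral_distr) auto
  finally show ?thesis by simp
qed

lemma lborel_integrable_reflect:
  fixes f :: "'x :: euclidean_space \<Rightarrow> 'b :: {banach, second_countable_topology}"
  assumes "integrable lborel f"
  shows "integrable lborel (\<lambda>x. f (- x))"
proof -
  have "integrable (distr lborel borel uminus) f" using assms by (simp only: lborel_distr_reflect)
  then show ?thesis using assms by (subst (asm) integrable_distr_eq) auto
qed

text \<open>Expanding the square and using translation invariance leaves
  \<open>2 * (R 0 - R \<tau>)\<close>, where \<open>R \<tau>\<close> is the integral of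
  \<open>F x * F (x + \<tau> *\<^sub>R axis i 1)\<close>. Only the shifted factor is expanded into
  monomials, so each term depends on \<open>\<tau>\<close> through a single exponential.\<close>

lemma integral_square_increment:
  fixes F :: "real ^ 'd :: finite \<Rightarrow> real" and m :: "nat \<Rightarrow> 'd \<Rightarrow> complex"
  assumes F: "\<And>x. complex_of_real (F x) = indicator orthant x *\<^sub>R (\<Sum>n<N. c n * exp_monomial (m n) x)"
    and [measurable]: "F \<in> borel_measurable borel" and m: "\<And>n i. n < N \<Longrightarrow> Re (m n i) < 0"
  shows "integrable lborel (\<lambda>x. (F (x + t) - F x)\<^sup>2)"
    and "\<exists>D. \<forall>i \<tau>. complex_of_real (LINT x|lborel. (F (x + \<tau> *\<^sub>R axis i 1) - F x)\<^sup>2) =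
      2 * (\<Sum>n<N. D n * (1 - exp (m n i * complex_of_real \<bar>\<tau>\<bar>)))"
proof -
  have FE: "integrable lborel (\<lambda>x. complex_of_real (F x) * (c n * exp_monomial (m n) x))" if n: "n < N" for n
  proof -
    have "complex_of_real (F x) * (c n * exp_monomial (m n) x) =
      (\<Sum>k<N. (c k * c n) * (indicator orthant x *\<^sub>R exp_monomial (\<lambda>i. m k i + m n i) x))" for x
      unfolding F exp_monomial_mult[symmetric]
      by (simp add: sum_distrib_left sum_distrib_right scaleR_conv_of_real mult_ac)
    moreover have "integrable lborel (\<lambda>x. \<Sum>k<N. (c k * c n) * (indicator orthant x *\<^sub>R exp_monomial (\<lambda>i. m k i + m n i) x))"
      using m n by (intro Bochner_Integration.integrable_sum integrable_mult_right integrable_exp_monomial_orthant)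
        (auto intro: add_neg_neg)
    ultimately show ?thesis by simp
  qed
  \<comment> \<open>For \<open>\<tau> \<ge> 0\<close> the shift maps the orthant into itself, so the
    indicator of the shifted factor is absorbed by that of \<open>F x\<close>.\<close>
  have cross: "complex_of_real (F x * F (x + \<tau> *\<^sub>R axis i 1)) =
      (\<Sum>n<N. exp (m n i * complex_of_real \<tau>) * (complex_of_real (F x) * (c n * exp_monomial (m n) x)))"
    if "\<tau> \<ge> 0" for x i \<tau>
  proof (cases "x \<in> orthant")
    case True
    then have "x + \<tau> *\<^sub>R axis i 1 \<in> orthant" using that by (auto simp: orthant_def axis_def)
    then show ?thesis
      by (simp add: F[of "x + \<tau> *\<^sub>R axis i 1"] exp_monomial_shift sum_distrib_left mult_ac)
  next
    case False
    then have "F x = 0" using F[of x] by simp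
    then show ?thesis by simp
  qed
  have cross_int: "integrable lborel (\<lambda>x. F x * F (x + \<tau> *\<^sub>R axis i 1))" if "\<tau> \<ge> 0" for \<tau> i
    unfolding complex_of_real_integrable_eq[symmetric] cross[OF that]
    by (intro Bochner_Integration.integrable_sum integrable_mult_right FE) auto
  have F2: "integrable lborel (\<lambda>x. (F x)\<^sup>2)"
    using cross_int[of 0] by (simp add: power2_eq_square)
  have F2_shift: "integrable lborel (\<lambda>x. (F (x + t))\<^sup>2)" for t
    by (rule lborel_integrable_shift[OF F2])
  show "integrable lborel (\<lambda>x. (F (x + t) - F x)\<^sup>2)" for t
  proof (rule Bochner_Integration.integrable_bound)
    show "integrable lborel (\<lambda>x. 2 * (F (x + t))\<^sup>2 + 2 * (F x)\<^sup>2)" using F2 F2_shift by auto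
    have "(F (x + t) - F x)\<^sup>2 \<le> 2 * (F (x + t))\<^sup>2 + 2 * (F x)\<^sup>2" for x
      using zero_le_power2[of "F (x + t) + F x"] unfolding power2_sum power2_diff by linarith
    then show "AE x in lborel. norm ((F (x + t) - F x)\<^sup>2) \<le> norm (2 * (F (x + t))\<^sup>2 + 2 * (F x)\<^sup>2)"
      by (auto intro: order_trans)
  qed measurable
  define D where "D n = (CLINT x|lborel. complex_of_real (F x) * (c n * exp_monomial (m n) x))" for n
  have cross_eq: "complex_of_real (LINT x|lborel. F x * F (x + \<tau> *\<^sub>R axis i 1)) = (\<Sum>n<N. D n * exp (m n i * complex_of_real \<tau>))"
    if "\<tau> \<ge> 0" for \<tau> i
  proof -
    have "complex_of_real (LINT x|lborel. F x * F (x + \<tau> *\<^sub>R axis i 1)) = (CLINT x|lborel. complex_of_real (F x * F (x + \<tau> *\<^sub>R axis i 1)))"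
      by (rule integral_complex_of_real[symmetric])
    also have "\<dots> = (\<Sum>n<N. exp (m n i * complex_of_real \<tau>) * D n)"
      unfolding cross[OF that] D_def
      using FE by (subst Bochner_Integration.integral_sum) auto
    finally show ?thesis by (simp add: mult.commute)
  qed
  have nonneg: "complex_of_real (LINT x|lborel. (F (x + \<tau> *\<^sub>R axis i 1) - F x)\<^sup>2) =
      2 * (\<Sum>n<N. D n * (1 - exp (m n i * complex_of_real \<tau>)))" if "\<tau> \<ge> 0" for i \<tau>
  proof -
    have "(LINT x|lborel. (F (x + \<tau> *\<^sub>R axis i 1) - F x)\<^sup>2) =
        (LINT x|lborel. (F (x + \<tau> *\<^sub>R axis i 1))\<^sup>2 + (F x)\<^sup>2 - 2 * (F x * F (x + \<tau> *\<^sub>R axis i 1)))"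
      by (intro Bochner_Integration.integral_cong) (auto simp: power2_diff)
    also have "\<dots> = (LINT x|lborel. (F (x + \<tau> *\<^sub>R axis i 1))\<^sup>2) + (LINT x|lborel. (F x)\<^sup>2) - 2 * (LINT x|lborel. F x * F (x + \<tau> *\<^sub>R axis i 1))"
      using F2 F2_shift cross_int[OF that] by simp
    also have "(LINT x|lborel. (F (x + \<tau> *\<^sub>R axis i 1))\<^sup>2) = (LINT x|lborel. (F x)\<^sup>2)"
      by (rule lborel_integral_shift) measurable
    \<comment> \<open>The first term is written as a shift by \<open>0\<close>, so that
      \<open>cross_eq\<close> expresses it as the sum of the \<open>D n\<close> and the differences
      \<open>1 - exp\<close> appear.\<close>
    also have "(LINT x|lborel. (F x)\<^sup>2) + (LINT x|lborel. (F x)\<^sup>2) - 2 * (LINT x|lborel. F x * F (x + \<tau> *\<^sub>R axis i 1))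
      = 2 * ((LINT x|lborel. F x * F (x + 0 *\<^sub>R axis i 1)) - (LINT x|lborel. F x * F (x + \<tau> *\<^sub>R axis i 1)))"
      by (simp add: power2_eq_square)
    finally show ?thesis
      using cross_eq[of 0 i] cross_eq[OF that, of i]
      by (simp add: sum_subtractf right_diff_distrib)
  qed
  have "complex_of_real (LINT x|lborel. (F (x + \<tau> *\<^sub>R axis i 1) - F x)\<^sup>2) =
      2 * (\<Sum>n<N. D n * (1 - exp (m n i * complex_of_real \<bar>\<tau>\<bar>)))" for i \<tau>
  proof (cases "\<tau> \<ge> 0")
    case True
    then show ?thesis using nonneg[of \<tau> i] by simp
  next
    case False
    \<comment> \<open>A negative shift is undone by translating the integration variable, which
      exchanges the two terms of the increment; this is where \<open>\<bar>\<tau>\<bar>\<close>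
      comes from.\<close>
    let ?t = "- \<tau> *\<^sub>R axis i 1 :: real ^ 'd"
    have "(LINT x|lborel. (F (x + \<tau> *\<^sub>R axis i 1) - F x)\<^sup>2) = (LINT x|lborel. (F ((x + ?t) + \<tau> *\<^sub>R axis i 1) - F (x + ?t))\<^sup>2)"
      by (rule lborel_integral_shift[symmetric]) measurable
    also have "\<dots> = (LINT x|lborel. (F (x + ?t) - F x)\<^sup>2)"
      by (simp add: power2_commute)
    finally show ?thesis using nonneg[of "- \<tau>" i] False by simp
  qed
  then show "\<exists>D. \<forall>i \<tau>. complex_of_real (LINT x|lborel. (F (x + \<tau> *\<^sub>R axis i 1) - F x)\<^sup>2) =
      2 * (\<Sum>n<N. D n * (1 - exp (m n i * complex_of_real \<bar>\<tau>\<bar>)))" by blast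
qed

section \<open>The variogram of a CAR field\<close>

text \<open>For a CAR field \<open>b\<close> is a multiple of the first unit vector, so only the top
  right entry of the matrix product survives. Leaving out the factor \<open>b $ 0\<close> gives a
  function of \<open>p\<close> and \<open>A\<close> alone, shared by two fields with the same
  companion matrices.\<close>

definition car_kernel :: "nat \<Rightarrow> ('d \<Rightarrow> real mat) \<Rightarrow> real ^ ('d :: {finite, linorder}) \<Rightarrow> real" where
  "car_kernel p A x = (if x \<in> orthant
     then foldr (\<lambda>i P. mat_exp ((x $ i) \<cdot>\<^sub>m A i) * P) (sorted_list_of_set UNIV) (1\<^sub>m p) $$ (0, p - 1) else 0)"

lemma foldr_mat_exp_carrier:
  assumes "\<And>i. A i \<in> carrier_mat p p"
  shows "foldr (\<lambda>i P. mat_exp (t i \<cdot>\<^sub>m A i) * P) xs (1\<^sub>m p) \<in> carrier_mat p p"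
proof (induction xs)
  case (Cons i xs)
  have "mat_exp (t i \<cdot>\<^sub>m A i) \<in> carrier_mat p p" using assms[of i] by (simp add: mat_exp_def)
  from mult_carrier_mat[OF this Cons] show ?case by simp
qed simp

lemma carma_kernel_eq_car_kernel:
  fixes A :: "'d :: {finite, linorder} \<Rightarrow> real mat"
  assumes p: "0 < p" and b: "b \<in> carrier_vec p" and b0: "\<And>k. k < p \<Longrightarrow> k > 0 \<Longrightarrow> vec_index b k = 0"
    and A: "\<And>i. A i \<in> carrier_mat p p"
  shows "carma_kernel p b A t s = vec_index b 0 * car_kernel p A (t - s)"
proof -
  let ?P = "foldr (\<lambda>i P. mat_exp ((t $ i - s $ i) \<cdot>\<^sub>m A i) * P) (sorted_list_of_set (UNIV :: 'd set)) (1\<^sub>m p)"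
  have P: "?P \<in> carrier_mat p p" by (rule foldr_mat_exp_carrier[OF A])
  have "scalar_prod b (?P *\<^sub>v unit_vec p (p - 1)) = (\<Sum>k<p. vec_index b k * ?P $$ (k, p - 1))"
    using P p by (simp add: scalar_prod_def[of b] lessThan_atLeast0 scalar_prod_right_unit)
  also have "\<dots> = (\<Sum>k\<in>{0}. vec_index b k * ?P $$ (k, p - 1))"
    using p b0 by (intro sum.mono_neutral_right) auto
  finally show ?thesis by (simp add: carma_kernel_def car_kernel_def orthant_def)
qed

lemma car_kernel_expansion:
  fixes A :: "'d :: {finite, linorder} \<Rightarrow> real mat"
  assumes p: "0 < p" and A: "\<And>i. A i = companion_matrix (a i)" "\<And>i. degree (a i) = p" "\<And>i. lead_coeff (a i) = 1"
    and S: "\<And>i. finite (S i)" "\<And>i. card (S i) = p"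
      "\<And>i l. l \<in> S i \<Longrightarrow> poly (map_poly complex_of_real (a i)) l = 0"
  shows "\<exists>(N :: nat) c m. (\<forall>n<N. \<forall>i. m n i \<in> S i) \<and>
    (\<forall>x. complex_of_real (car_kernel p A x) = indicator orthant x *\<^sub>R (\<Sum>n<N. c n * exp_monomial (m n) x))"
proof -
  have "exponential_sum S (set (sorted_list_of_set UNIV)) (\<lambda>x. complex_of_real
     (foldr (\<lambda>i P. mat_exp ((x $ i) \<cdot>\<^sub>m A i) * P) (sorted_list_of_set UNIV) (1\<^sub>m p) $$ (0, p - 1)))"
  proof (rule exponential_sum_foldr_mat_exp)
    show "A i \<in> carrier_mat p p" for i using companion_matrix_carrier[of "a i"] A(1,2) by simp
    show "\<exists>c. \<forall>t. complex_of_real (mat_exp (t \<cdot>\<^sub>m A i) $$ (r, s)) = (\<Sum>l\<in>S i. c l * exp (l * complex_of_real t))"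
      if "r < p" "s < p" for i r s
      by (rule mat_exp_companion_matrix_entry[of "a i" "S i" r s]) (use A S that in auto)
  qed (use p S in auto)
  then obtain ms where ms: "\<And>c m i. (c, m) \<in> set ms \<Longrightarrow> m i \<in> S i"
    "\<And>x. complex_of_real (foldr (\<lambda>i P. mat_exp ((x $ i) \<cdot>\<^sub>m A i) * P) (sorted_list_of_set UNIV) (1\<^sub>m p) $$ (0, p - 1))
       = (\<Sum>(c, m)\<leftarrow>ms. c * exp_monomial m x)"
    unfolding exponential_sum_def exp_monomial_def by force
  show ?thesis
  proof (rule exI[of _ "length ms"], rule exI[of _ "\<lambda>n. fst (ms ! n)"], rule exI[of _ "\<lambda>n. snd (ms ! n)"], intro conjI allI impI)
    show "snd (ms ! n) i \<in> S i" if "n < length ms" for n i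
      using ms(1)[of "fst (ms ! n)" "snd (ms ! n)"] that by simp
    fix x
    have "(\<Sum>(c, m)\<leftarrow>ms. c * exp_monomial m x) = (\<Sum>n<length ms. fst (ms ! n) * exp_monomial (snd (ms ! n)) x)"
      by (simp add: sum_list_sum_nth lessThan_atLeast0 split_beta)
    then show "complex_of_real (car_kernel p A x) = indicator orthant x *\<^sub>R (\<Sum>n<length ms. fst (ms ! n) * exp_monomial (snd (ms ! n)) x)"
      by (cases "x \<in> orthant") (simp_all only: car_kernel_def if_True if_False ms(2) indicator_simps scaleR_one scaleR_zero_left of_real_0 simp_thms)
  qed
qed

lemma causal_CAR_fieldD:
  fixes A :: "'d :: {finite, linorder} \<Rightarrow> real mat"
  assumes "causal_CAR_field M \<Lambda> \<beta> \<sigma>2 \<nu> p b A Y"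
  shows "homogeneous_levy_basis M \<Lambda> \<beta> \<sigma>2 \<nu>" "0 < p" "b \<in> carrier_vec p" "vec_index b 0 \<noteq> 0"
    "\<And>k. k < p \<Longrightarrow> k > 0 \<Longrightarrow> vec_index b k = 0"
    "\<And>t. has_stochastic_integral M \<Lambda> (carma_kernel p b A t) (Y t)"
    "\<exists>a. degree a = p \<and> lead_coeff a = 1 \<and> (\<forall>z. poly (map_poly complex_of_real a) z = 0 \<longrightarrow> Re z < 0) \<and> A i = companion_matrix a"
  using assms unfolding causal_CAR_field_def causal_CARMA_field_def by blast+

lemma CAR_field_spectrum_Re_neg:
  fixes A :: "'d :: {finite, linorder} \<Rightarrow> real mat"
  assumes "causal_CAR_field M \<Lambda> \<beta> \<sigma>2 \<nu> p b A Y" and l: "l \<in> complex_spectrum (A i)"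
  shows "Re l < 0"
proof -
  obtain a where a: "lead_coeff a = 1" "A i = companion_matrix a"
      "\<And>z. poly (map_poly complex_of_real a) z = 0 \<Longrightarrow> Re z < 0"
    using causal_CAR_fieldD(7)[OF assms(1), of i] by blast
  show ?thesis using complex_spectrum_companion_matrix_root[OF a(1)] l a(2,3) by simp
qed

lemma CAR_field_variogram:
  fixes A :: "'d :: {finite, linorder} \<Rightarrow> real mat"
  assumes car: "causal_CAR_field M \<Lambda> \<beta> \<sigma>2 \<nu> p b A Y"
    and spec: "\<And>i. finite (complex_spectrum (A i))" "\<And>i. card (complex_spectrum (A i)) = p"
    and fin: "levy_finite_second_moment M \<Lambda>"
  shows "variogram M Y t = levy_variance \<sigma>2 \<nu> * (vec_index b 0)\<^sup>2 * (LINT x|lborel. (car_kernel p A (x + t) - car_kernel p A x)\<^sup>2)"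
    and "\<exists>c. (\<forall>l. l \<notin> complex_spectrum (A i) \<longrightarrow> c l = 0) \<and>
      (\<forall>\<tau>. complex_of_real (variogram M Y (\<tau> *\<^sub>R axis i 1)) = 2 * complex_of_real (levy_variance \<sigma>2 \<nu>) *
        (\<Sum>l\<in>complex_spectrum (A i). c l * (1 - exp (l * complex_of_real \<bar>\<tau>\<bar>))))"
proof -
  note D = causal_CAR_fieldD[OF car]
  let ?S = "\<lambda>i. complex_spectrum (A i)" and ?\<kappa> = "levy_variance \<sigma>2 \<nu>"
  have "\<forall>i. \<exists>a. degree a = p \<and> lead_coeff a = 1 \<and> (\<forall>z. poly (map_poly complex_of_real a) z = 0 \<longrightarrow> Re z < 0) \<and> A i = companion_matrix a"
    using D(7) by blast
  from choice[OF this] obtain a where a: "\<And>i. degree (a i) = p" "\<And>i. lead_coeff (a i) = 1"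
    "\<And>i z. poly (map_poly complex_of_real (a i)) z = 0 \<Longrightarrow> Re z < 0" "\<And>i. A i = companion_matrix (a i)"
    by blast
  have A: "A i \<in> carrier_mat p p" for i using companion_matrix_carrier[of "a i"] a by simp
  have root: "poly (map_poly complex_of_real (a i)) l = 0" if "l \<in> ?S i" for i l
    using complex_spectrum_companion_matrix_root[of "a i" l] that a by simp
  note kernel = carma_kernel_eq_car_kernel[OF D(2,3,5) A]
  have "\<exists>(N :: nat) c m. (\<forall>n<N. \<forall>i. m n i \<in> ?S i) \<and>
    (\<forall>x. complex_of_real (car_kernel p A x) = indicator orthant x *\<^sub>R (\<Sum>n<N. c n * exp_monomial (m n) x))"
    by (rule car_kernel_expansion[where a = a]) (use D(2) a spec root in auto)
  then obtain N :: nat where "\<exists>c m. (\<forall>n<N. \<forall>i. m n i \<in> ?S i) \<and>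
    (\<forall>x. complex_of_real (car_kernel p A x) = indicator orthant x *\<^sub>R (\<Sum>n<N. c n * exp_monomial (m n) x))" by (rule exE)
  then obtain c where "\<exists>m. (\<forall>n<N. \<forall>i. m n i \<in> ?S i) \<and>
    (\<forall>x. complex_of_real (car_kernel p A x) = indicator orthant x *\<^sub>R (\<Sum>n<N. c n * exp_monomial (m n) x))" by (rule exE)
  then obtain m where "(\<forall>n<N. \<forall>i. m n i \<in> ?S i) \<and>
    (\<forall>x. complex_of_real (car_kernel p A x) = indicator orthant x *\<^sub>R (\<Sum>n<N. c n * exp_monomial (m n) x))" by (rule exE)
  then have m: "\<And>n i. n < N \<Longrightarrow> m n i \<in> ?S i"
    "\<And>x. complex_of_real (car_kernel p A x) = indicator orthant x *\<^sub>R (\<Sum>n<N. c n * exp_monomial (m n) x)"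
    by simp_all
  \<comment> \<open>Measurability of the kernel is part of the existence of its stochastic integral;
    \<open>car_kernel\<close> is recovered from the kernel at \<open>t = 0\<close> by reflection and
    division by the nonzero \<open>b $ 0\<close>.\<close>
  have "carma_kernel p b A 0 \<in> borel_measurable borel" using D(6) by (simp add: has_stochastic_integral_def)
  then have "(\<lambda>x. carma_kernel p b A 0 (- x) / vec_index b 0) \<in> borel_measurable borel" by measurable
  then have meas [measurable]: "car_kernel p A \<in> borel_measurable borel" using D(4) by (simp add: kernel)
  have neg: "Re (m n i) < 0" if "n < N" for n i using a(3) root m(1)[OF that] by blast
  note incr = integral_square_increment[OF m(2) meas neg]
  let ?I = "\<lambda>t. LINT x|lborel. (car_kernel p A (x + t) - car_kernel p A x)\<^sup>2"
  have var: "variogram M Y t = ?\<kappa> * (vec_index b 0)\<^sup>2 * ?I t" for t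
  proof -
    have eq: "(carma_kernel p b A t s - carma_kernel p b A 0 s)\<^sup>2 =
        (vec_index b 0)\<^sup>2 * (car_kernel p A (- s + t) - car_kernel p A (- s))\<^sup>2" for s
      by (simp add: kernel power_mult_distrib flip: right_diff_distrib)
    have sq: "integrable lborel (\<lambda>s. (carma_kernel p b A t s - carma_kernel p b A 0 s)\<^sup>2)"
      unfolding eq by (intro integrable_mult_right lborel_integrable_reflect[OF incr(1)])
    have "variogram M Y t = ?\<kappa> * (LINT s|lborel. (carma_kernel p b A t s - carma_kernel p b A 0 s)\<^sup>2)"
      unfolding variogram_def by (rule variance_stochastic_integral_diff[OF D(1) fin D(6) D(6) sq])
    also have "(LINT s|lborel. (carma_kernel p b A t s - carma_kernel p b A 0 s)\<^sup>2) =
        (vec_index b 0)\<^sup>2 * (LINT s|lborel. (car_kernel p A (- s + t) - car_kernel p A (- s))\<^sup>2)"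
      unfolding eq by simp
    also have "(LINT s|lborel. (car_kernel p A (- s + t) - car_kernel p A (- s))\<^sup>2) = ?I t"
      by (rule lborel_integral_reflect) measurable
    finally show ?thesis by simp
  qed
  then show "variogram M Y t = ?\<kappa> * (vec_index b 0)\<^sup>2 * ?I t" .
  obtain E where E: "\<And>\<tau>. complex_of_real (?I (\<tau> *\<^sub>R axis i 1)) = 2 * (\<Sum>n<N. E n * (1 - exp (m n i * complex_of_real \<bar>\<tau>\<bar>)))"
    using incr(2) by blast
  \<comment> \<open>Along the \<open>i\<close>-th axis only the \<open>i\<close>-th exponent of a
    monomial matters, so monomials with the same \<open>m n i\<close> are collected. Off the
    spectrum the coefficient is set to \<open>0\<close>, as the description in
    \<open>variogram_coeff\<close> demands.\<close>
  define d where "d l = (if l \<in> ?S i then (vec_index b 0)\<^sup>2 * (\<Sum>n\<in>{n \<in> {..<N}. m n i = l}. E n) else 0)" for l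
  have "complex_of_real (variogram M Y (\<tau> *\<^sub>R axis i 1)) = 2 * complex_of_real ?\<kappa> *
        (\<Sum>l\<in>?S i. d l * (1 - exp (l * complex_of_real \<bar>\<tau>\<bar>)))" for \<tau>
  proof -
    have "(\<Sum>n<N. E n * (1 - exp (m n i * complex_of_real \<bar>\<tau>\<bar>))) =
        (\<Sum>l\<in>?S i. \<Sum>n\<in>{n \<in> {..<N}. m n i = l}. E n * (1 - exp (m n i * complex_of_real \<bar>\<tau>\<bar>)))"
      using spec m(1) by (intro sum.group[symmetric]) auto
    also have "\<dots> = (\<Sum>l\<in>?S i. (\<Sum>n\<in>{n \<in> {..<N}. m n i = l}. E n) * (1 - exp (l * complex_of_real \<bar>\<tau>\<bar>)))"
      by (simp add: sum_distrib_right)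
    finally have "(vec_index b 0)\<^sup>2 * (\<Sum>n<N. E n * (1 - exp (m n i * complex_of_real \<bar>\<tau>\<bar>))) =
        (\<Sum>l\<in>?S i. d l * (1 - exp (l * complex_of_real \<bar>\<tau>\<bar>)))"
      by (simp add: d_def sum_distrib_left[of _ _ "?S i"] mult.assoc)
    moreover have "complex_of_real (variogram M Y (\<tau> *\<^sub>R axis i 1)) = 2 * complex_of_real ?\<kappa> *
        ((vec_index b 0)\<^sup>2 * (\<Sum>n<N. E n * (1 - exp (m n i * complex_of_real \<bar>\<tau>\<bar>))))"
      by (simp add: var E)
    ultimately show ?thesis by simp
  qed
  moreover have "\<forall>l. l \<notin> ?S i \<longrightarrow> d l = 0" by (simp add: d_def)
  ultimately show "\<exists>c. (\<forall>l. l \<notin> ?S i \<longrightarrow> c l = 0) \<and>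
      (\<forall>\<tau>. complex_of_real (variogram M Y (\<tau> *\<^sub>R axis i 1)) = 2 * complex_of_real ?\<kappa> *
        (\<Sum>l\<in>?S i. c l * (1 - exp (l * complex_of_real \<bar>\<tau>\<bar>))))" by blast
qed

text \<open>Turns the definite description into a representation at hand. For uniqueness the samples
  at multiples of \<open>\<Delta>\<close> suffice, since the nodes are distinct and different from
  \<open>1\<close>.\<close>

lemma variogram_coeff_eq:
  fixes \<psi> :: "real ^ 'd :: finite \<Rightarrow> real"
  assumes S: "finite S" and inj: "inj_on (\<lambda>l. exp (l * complex_of_real \<Delta>)) S" and \<Delta>: "\<Delta> > 0"
    and ne1: "\<And>l. l \<in> S \<Longrightarrow> exp (l * complex_of_real \<Delta>) \<noteq> 1" and \<kappa>: "\<kappa>2 \<noteq> 0"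
    and c0: "\<And>l. l \<notin> S \<Longrightarrow> c l = 0"
    and c: "\<And>\<tau>. complex_of_real (\<psi> (\<tau> *\<^sub>R axis i 1)) = 2 * complex_of_real \<kappa>2 * (\<Sum>l\<in>S. c l * (1 - exp (l * complex_of_real \<bar>\<tau>\<bar>)))"
  shows "variogram_coeff \<psi> \<kappa>2 S i = c"
  unfolding variogram_coeff_def
proof (rule the_equality)
  fix c' assume c': "(\<forall>l. l \<notin> S \<longrightarrow> c' l = 0) \<and>
        (\<forall>\<tau>::real. complex_of_real (\<psi> (\<tau> *\<^sub>R axis i 1)) =
           2 * complex_of_real \<kappa>2 * (\<Sum>l\<in>S. c' l * (1 - exp (l * \<bar>\<tau>\<bar>))))"
  show "c' = c"
  proof
    fix l
    show "c' l = c l"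
    proof (cases "l \<in> S")
      case True
      have "c' l - c l = 0"
      proof (rule exponential_samples_eq_0_imp_coeff_eq_0[OF S inj ne1 _ True])
        fix j
        have "(\<Sum>l\<in>S. c' l * (1 - exp (l * complex_of_real \<bar>real j * \<Delta>\<bar>))) = (\<Sum>l\<in>S. c l * (1 - exp (l * complex_of_real \<bar>real j * \<Delta>\<bar>)))"
          using c[of "real j * \<Delta>"] spec[OF conjunct2[OF c'], of "real j * \<Delta>"] \<kappa> by simp
        then show "(\<Sum>l\<in>S. (c' l - c l) * (1 - exp (l * complex_of_real (real j * \<Delta>)))) = 0"
          using \<Delta> by (simp add: left_diff_distrib sum_subtractf)
      qed
      then show ?thesis by simp
    next
      case False
      then show ?thesis using c' c0 by simp
    qed
  qed
qed (use c0 c in auto)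

text \<open>The half-open strip has height \<open>2 * pi / \<Delta>\<close>, exactly one period of
  \<open>\<lambda>l. exp (l * \<Delta>)\<close>.\<close>

lemma inj_on_exp_strip:
  assumes "\<Delta> > 0" and T: "\<And>l. l \<in> T \<Longrightarrow> - pi / \<Delta> \<le> Im l \<and> Im l < pi / \<Delta>"
  shows "inj_on (\<lambda>l. exp (l * complex_of_real \<Delta>)) T"
proof (rule inj_onI)
  fix l l' assume l: "l \<in> T" "l' \<in> T" and eq: "exp (l * complex_of_real \<Delta>) = exp (l' * complex_of_real \<Delta>)"
  have b: "- pi \<le> Im k * \<Delta> \<and> Im k * \<Delta> < pi" if "k \<in> T" for k
    using T[OF that] assms(1) by (simp add: field_simps)
  have "\<bar>Im (l * complex_of_real \<Delta>) - Im (l' * complex_of_real \<Delta>)\<bar> < 2 * pi"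
    using b[OF l(1)] b[OF l(2)] by auto
  then have "l * complex_of_real \<Delta> = l' * complex_of_real \<Delta>" using eq by (rule exp_complex_eqI)
  then show "l = l'" using assms(1) by simp
qed

theorem theorem4p4:
  fixes \<Delta> \<kappa>2 :: real and p :: nat
    and M :: "'a measure" and M' :: "'b measure"
    and \<Lambda> :: "(real ^ ('d :: {finite, linorder})) set \<Rightarrow> 'a \<Rightarrow> real"
    and \<Lambda>' :: "(real ^ ('d :: {finite, linorder})) set \<Rightarrow> 'b \<Rightarrow> real"
    and \<beta> \<beta>' \<sigma>2 \<sigma>2' :: real and \<nu> \<nu>' :: "real measure"
    and b b' :: "real Matrix.vec" and A A' :: "'d \<Rightarrow> real mat"
    and Y :: "real ^ ('d :: {finite, linorder}) \<Rightarrow> 'a \<Rightarrow> real" and Y' :: "real ^ ('d :: {finite, linorder}) \<Rightarrow> 'b \<Rightarrow> real"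
    and eig eig' :: "'d \<Rightarrow> complex list"
  assumes "\<Delta> > 0" and "\<kappa>2 > 0"
    and "causal_CAR_field M \<Lambda> \<beta> \<sigma>2 \<nu> p b A Y"
    and "\<And>i. length (eig i) = p \<and> distinct (eig i) \<and> set (eig i) = complex_spectrum (A i)"
    and "levy_mean_zero M \<Lambda>" and "levy_finite_second_moment M \<Lambda>"
    and "levy_variance \<sigma>2 \<nu> = \<kappa>2"
    and "b $ 0 \<ge> 0"
    and "\<And>i l. l \<in> complex_spectrum (A i) \<Longrightarrow> - pi / \<Delta> \<le> Im l \<and> Im l < pi / \<Delta>"
    and "\<And>i l. l \<in> complex_spectrum (A i) \<Longrightarrow>
           variogram_coeff (variogram M Y) \<kappa>2 (complex_spectrum (A i)) i l \<noteq> 0"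
    and "causal_CAR_field M' \<Lambda>' \<beta>' \<sigma>2' \<nu>' p b' A' Y'"
    and "\<And>i. length (eig' i) = p \<and> distinct (eig' i) \<and> set (eig' i) = complex_spectrum (A' i)"
    and "levy_mean_zero M' \<Lambda>'" and "levy_finite_second_moment M' \<Lambda>'"
    and "levy_variance \<sigma>2' \<nu>' = \<kappa>2"
    and "b' $ 0 \<ge> 0"
    and "\<And>i l. l \<in> complex_spectrum (A' i) \<Longrightarrow> - pi / \<Delta> \<le> Im l \<and> Im l < pi / \<Delta>"
    and "\<And>i l. l \<in> complex_spectrum (A' i) \<Longrightarrow>
           variogram_coeff (variogram M' Y') \<kappa>2 (complex_spectrum (A' i)) i l \<noteq> 0"
    and "\<And>i j. j \<le> 2 * p + 1 \<Longrightarrow>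
           variogram M Y ((real j * \<Delta>) *\<^sub>R axis i 1) = variogram M' Y' ((real j * \<Delta>) *\<^sub>R axis i 1)"
  shows "b $ 0 = b' $ 0 \<and> (\<forall>i. mset (eig i) = mset (eig' i))"
proof -
  note \<Delta> = assms(1) and car = assms(3) and eig = assms(4) and car' = assms(11) and eig' = assms(12)
  let ?S = "\<lambda>i. complex_spectrum (A i)" and ?S' = "\<lambda>i. complex_spectrum (A' i)"
  have S: "finite (?S i)" "card (?S i) = p" for i
    using eig[of i] List.finite_set[of "eig i"] distinct_card[of "eig i"] by simp_all
  have S': "finite (?S' i)" "card (?S' i) = p" for i
    using eig'[of i] List.finite_set[of "eig' i"] distinct_card[of "eig' i"] by simp_all
  note D = causal_CAR_fieldD[OF car] and D' = causal_CAR_fieldD[OF car']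
  have Re_neg: "Re l < 0" if "l \<in> ?S i \<union> ?S' i" for i l
    using that CAR_field_spectrum_Re_neg[OF car] CAR_field_spectrum_Re_neg[OF car'] by blast
  \<comment> \<open>Injectivity is wanted on the union: an eigenvalue of \<open>A i\<close> must not
    share its node with a different eigenvalue of \<open>A' i\<close>. Both spectra lie in the same
    strip.\<close>
  have inj: "inj_on (\<lambda>l. exp (l * complex_of_real \<Delta>)) (?S i \<union> ?S' i)" for i
    using assms(9,17) by (intro inj_on_exp_strip \<Delta>) blast
  have ne1: "exp (l * complex_of_real \<Delta>) \<noteq> 1" if "l \<in> ?S i \<union> ?S' i" for i l
  proof
    assume "exp (l * complex_of_real \<Delta>) = 1"
    then have "Re (l * complex_of_real \<Delta>) = 0" by (simp add: exp_eq_1)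
    then show False using Re_neg[OF that] \<Delta> by simp
  qed
  let ?\<psi> = "variogram M Y" and ?\<psi>' = "variogram M' Y'"
  \<comment> \<open>As the coefficients are nonzero by hypothesis, the spectrum is exactly the
    support of \<open>c\<close>; equal coefficient functions will therefore give equal
    spectra.\<close>
  have rep: "\<exists>c. (\<forall>l. l \<in> ?S i \<longleftrightarrow> c l \<noteq> 0) \<and> (\<forall>\<tau>. complex_of_real (?\<psi> (\<tau> *\<^sub>R axis i 1)) =
      2 * complex_of_real \<kappa>2 * (\<Sum>l\<in>?S i. c l * (1 - exp (l * complex_of_real \<bar>\<tau>\<bar>))))" for i
  proof -
    obtain c where c: "\<And>l. l \<notin> ?S i \<Longrightarrow> c l = 0" "\<And>\<tau>. complex_of_real (?\<psi> (\<tau> *\<^sub>R axis i 1)) =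
        2 * complex_of_real \<kappa>2 * (\<Sum>l\<in>?S i. c l * (1 - exp (l * complex_of_real \<bar>\<tau>\<bar>)))"
      using CAR_field_variogram(2)[OF car S assms(6), of i] assms(7) by auto
    have coeff: "variogram_coeff ?\<psi> \<kappa>2 (?S i) i = c"
      using assms(2) ne1[of _ i] inj_on_subset[OF inj[of i]]
      by (intro variogram_coeff_eq[OF S(1) _ \<Delta>] c) auto
    have "c l \<noteq> 0" if "l \<in> ?S i" for l using assms(10)[OF that] unfolding coeff .
    then show ?thesis using c by (intro exI[of _ c]) blast
  qed
  have rep': "\<exists>c. (\<forall>l. l \<in> ?S' i \<longleftrightarrow> c l \<noteq> 0) \<and> (\<forall>\<tau>. complex_of_real (?\<psi>' (\<tau> *\<^sub>R axis i 1)) =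
      2 * complex_of_real \<kappa>2 * (\<Sum>l\<in>?S' i. c l * (1 - exp (l * complex_of_real \<bar>\<tau>\<bar>))))" for i
  proof -
    obtain c where c: "\<And>l. l \<notin> ?S' i \<Longrightarrow> c l = 0" "\<And>\<tau>. complex_of_real (?\<psi>' (\<tau> *\<^sub>R axis i 1)) =
        2 * complex_of_real \<kappa>2 * (\<Sum>l\<in>?S' i. c l * (1 - exp (l * complex_of_real \<bar>\<tau>\<bar>)))"
      using CAR_field_variogram(2)[OF car' S' assms(14), of i] assms(15) by auto
    have coeff: "variogram_coeff ?\<psi>' \<kappa>2 (?S' i) i = c"
      using assms(2) ne1[of _ i] inj_on_subset[OF inj[of i]]
      by (intro variogram_coeff_eq[OF S'(1) _ \<Delta>] c) auto
    have "c l \<noteq> 0" if "l \<in> ?S' i" for l using assms(18)[OF that] unfolding coeff .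
    then show ?thesis using c by (intro exI[of _ c]) blast
  qed
  have spectra: "?S i = ?S' i" for i
  proof -
    obtain c where c: "\<And>l. l \<in> ?S i \<longleftrightarrow> c l \<noteq> 0" "\<And>\<tau>. complex_of_real (?\<psi> (\<tau> *\<^sub>R axis i 1)) =
        2 * complex_of_real \<kappa>2 * (\<Sum>l\<in>?S i. c l * (1 - exp (l * complex_of_real \<bar>\<tau>\<bar>)))"
      using rep[of i] by auto
    obtain c' where c': "\<And>l. l \<in> ?S' i \<longleftrightarrow> c' l \<noteq> 0" "\<And>\<tau>. complex_of_real (?\<psi>' (\<tau> *\<^sub>R axis i 1)) =
        2 * complex_of_real \<kappa>2 * (\<Sum>l\<in>?S' i. c' l * (1 - exp (l * complex_of_real \<bar>\<tau>\<bar>)))"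
      using rep'[of i] by auto
    \<comment> \<open>Both coefficient functions vanish outside their own spectra and can be summed
      over the union, which has at most \<open>2 * p\<close> elements; the samples up to
      \<open>card ?T\<close> are among the given ordinates.\<close>
    let ?T = "?S i \<union> ?S' i"
    have T: "finite ?T" "card ?T \<le> 2 * p" using S[of i] S'[of i] card_Un_le[of "?S i" "?S' i"] by auto
    have "c l - c' l = 0" if "l \<in> ?T" for l
    proof (rule exponential_samples_eq_0_imp_coeff_eq_0[OF T(1) inj[of i] ne1[of _ i] _ that])
      fix j assume "j \<le> card ?T"
      then have "j \<le> 2 * p + 1" using T(2) by linarith
      let ?f = "\<lambda>c l. c l * (1 - exp (l * complex_of_real \<bar>real j * \<Delta>\<bar>))"
      have "complex_of_real (?\<psi> ((real j * \<Delta>) *\<^sub>R axis i 1)) = complex_of_real (?\<psi>' ((real j * \<Delta>) *\<^sub>R axis i 1))"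
        using assms(19)[OF \<open>j \<le> 2 * p + 1\<close>] by simp
      then have "(\<Sum>l\<in>?S i. ?f c l) = (\<Sum>l\<in>?S' i. ?f c' l)"
        unfolding c(2) c'(2) using assms(2) by simp
      moreover have "(\<Sum>l\<in>?S i. ?f c l) = (\<Sum>l\<in>?T. ?f c l)"
        using T(1) c(1) by (intro sum.mono_neutral_left) auto
      moreover have "(\<Sum>l\<in>?S' i. ?f c' l) = (\<Sum>l\<in>?T. ?f c' l)"
        using T(1) c'(1) by (intro sum.mono_neutral_left) auto
      ultimately show "(\<Sum>l\<in>?T. (c l - c' l) * (1 - exp (l * complex_of_real (real j * \<Delta>)))) = 0"
        using \<Delta> by (simp add: left_diff_distrib sum_subtractf)
    qed
    then show ?thesis using c(1) c'(1) by fastforce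
  qed
  \<comment> \<open>The \<open>p\<close> common eigenvalues are roots of both monic polynomials of
    degree \<open>p\<close>, so these coincide. Equality of the matrices makes both variograms
    multiples of the same kernel integral.\<close>
  have A_eq: "A i = A' i" for i
  proof -
    obtain a where a: "degree a = p" "lead_coeff a = 1" "A i = companion_matrix a" using D(7)[of i] by blast
    obtain a' where a': "degree a' = p" "lead_coeff a' = 1" "A' i = companion_matrix a'" using D'(7)[of i] by blast
    have "a = a'"
      using complex_spectrum_companion_matrix_root[OF a(2)] complex_spectrum_companion_matrix_root[OF a'(2)]
        a(3) a'(3) spectra[of i] S[of i] by (intro monic_poly_eqI_roots[OF a(1) a'(1) a(2) a'(2), of "?S i"]) auto
    then show ?thesis using a a' by simp
  qed
  have "b $ 0 = b' $ 0"
  proof -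
    obtain i :: 'd where True by simp
    have "\<exists>j\<le>2 * p + 1. ?\<psi> ((real j * \<Delta>) *\<^sub>R axis i 1) \<noteq> 0"
    proof (rule ccontr)
      assume neg: "\<not> ?thesis"
      obtain c where c: "\<And>l. l \<in> ?S i \<longleftrightarrow> c l \<noteq> 0" "\<And>\<tau>. complex_of_real (?\<psi> (\<tau> *\<^sub>R axis i 1)) =
          2 * complex_of_real \<kappa>2 * (\<Sum>l\<in>?S i. c l * (1 - exp (l * complex_of_real \<bar>\<tau>\<bar>)))"
        using rep[of i] by auto
      have "card (?S i) > 0" using S(2) D(2) by simp
      then obtain l where l: "l \<in> ?S i" by (auto simp: card_gt_0_iff)
      have "c l = 0"
      proof (rule exponential_samples_eq_0_imp_coeff_eq_0[OF S(1) inj_on_subset[OF inj[of i]] ne1[of _ i] _ l])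
        fix j assume "j \<le> card (?S i)"
        then have "complex_of_real (?\<psi> ((real j * \<Delta>) *\<^sub>R axis i 1)) = 0" using neg S(2) by simp
        then show "(\<Sum>l\<in>?S i. c l * (1 - exp (l * complex_of_real (real j * \<Delta>)))) = 0"
          unfolding c(2) using assms(2) \<Delta> by simp
      qed auto
      then show False using l c(1) by simp
    qed
    then obtain j where j: "j \<le> 2 * p + 1" "?\<psi> ((real j * \<Delta>) *\<^sub>R axis i 1) \<noteq> 0" by blast
    have "A = A'" using A_eq by auto
    define I where "I = (LINT x|lborel. (car_kernel p A (x + (real j * \<Delta>) *\<^sub>R axis i 1) - car_kernel p A x)\<^sup>2)"
    have \<psi>: "?\<psi> ((real j * \<Delta>) *\<^sub>R axis i 1) = \<kappa>2 * (b $ 0)\<^sup>2 * I"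
      unfolding I_def assms(7)[symmetric] by (rule CAR_field_variogram(1)[OF car S assms(6)])
    have \<psi>': "?\<psi>' ((real j * \<Delta>) *\<^sub>R axis i 1) = \<kappa>2 * (b' $ 0)\<^sup>2 * I"
      unfolding I_def assms(15)[symmetric] \<open>A = A'\<close> by (rule CAR_field_variogram(1)[OF car' S' assms(14)])
    have "\<kappa>2 * (b $ 0)\<^sup>2 * I = \<kappa>2 * (b' $ 0)\<^sup>2 * I"
      using assms(19)[OF j(1), of i] unfolding \<psi> \<psi>' .
    \<comment> \<open>The ordinate at \<open>j\<close> is nonzero, hence \<open>\<kappa>2\<close>
      and \<open>I\<close> are too and can be cancelled; nonnegativity then selects the common
      square root.\<close>
    then have "(b $ 0)\<^sup>2 = (b' $ 0)\<^sup>2" using j(2) unfolding \<psi> by simp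
    then show ?thesis using assms(8,16) by simp
  qed
  moreover have "mset (eig i) = mset (eig' i)" for i
    using eig[of i] eig'[of i] spectra[of i] mset_set_set[of "eig i"] mset_set_set[of "eig' i"] by simp
  ultimately show ?thesis by blast
qed

end
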